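(* There is an absolute constant $C>0$ such that the following holds. Let $\epsilon\in(0,1)$. Let $G$ be a finite abelian group, let $A,M,L\subset G$ be nonempty, and let $B\subset G$ be a regular Bohr set of rank $d\ge1$ and radius $\rho$. Suppose $|A+S|\le K|A|$ for a subset $S\subset B$ with $\mu_B(S)=|S|/|B|\ge\sigma>0$, and assume $\eta:=|M|/|L|\le1$. Put \[ d'=C\left(\epsilon^{-2}\log^2(2/\epsilon\eta)\log(2/\eta)\log(2K)+\log(1/\sigma)\right). \] Then there is a regular Bohr set $B'\le B$ of rank at most $d+d'$ and radius at least $\rho\epsilon\eta^{1/2}/(d^2d')$ such that \[ \|1_A*1_M*1_L(\cdot+t)-1_A*1_M*1_L\|_\infty\le\epsilon|A||M|\quad\text{for all }t\in B'. \] In particular $\|1_A*1_M*1_L*\mu_{B'}-1_A*1_M*1_L\|_\infty\le\epsilon|A||M|$.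
   Context: $\widehat G$ is the group of homomorphisms $G\to\mathbb{C}^\times$. For $\Gamma\subset\widehat G$ and $\rho\ge0$, the Bohr set $\mathrm{Bohr}(\Gamma,\rho)=\{x\in G:|\gamma(x)-1|\le\rho\ \forall\gamma\in\Gamma\}$, with rank $|\Gamma|$ and radius $\rho$ (these data are considered part of the Bohr set). $\mathrm{Bohr}(\Gamma',\rho')\le\mathrm{Bohr}(\Gamma,\rho)$ (sub-Bohr set) means $\Gamma'\supset\Gamma$ and $\rho'\le\rho$. For $B=\mathrm{Bohr}(\Gamma,\rho)$ and $\delta\ge0$, $B_\delta=\mathrm{Bohr}(\Gamma,\delta\rho)$. A Bohr set $B$ of rank $d$ is regular if $1-12d|\delta|\le|B_{1+\delta}|/|B|\le1+12d|\delta|$ whenever $|\delta|\le1/(12d)$. $\mu_X=1_X/|X|$, $f*g(x)=\sum_yf(y)g(x-y)$, $\|f\|_\infty=\max_x|f(x)|$.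
   Formalization: The radius of B' is bounded below by min(ρ,2)εη^{1/2}/(d²d') instead of ρεη^{1/2}/(d²d'), since for large ρ the printed bound would force B' to be all of G and fails, e.g. for G=Z/2 and A=M=L={0}; for ρ≤2 the bounds agree. *)

theory Defs
  imports "HOL-Algebra.Coset" Complex_Main "HOL-Library.Indicator_Function" "HOL-Library.FuncSet"
begin

text \<open>
  A finite abelian group is a \<open>comm_group\<close> with finite carrier, so it is written multiplicatively:
  \<open>x - y\<close> becomes \<open>x \<otimes> inv y\<close> and \<open>A + S\<close> becomes \<open>A <#> S\<close>.
\<close>

definition complex_units :: "complex monoid" where
  "complex_units = \<lparr>carrier = - {0}, mult = (*), one = 1\<rparr>"

text \<open>
  \<open>hom\<close> does not constrain values off the carrier; extensionality makes characters
  that agree on the group equal, so that cardinalities of sets of characters are the right ones.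
\<close>

definition characters :: "('a, 'b) monoid_scheme \<Rightarrow> ('a \<Rightarrow> complex) set" where
  "characters G = hom G complex_units \<inter> extensional (carrier G)"

text \<open>
  The frequency set and the radius are part of a Bohr set, so a Bohr set is represented by
  these data, and \<open>bohr_set\<close> is its underlying set of group elements.
  On a finite group characters take values in the unit circle, so \<open>bohr_set\<close> is the whole group
  as soon as the radius is at least \<open>2\<close>. Hence a lower bound for the radius of a sub-Bohr set that is
  proportional to the radius \<open>\<rho>\<close> of the ambient one only makes sense in terms of \<open>min \<rho> 2\<close>:
  for large \<open>\<rho>\<close> a bound proportional to \<open>\<rho>\<close> itself would force the sub-Bohr set to be
  the whole group.
\<close>

datatype 'a bohr = Bohr (freqs: "('a \<Rightarrow> complex) set") (radius: real)

definition is_bohr :: "('a, 'b) monoid_scheme \<Rightarrow> 'a bohr \<Rightarrow> bool" where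
  "is_bohr G B \<longleftrightarrow> freqs B \<subseteq> characters G \<and> radius B \<ge> 0"

definition bohr_set :: "('a, 'b) monoid_scheme \<Rightarrow> 'a bohr \<Rightarrow> 'a set" where
  "bohr_set G B = {x \<in> carrier G. \<forall>\<gamma>\<in>freqs B. cmod (\<gamma> x - 1) \<le> radius B}"

definition bohr_rank :: "'a bohr \<Rightarrow> nat" where
  "bohr_rank B = card (freqs B)"

definition sub_bohr :: "'a bohr \<Rightarrow> 'a bohr \<Rightarrow> bool" where
  "sub_bohr B' B \<longleftrightarrow> freqs B \<subseteq> freqs B' \<and> radius B' \<le> radius B"

definition dilate :: "real \<Rightarrow> 'a bohr \<Rightarrow> 'a bohr" where
  "dilate \<delta> B = Bohr (freqs B) (\<delta> * radius B)"

text \<open>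
  In rank \<open>0\<close> the bound on \<open>\<delta>\<close> reads \<open>\<bar>\<delta>\<bar> \<le> 1 / 0 = 0\<close>; this is harmless, because every
  Bohr set of rank \<open>0\<close> is the whole group and hence regular under either reading.
\<close>

definition regular_bohr :: "('a, 'b) monoid_scheme \<Rightarrow> 'a bohr \<Rightarrow> bool" where
  "regular_bohr G B \<longleftrightarrow> is_bohr G B \<and>
     (\<forall>\<delta>. \<bar>\<delta>\<bar> \<le> 1 / (12 * real (bohr_rank B)) \<longrightarrow>
        1 - 12 * real (bohr_rank B) * \<bar>\<delta>\<bar>
          \<le> real (card (bohr_set G (dilate (1 + \<delta>) B))) / real (card (bohr_set G B)) \<and>
        real (card (bohr_set G (dilate (1 + \<delta>) B))) / real (card (bohr_set G B))
          \<le> 1 + 12 * real (bohr_rank B) * \<bar>\<delta>\<bar>)"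

definition convol :: "('a, 'b) monoid_scheme \<Rightarrow> ('a \<Rightarrow> real) \<Rightarrow> ('a \<Rightarrow> real) \<Rightarrow> 'a \<Rightarrow> real"
    (infixl "\<star>\<index>" 70) where
  "f \<star>\<^bsub>G\<^esub> g = (\<lambda>x. \<Sum>y\<in>carrier G. f y * g (x \<otimes>\<^bsub>G\<^esub> inv\<^bsub>G\<^esub> y))"

definition sup_norm :: "('a, 'b) monoid_scheme \<Rightarrow> ('a \<Rightarrow> real) \<Rightarrow> real" where
  "sup_norm G f = Max ((\<lambda>x. \<bar>f x\<bar>) ` carrier G)"

definition unif :: "'a set \<Rightarrow> 'a \<Rightarrow> real" where
  "unif X = (\<lambda>x. indicat_real X x / real (card X))"

end

(* Write F = 1_A * 1_M * 1_L / |A|. By Croot-Sisask sampling, 1_A * 1_L is approximated in L^{2q},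
   with q ~ log(2/eta), by averages of m ~ q k^2/eps^2 translates of 1_L; pigeonholing over samples from
   A + S gives T in S of relative density at least sigma/(2 K^m) such that F moves by at most
   O(eps |M|/k) under T - T, hence by O(eps |M|) under k(T - T), where k ~ log(2/(eps eta)).
   Averaging F over k(T - T) multiplies its Fourier coefficients by |mu_T^|^{2k}, so only the
   characters in the large spectrum of T matter up to an error 4^{-k} (|M||L|)^{1/2}. A Chang-type
   argument with Riesz products, relative to a smooth weight on the regular Bohr set B, shows that
   O(log(K^m/sigma)) further characters and a small radius suffice to make all of the large spectrum
   almost trivial. Finally the radius is decreased by a bounded factor to make the Bohr set regular. *)

theory Submission
  imports Defs "HOL-Analysis.Analysis" "HOL-Algebra.Multiplicative_Group"
begin

text \<open>Passing from the L^{2q} bound to a pointwise one costs the factor |L|/|M| to the power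
  1/(2q), which is bounded once q ~ log(2/eta). The part of the Fourier sum off the large spectrum
  is O(4^{-k} |M| eta^{-1/2}) and has to be O(eps |M|), which fixes k. As k periods are added up,
  each must be accurate to eps/k, so k enters m squared: this is the squared logarithm in
  \<open>d'\<close>. Chang's argument in all of G would give the logarithm of |G|/|T|. A weight
  living on B replaces this by the density of T in B, but then its transform does not vanish off the
  trivial character. A failing Riesz product only yields a correlation with the weight that is
  exponentially small in n ~ d'. Hence the weight is an n-fold average over a small regular Bohr set
  D: the n-th root of the correlation is bounded below by a constant. D has radius about rho/(d n),
  so that the weight stays close to B, and the regularity of D costs another factor d; this is the
  origin of d^2 d' in the final radius. Existence of regular radii is thus needed twice, for D and
  for B'.\<close>

locale finite_comm_group = comm_group G for G (structure) +
  assumes finite_carrier [simp]: "finite (carrier G)"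
begin

abbreviation cardG :: nat where
  "cardG \<equiv> card (carrier G)"

abbreviation inner :: "('a \<Rightarrow> complex) \<Rightarrow> ('a \<Rightarrow> complex) \<Rightarrow> complex" where
  "inner f g \<equiv> (\<Sum>x\<in>carrier G. f x * cnj (g x))"

declare carrier_not_empty [simp]

lemma cardG_pos [simp]: "0 < cardG" "Suc 0 \<le> cardG"
  by (simp_all add: card_gt_0_iff Suc_le_eq)

lemma sum_translate:
  assumes "g \<in> carrier G"
  shows "(\<Sum>x\<in>carrier G. f (x \<otimes> g)) = (\<Sum>x\<in>carrier G. f x)"
  by (rule sum.reindex_bij_witness[of _ "\<lambda>x. x \<otimes> inv g" "\<lambda>x. x \<otimes> g"])
     (use assms in \<open>auto simp: m_assoc\<close>)

subsection \<open>Characters and Fourier inversion\<close>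

lemma char_mult:
  "\<lbrakk>\<gamma> \<in> characters G; x \<in> carrier G; y \<in> carrier G\<rbrakk> \<Longrightarrow> \<gamma> (x \<otimes> y) = \<gamma> x * \<gamma> y"
  by (auto simp: characters_def hom_def complex_units_def)

lemma char_nonzero: "\<lbrakk>\<gamma> \<in> characters G; x \<in> carrier G\<rbrakk> \<Longrightarrow> \<gamma> x \<noteq> 0"
  by (auto simp: characters_def hom_def complex_units_def Pi_def)

lemma char_one [simp]: "\<gamma> \<in> characters G \<Longrightarrow> \<gamma> \<one> = 1"
  using char_mult[of \<gamma> \<one> \<one>] char_nonzero[of \<gamma> \<one>] by simp

lemma char_pow: "\<lbrakk>\<gamma> \<in> characters G; x \<in> carrier G\<rbrakk> \<Longrightarrow> \<gamma> (x [^] (n::nat)) = \<gamma> x ^ n"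
  by (induction n) (auto simp: char_mult)

lemma char_pow_order: "\<lbrakk>\<gamma> \<in> characters G; x \<in> carrier G\<rbrakk> \<Longrightarrow> \<gamma> x ^ cardG = 1"
  using char_pow[of \<gamma> x "cardG"] by (simp add: pow_order_eq_1[unfolded Coset.order_def])

lemma char_norm [simp]: "\<lbrakk>\<gamma> \<in> characters G; x \<in> carrier G\<rbrakk> \<Longrightarrow> cmod (\<gamma> x) = 1"
  by (metis char_pow_order norm_ge_zero norm_one norm_power cardG_pos power_eq_1_iff not_gr_zero)

lemma char_mult_cnj: "\<lbrakk>\<gamma> \<in> characters G; x \<in> carrier G\<rbrakk> \<Longrightarrow> \<gamma> x * cnj (\<gamma> x) = 1"
  by (simp add: complex_norm_square[symmetric])

lemma char_inv: 
  assumes "\<gamma> \<in> characters G" "x \<in> carrier G"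
  shows "\<gamma> (inv x) = cnj (\<gamma> x)"
proof -
  have "\<gamma> x * \<gamma> (inv x) = \<gamma> x * cnj (\<gamma> x)"
    using assms char_mult[of \<gamma> x "inv x"] by (simp add: char_mult_cnj)
  thus ?thesis using assms char_nonzero by simp
qed

lemma characterI:
  assumes "\<And>x y. \<lbrakk>x \<in> carrier G; y \<in> carrier G\<rbrakk> \<Longrightarrow> c (x \<otimes> y) = c x * c y"
    and "\<And>x. x \<in> carrier G \<Longrightarrow> c x \<noteq> 0"
  shows "restrict c (carrier G) \<in> characters G"
  using assms by (auto simp: characters_def hom_def complex_units_def Pi_def)

lemma char_prod:
  assumes "\<gamma> \<in> characters G" "\<phi> \<in> characters G"
  shows "(\<lambda>x\<in>carrier G. \<gamma> x * \<phi> x) \<in> characters G"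
  using assms by (intro characterI) (auto simp: char_mult char_nonzero)

lemma char_cnj:
  assumes "\<gamma> \<in> characters G"
  shows "(\<lambda>x\<in>carrier G. cnj (\<gamma> x)) \<in> characters G"
  using assms by (intro characterI) (auto simp: char_mult char_nonzero)

lemma char_eqI:
  "\<lbrakk>\<gamma> \<in> characters G; \<phi> \<in> characters G; \<And>x. x \<in> carrier G \<Longrightarrow> \<gamma> x = \<phi> x\<rbrakk> \<Longrightarrow> \<gamma> = \<phi>"
  by (auto simp: characters_def intro: extensionalityI)

lemma finite_characters [simp]: "finite (characters G)"
proof (rule finite_subset)
  show "characters G \<subseteq> carrier G \<rightarrow>\<^sub>E {z. z ^ cardG = 1}"
    by (auto simp: char_pow_order PiE_def) (auto simp: characters_def)
  show "finite (carrier G \<rightarrow>\<^sub>E {z::complex. z ^ cardG = 1})"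
    using cardG_pos by (intro finite_PiE finite_roots_unity) auto
qed

lemma char_orthogonal:
  assumes "\<gamma> \<in> characters G" "\<phi> \<in> characters G"
  shows "inner \<gamma> \<phi> = (if \<gamma> = \<phi> then of_nat cardG else 0)"
proof (cases "\<gamma> = \<phi>")
  case True
  then show ?thesis using assms by (simp add: char_mult_cnj)
next
  case False
  then obtain y where y: "y \<in> carrier G" "\<gamma> y \<noteq> \<phi> y" using char_eqI assms by blast
  have "inner \<gamma> \<phi> = (\<Sum>x\<in>carrier G. \<gamma> (x \<otimes> y) * cnj (\<phi> (x \<otimes> y)))"
    using sum_translate[OF y(1), of "\<lambda>x. \<gamma> x * cnj (\<phi> x)"] by simp
  also have "\<dots> = \<gamma> y * cnj (\<phi> y) * inner \<gamma> \<phi>"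
    unfolding sum_distrib_left using assms y by (intro sum.cong) (auto simp: char_mult)
  finally have "(\<gamma> y * cnj (\<phi> y) - 1) * inner \<gamma> \<phi> = 0" by (simp add: algebra_simps)
  moreover have "\<gamma> y * cnj (\<phi> y) \<noteq> 1"
  proof
    assume "\<gamma> y * cnj (\<phi> y) = 1"
    hence "\<gamma> y * (\<phi> y * cnj (\<phi> y)) = \<phi> y" by (metis mult.left_commute mult.right_neutral)
    thus False using assms y by (simp add: char_mult_cnj)
  qed
  ultimately show ?thesis using False by simp
qed

text \<open>That there are enough characters is shown without extending them from subgroups: the spectral
  projections of the translations, which have finite order and commute, decompose every function into
  joint eigenfunctions, and these are multiples of characters.\<close>

definition joint_eigen :: "'a set \<Rightarrow> ('a \<Rightarrow> complex) \<Rightarrow> bool" where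
  "joint_eigen E f \<longleftrightarrow> (\<forall>g\<in>E. \<exists>c. \<forall>x\<in>carrier G. f (x \<otimes> g) = c * f x)"

lemma cis_root_pow: "0 < n \<Longrightarrow> cis (2 * pi / real n) ^ n = 1"
  by (simp add: Complex.DeMoivre)

lemma roots_unity_sum:
  fixes n i :: nat
  assumes "0 < n" "i < n"
  shows "(\<Sum>j<n. cis (2 * pi / real n) ^ (i * j)) = (if i = 0 then of_nat n else 0)"
proof (cases "i = 0")
  case False
  let ?z = "cis (2 * pi / real n) ^ i"
  have "?z \<noteq> 1"
  proof
    assume "?z = 1"
    moreover have "?z = cis (2 * pi * real i / real n)"
      unfolding Complex.DeMoivre by (simp add: mult_ac)
    ultimately have "cis (2 * pi * real i / real n) = cis (2 * pi * real 0 / real n)" by simp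
    thus False using Complex.bij_betw_roots_unity[OF assms(1)] assms False
      by (auto simp: bij_betw_def inj_on_def)
  qed
  moreover have "?z ^ n = 1"
  proof -
    have "cis (2 * pi / real n) ^ n = 1" using assms by (intro cis_root_pow)
    thus ?thesis by (metis power_commutes power_mult power_one mult.commute)
  qed
  ultimately have "(\<Sum>j<n. ?z ^ j) = 0" by (simp add: geometric_sum)
  thus ?thesis using False by (simp add: power_mult)
qed simp

text \<open>\<open>F j\<close> is the projection of \<open>f\<close> to the eigenspace of
  translation by \<open>g\<close> with eigenvalue \<open>z\<close> to the power \<open>-j\<close>.
  These eigenvalues suffice because the order of \<open>g\<close> divides \<open>cardG\<close>, and
  the projection commutes with the other translations, so the eigenproperties for \<open>E\<close>
  survive.\<close>

lemma eigen_split: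
  assumes "joint_eigen E f" "g \<in> carrier G" "E \<subseteq> carrier G"
  obtains F where "\<And>j. j < cardG \<Longrightarrow> joint_eigen (insert g E) (F j)"
    "\<And>x. x \<in> carrier G \<Longrightarrow> f x = (\<Sum>j<cardG. F j x)"
proof -
  let ?n = "cardG"
  define z where "z = cis (2 * pi / real ?n)"
  have z0: "z \<noteq> 0" by (auto simp: z_def)
  have zn: "z ^ ?n = 1" unfolding z_def by (rule cis_root_pow) simp
  define F where "F = (\<lambda>j x. (\<Sum>i<?n. z ^ (i * j) * f (x \<otimes> g [^] i)) / of_nat ?n)"
  show thesis
  proof (rule that[of F])
    fix j assume "j < ?n"
    have "\<exists>c. \<forall>x\<in>carrier G. F j (x \<otimes> h) = c * F j x" if h: "h \<in> E" for h
    proof -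
      have "\<exists>c. \<forall>x\<in>carrier G. f (x \<otimes> h) = c * f x"
        using assms(1) h unfolding joint_eigen_def by (rule bspec)
      then obtain c where c: "\<forall>x\<in>carrier G. f (x \<otimes> h) = c * f x" ..
      have "F j (x \<otimes> h) = c * F j x" if x: "x \<in> carrier G" for x
      proof -
        have hc: "h \<in> carrier G" using h assms by auto
        have "f (x \<otimes> h \<otimes> g [^] i) = c * f (x \<otimes> g [^] i)" for i :: nat
          using c x hc assms(2) by (metis (no_types, lifting) m_assoc m_closed m_comm nat_pow_closed)
        thus ?thesis by (simp add: F_def sum_distrib_left mult_ac sum_divide_distrib)
      qed
      thus ?thesis by blast
    qed
    moreover have "F j (x \<otimes> g) = (1 / z ^ j) * F j x" if x: "x \<in> carrier G" for x
    proof -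
      define u where "u = (\<lambda>i. z ^ (i * j) * f (x \<otimes> g [^] i))"
      have "z ^ j * (\<Sum>i<?n. z ^ (i * j) * f (x \<otimes> g \<otimes> g [^] i)) = (\<Sum>i<?n. u (Suc i))"
        unfolding sum_distrib_left
      proof (rule sum.cong)
        fix i
        have "x \<otimes> g \<otimes> g [^] i = x \<otimes> g [^] (Suc i)"
          using x assms(2) by (metis m_assoc nat_pow_Suc2 nat_pow_closed)
        thus "z ^ j * (z ^ (i * j) * f (x \<otimes> g \<otimes> g [^] i)) = u (Suc i)"
          by (simp add: u_def power_add)
      qed simp
      also have "\<dots> = (\<Sum>i<?n. u i)"
      proof -
        have "u ?n = u 0" using x assms(2) zn
          by (simp add: u_def pow_order_eq_1[unfolded Coset.order_def] power_mult)
        thus ?thesis using sum.lessThan_Suc_shift[of u ?n] by simp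
      qed
      finally have "z ^ j * F j (x \<otimes> g) = F j x" by (simp add: F_def u_def)
      thus ?thesis using z0 by (simp add: field_simps)
    qed
    ultimately show "joint_eigen (insert g E) (F j)" unfolding joint_eigen_def by blast
  next
    fix x assume x: "x \<in> carrier G"
    have "(\<Sum>j<?n. F j x) = (\<Sum>i<?n. (\<Sum>j<?n. z ^ (i * j)) * f (x \<otimes> g [^] i)) / of_nat ?n"
      unfolding F_def sum_divide_distrib[symmetric] sum_distrib_right by (subst sum.swap) simp
    also have "(\<Sum>i<?n. (\<Sum>j<?n. z ^ (i * j)) * f (x \<otimes> g [^] i)) = 
       (\<Sum>i<?n. (if i = 0 then of_nat ?n * f x else 0))"
      using x by (intro sum.cong) (auto simp: z_def roots_unity_sum)
    also have "\<dots> = of_nat ?n * f x" by (simp add: sum.delta)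
    finally show "f x = (\<Sum>j<?n. F j x)" using cardG_pos by simp
  qed
qed

lemma eigen_decomposition:
  assumes "finite E" "E \<subseteq> carrier G"
  shows "\<exists>(I::nat set) F. finite I \<and> (\<forall>i\<in>I. joint_eigen E (F i)) \<and> (\<forall>x\<in>carrier G. f x = (\<Sum>i\<in>I. F i x))"
  using assms
proof (induction E rule: finite_induct)
  case empty
  show ?case by (rule exI[of _ "{0}"], rule exI[of _ "\<lambda>_. f"]) (auto simp: joint_eigen_def)
next
  case (insert g E)
  then obtain I :: "nat set" and F where F': "finite I" "\<forall>i\<in>I. joint_eigen E (F i)"
    "\<forall>x\<in>carrier G. f x = (\<Sum>i\<in>I. F i x)" by auto
  note F = F'(1) F'(2)[rule_format] F'(3)[rule_format]
  have "\<forall>i\<in>I. \<exists>H. (\<forall>j<cardG. joint_eigen (insert g E) (H j)) \<and> (\<forall>x\<in>carrier G. F i x = (\<Sum>j<cardG. H j x))"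
    using eigen_split[OF F(2)] insert.prems by (metis insert_subset)
  then obtain H where H: "\<And>i j. \<lbrakk>i \<in> I; j < cardG\<rbrakk> \<Longrightarrow> joint_eigen (insert g E) (H i j)"
    "\<And>i x. \<lbrakk>i \<in> I; x \<in> carrier G\<rbrakk> \<Longrightarrow> F i x = (\<Sum>j<cardG. H i j x)" by metis
  \<comment> \<open>Pairs of indices are coded as naturals, so that the index type stays the same
    throughout the induction.\<close>
  define J where "J = prod_encode ` (I \<times> {..<cardG})"
  define K where "K = (\<lambda>n. case_prod H (prod_decode n))"
  have "finite J" using F by (simp add: J_def)
  moreover have "\<forall>i\<in>J. joint_eigen (insert g E) (K i)" using H by (auto simp: J_def K_def)
  moreover have "f x = (\<Sum>i\<in>J. K i x)" if x: "x \<in> carrier G" for x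
  proof -
    have "(\<Sum>i\<in>J. K i x) = (\<Sum>(i,j)\<in>I \<times> {..<cardG}. H i j x)"
      unfolding J_def by (subst sum.reindex) (auto simp: K_def inj_on_def case_prod_unfold)
    also have "\<dots> = f x" using F(3)[OF x] H(2)[OF _ x] by (simp add: sum.cartesian_product[symmetric])
    finally show ?thesis by simp
  qed
  ultimately show ?case by blast
qed

text \<open>The eigenvalue of translation by \<open>g\<close> can only be
  \<open>f g / f \<one>\<close>, and eigenvalues of translations are multiplicative. If
  \<open>f \<one> = 0\<close>, then \<open>f\<close> vanishes on the group and is a multiple of the
  trivial character.\<close>

lemma joint_eigen_multiple_char:
  assumes "joint_eigen (carrier G) f"
  shows "\<exists>\<phi>\<in>characters G. \<exists>c. \<forall>x\<in>carrier G. f x = c * \<phi> x"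
proof (cases "f \<one> = 0")
  case True
  have "(\<lambda>x\<in>carrier G. 1) \<in> characters G" by (intro characterI) auto
  moreover have "\<forall>x\<in>carrier G. f x = 0"
    using assms True by (metis joint_eigen_def l_one mult_zero_right one_closed)
  ultimately show ?thesis by (metis mult_zero_left)
next
  case False
  define c where "c = (\<lambda>g. f g / f \<one>)"
  have eig: "f (x \<otimes> g) = c g * f x" if "g \<in> carrier G" "x \<in> carrier G" for g x
  proof -
    have "\<exists>e. \<forall>x\<in>carrier G. f (x \<otimes> g) = e * f x"
      using assms that(1) unfolding joint_eigen_def by (rule bspec)
    then obtain e where e: "\<forall>x\<in>carrier G. f (x \<otimes> g) = e * f x" ..
    from this[rule_format, of \<one>] have "e = c g" using that False by (simp add: c_def)
    thus ?thesis using e that by simp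
  qed
  have "restrict c (carrier G) \<in> characters G"
  proof (rule characterI)
    show *: "c (x \<otimes> y) = c x * c y" if "x \<in> carrier G" "y \<in> carrier G" for x y
      using eig[OF that(2) that(1)] by (simp add: c_def)
    show "c x \<noteq> 0" if "x \<in> carrier G" for x
      using *[of x "inv x"] that False by (auto simp: c_def)
  qed
  thus ?thesis using False by (intro bexI[of _ "restrict c (carrier G)"] exI[of _ "f \<one>"]) (auto simp: c_def)
qed

text \<open>The point mass at \<open>\<one>\<close> is a combination of characters by the
  eigenfunction decomposition. Pairing with a character determines its coefficient, which is
  \<open>1 / cardG\<close> for every character; so none is missing.\<close>

lemma char_sum:
  assumes "x \<in> carrier G"
  shows "(\<Sum>\<phi>\<in>characters G. \<phi> x) = (if x = \<one> then of_nat cardG else 0)"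
proof -
  define \<delta> :: "'a \<Rightarrow> complex" where "\<delta> = (\<lambda>x. if x = \<one> then 1 else 0)"
  obtain I :: "nat set" and F where F': "finite I" "\<forall>i\<in>I. joint_eigen (carrier G) (F i)"
    "\<forall>x\<in>carrier G. \<delta> x = (\<Sum>i\<in>I. F i x)"
    using eigen_decomposition[of "carrier G" \<delta>] by auto
  note F = F'(1) F'(2)[rule_format] F'(3)[rule_format]
  obtain X a where X: "\<And>i. i \<in> I \<Longrightarrow> X i \<in> characters G"
    "\<And>i x. \<lbrakk>i \<in> I; x \<in> carrier G\<rbrakk> \<Longrightarrow> F i x = a i * X i x"
    using joint_eigen_multiple_char[OF F(2)] by metis
  \<comment> \<open>Several eigenfunctions may be multiples of the same character, so their
    coefficients are collected.\<close>
  define b where "b = (\<lambda>\<phi>. \<Sum>i | i \<in> I \<and> X i = \<phi>. a i)"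
  have expand: "\<delta> x = (\<Sum>\<phi>\<in>characters G. b \<phi> * \<phi> x)" if x: "x \<in> carrier G" for x
  proof -
    have "(\<Sum>\<phi>\<in>characters G. b \<phi> * \<phi> x) = (\<Sum>\<phi>\<in>characters G. \<Sum>i | i \<in> I \<and> X i = \<phi>. F i x)"
      using X x by (intro sum.cong) (auto simp: b_def sum_distrib_right)
    also have "\<dots> = (\<Sum>i\<in>I. F i x)" 
      using F(1) X(1) by (intro sum.group) auto
    finally show ?thesis using F(3) x by simp
  qed
  have b: "b \<phi> * of_nat cardG = 1" if \<phi>: "\<phi> \<in> characters G" for \<phi>
  proof -
    have "1 = inner \<delta> \<phi>" using \<phi> by (simp add: \<delta>_def if_distrib[of "\<lambda>z. z * _"] sum.delta cong: if_cong)
    also have "\<dots> = (\<Sum>x\<in>carrier G. \<Sum>\<psi>\<in>characters G. b \<psi> * (\<psi> x * cnj (\<phi> x)))"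
      by (intro sum.cong) (auto simp: expand sum_distrib_right mult.assoc)
    also have "\<dots> = (\<Sum>\<psi>\<in>characters G. b \<psi> * inner \<psi> \<phi>)"
      by (subst sum.swap) (simp add: sum_distrib_left)
    also have "\<dots> = b \<phi> * of_nat cardG"
      using \<phi> by (simp add: char_orthogonal if_distrib[of "\<lambda>z. _ * z"] sum.delta cong: if_cong)
    finally show ?thesis by simp
  qed
  have "(\<Sum>\<phi>\<in>characters G. \<phi> x) = of_nat cardG * \<delta> x"
    unfolding expand[OF assms] sum_distrib_left using b by (intro sum.cong) (auto simp: mult_ac mult.assoc[symmetric])
  thus ?thesis by (simp add: \<delta>_def)
qed

lemma fourier_inversion:
  assumes x: "x \<in> carrier G"
  shows "of_nat cardG * f x = (\<Sum>\<phi>\<in>characters G. inner f \<phi> * \<phi> x)"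
proof -
  have "(\<Sum>\<phi>\<in>characters G. inner f \<phi> * \<phi> x) = (\<Sum>y\<in>carrier G. \<Sum>\<phi>\<in>characters G. f y * \<phi> (x \<otimes> inv y))"
    unfolding sum_distrib_right using x
    by (subst sum.swap) (auto intro!: sum.cong simp: char_mult char_inv)
  also have "\<dots> = (\<Sum>y\<in>carrier G. f y * (if x = y then of_nat cardG else 0))"
  proof (rule sum.cong[OF refl])
    fix y assume y: "y \<in> carrier G"
    have "x \<otimes> inv y = \<one> \<longleftrightarrow> x = y" using x y by (metis inv_equality inv_inv inv_closed r_inv)
    thus "(\<Sum>\<phi>\<in>characters G. f y * \<phi> (x \<otimes> inv y)) = f y * (if x = y then of_nat cardG else 0)"
      unfolding sum_distrib_left[symmetric] using char_sum[of "x \<otimes> inv y"] x y by simp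
  qed
  also have "\<dots> = of_nat cardG * f x" using x
    by (simp add: if_distrib[of "\<lambda>z. _ * z"] sum.delta' mult.commute cong: if_cong)
  finally show ?thesis by simp
qed

lemma parseval:
  "(\<Sum>\<phi>\<in>characters G. (cmod (inner f \<phi>))\<^sup>2) = real cardG * (\<Sum>x\<in>carrier G. (cmod (f x))\<^sup>2)"
proof -
  have "complex_of_real (\<Sum>\<phi>\<in>characters G. (cmod (inner f \<phi>))\<^sup>2)
      = (\<Sum>\<phi>\<in>characters G. \<Sum>x\<in>carrier G. cnj (f x) * (inner f \<phi> * \<phi> x))"
    unfolding of_real_sum
  proof (rule sum.cong[OF refl])
    fix \<phi>
    have "complex_of_real ((cmod (inner f \<phi>))\<^sup>2) = inner f \<phi> * cnj (inner f \<phi>)"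
      by (rule complex_norm_square)
    also have "cnj (inner f \<phi>) = (\<Sum>x\<in>carrier G. cnj (f x) * \<phi> x)" by simp
    also have "inner f \<phi> * \<dots> = (\<Sum>x\<in>carrier G. cnj (f x) * (inner f \<phi> * \<phi> x))"
      by (subst sum_distrib_left) (simp add: mult_ac)
    finally show "complex_of_real ((cmod (inner f \<phi>))\<^sup>2) = \<dots>" .
  qed
  also have "\<dots> = (\<Sum>x\<in>carrier G. cnj (f x) * (of_nat cardG * f x))"
    by (subst sum.swap) (simp add: fourier_inversion sum_distrib_left)
  also have "\<dots> = complex_of_real (real cardG * (\<Sum>x\<in>carrier G. (cmod (f x))\<^sup>2))"
    unfolding of_real_mult of_real_sum complex_norm_square sum_distrib_left
    by (intro sum.cong) (auto simp: mult_ac)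
  finally show ?thesis using of_real_eq_iff by blast
qed

end

subsection \<open>Bohr sets and regularity\<close>

lemma ln_ge_one_minus_inverse:
  fixes x :: real
  assumes "0 < x"
  shows "1 - 1 / x \<le> ln x"
  using ln_le_minus_one[of "1 / x"] assms by (simp add: ln_div)

text \<open>Up to \<open>pi / 3\<close> the mean value theorem applies with cosine at least
  \<open>1 / 2\<close>; beyond it \<open>sin x \<ge> 4 / 5\<close>, while
  \<open>x / 2 \<le> pi / 4 \<le> 4 / 5\<close>. The crude slope \<open>1 / 2\<close>
  suffices.\<close>

lemma sin_ge_half:
  assumes "0 \<le> x" "x \<le> pi / 2"
  shows "x / 2 \<le> sin x"
proof (cases "x \<le> pi / 3")
  case True
  have "\<exists>z. 0 \<le> z \<and> z \<le> x \<and> sin x - sin 0 = (x - 0) * cos z" if "0 < x"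
  proof -
    have "\<exists>z. 0 < z \<and> z < x \<and> sin x - sin 0 = (x - 0) * cos z"
      using that by (intro MVT2) (auto intro!: derivative_eq_intros)
    then obtain z where "0 < z" "z < x" "sin x - sin 0 = (x - 0) * cos z" by blast
    thus ?thesis by (intro exI[of _ z]) auto
  qed
  then obtain z where z: "0 < x \<longrightarrow> 0 \<le> z \<and> z \<le> x \<and> sin x - sin 0 = (x - 0) * cos z" by blast
  show ?thesis
  proof (cases "0 < x")
    case x0: True
    have "cos (pi / 3) \<le> cos z" using z x0 True pi_gt_zero by (intro cos_monotone_0_pi_le) auto
    hence "x * (1 / 2) \<le> x * cos z" using x0 by (intro mult_left_mono) (auto simp: cos_60)
    thus ?thesis using z x0 by simp
  qed (use assms in auto)
next
  case False
  have "sin (pi / 3) \<le> sin x" using False assms pi_gt_zero by (intro sin_monotone_2pi_le) auto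
  moreover have "sin (pi / 3) \<ge> 4 / 5"
    using real_le_rsqrt[of "8/5" 3] by (simp add: sin_60 power2_eq_square)
  moreover have "pi \<le> 16 / 5" using pi_approx by simp
  ultimately show ?thesis using assms(2) by linarith
qed

text \<open>The chord from 1 to \<open>z\<close> has length
  \<open>2 * sin (\<bar>Arg z\<bar> / 2)\<close>. Together with the reverse comparison below, this
  allows \<open>bohr_doubling\<close> to pigeonhole real arguments instead of points of the
  circle.\<close>

lemma abs_Arg_le:
  assumes "cmod z = 1"
  shows "\<bar>Arg z\<bar> \<le> 2 * cmod (z - 1)"
proof -
  let ?t = "Arg z"
  have z: "z = cis ?t" using assms by (metis cis_Arg norm_zero sgn_if sgn_eq zero_neq_one div_by_1 of_real_1)
  have t: "\<bar>?t\<bar> \<le> pi" using Arg_bounded[of z] by auto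
  have "(cmod (z - 1))\<^sup>2 = (cos ?t - 1)\<^sup>2 + (sin ?t)\<^sup>2"
    by (subst z) (simp add: cmod_power2)
  also have "\<dots> = 2 - 2 * cos (2 * (\<bar>?t\<bar> / 2))"
    using sin_cos_squared_add[of ?t] by (simp add: power2_eq_square algebra_simps)
  also have "\<dots> = (2 * sin (\<bar>?t\<bar> / 2))\<^sup>2"
    by (subst cos_double_sin) (simp add: power2_eq_square)
  finally have "(cmod (z - 1))\<^sup>2 = (2 * sin (\<bar>?t\<bar> / 2))\<^sup>2" .
  moreover have s: "\<bar>?t\<bar> / 2 / 2 \<le> sin (\<bar>?t\<bar> / 2)" using t by (intro sin_ge_half) auto
  ultimately have "cmod (z - 1) = 2 * sin (\<bar>?t\<bar> / 2)"
    using power2_eq_iff_nonneg[of "cmod (z - 1)" "2 * sin (\<bar>?t\<bar> / 2)"] by simp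
  thus ?thesis using s by simp
qed

lemma cmod_diff_le_Arg:
  assumes "cmod z = 1" "cmod w = 1"
  shows "cmod (z - w) \<le> \<bar>Arg z - Arg w\<bar>"
proof -
  have *: "u = exp (\<i> * complex_of_real (Arg u))" if "cmod u = 1" for u
    using that complex_norm_eq_1_exp_eq by metis
  have "z - w = exp (\<i> * complex_of_real (Arg w)) * (exp (\<i> * complex_of_real (Arg z - Arg w)) - 1)"
    by (subst *[OF assms(1)], subst *[OF assms(2)])
       (simp add: algebra_simps exp_add[symmetric])
  hence "cmod (z - w) = cmod (exp (\<i> * complex_of_real (Arg z - Arg w)) - 1)"
    by (simp add: norm_mult)
  also have "\<dots> = 2 * \<bar>sin ((Arg z - Arg w) / 2)\<bar>" 
    using dist_exp_i_1[of "Arg z - Arg w"] by simp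
  also have "\<dots> \<le> \<bar>Arg z - Arg w\<bar>"
    using abs_sin_x_le_abs_x[of "(Arg z - Arg w) / 2"] by simp
  finally show ?thesis .
qed

text \<open>Picking at each step an interval reaching furthest to the right produces intervals of
  which every second one is disjoint from its predecessors; this accounts for the factor 2.\<close>

lemma cover_growth_aux:
  fixes g :: "real \<Rightarrow> real"
  assumes g: "mono g" and "w \<ge> 0" and K: "finite K"
    and growth: "\<And>a b. (a, b) \<in> K \<Longrightarrow> w * (b - a) \<le> g b - g a \<and> b \<le> \<beta>"
  shows "\<lbrakk>\<And>t. \<lbrakk>s \<le> t; t \<le> s1\<rbrakk> \<Longrightarrow> \<exists>(a, b)\<in>K. a < t \<and> t < b; e \<le> s; s \<le> s1; s1 \<le> \<beta>;
      \<And>a b. \<lbrakk>(a, b) \<in> K; s < b\<rbrakk> \<Longrightarrow> e \<le> a\<rbrakk>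
    \<Longrightarrow> w * (s1 - s) \<le> (g \<beta> - g e) + (g \<beta> - g s)"
proof (induction "card {p\<in>K. s < snd p}" arbitrary: s e rule: less_induct)
  case less
  define J where "J = {p\<in>K. fst p < s \<and> s < snd p}"
  have "J \<noteq> {}" using less.prems(1)[of s] less.prems(3) by (auto simp: J_def)
  moreover have "finite J" using K by (auto simp: J_def)
  ultimately have "Max (snd ` J) \<in> snd ` J" "\<forall>q\<in>J. snd q \<le> Max (snd ` J)" by simp_all
  then obtain p where p: "p \<in> J" "\<forall>q\<in>J. snd q \<le> snd p" by auto
  obtain a b where ab: "p = (a, b)" by (cases p)
  have K': "(a, b) \<in> K" "a < s" "s < b" using p ab by (auto simp: J_def)
  have e: "e \<le> a" using less.prems(5) K' by blast
  have gr: "w * (b - a) \<le> g b - g e" "b \<le> \<beta>"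
    using growth[OF K'(1)] monoD[OF g e] by auto
  have ws: "w * (b - s) \<le> w * (b - a)" using K' \<open>w \<ge> 0\<close> by (intro mult_left_mono) auto
  show ?case
  proof (cases "b \<le> s1")
    case True
    have "{q\<in>K. b < snd q} \<subset> {q\<in>K. s < snd q}" using K' by force
    hence "card {q\<in>K. b < snd q} < card {q\<in>K. s < snd q}" using K by (intro psubset_card_mono) auto
    \<comment> \<open>By the maximal choice of \<open>b\<close>, the induction hypothesis applies
      with \<open>b\<close> and \<open>s\<close> in place of \<open>s\<close> and \<open>e\<close>.
      This lowers the right-hand side by exactly \<open>g b - g e\<close>, which pays for the
      interval just used.\<close>
    moreover have "s \<le> a'" if "(a', b') \<in> K" "b < b'" for a' b'
    proof (rule ccontr)
      assume "\<not> s \<le> a'"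
      hence "(a', b') \<in> J" using that K' by (auto simp: J_def)
      thus False using p ab that by fastforce
    qed
    ultimately have "w * (s1 - b) \<le> (g \<beta> - g s) + (g \<beta> - g b)"
      using less.prems K' True by (intro less.hyps) auto
    thus ?thesis using gr ws by (simp add: algebra_simps)
  next
    case False
    have "w * (s1 - s) \<le> w * (b - s)" using False \<open>w \<ge> 0\<close> by (intro mult_left_mono) auto
    moreover have "g b \<le> g \<beta>" "g s \<le> g \<beta>" using g gr less.prems by (auto intro: monoD)
    ultimately show ?thesis using gr ws by linarith
  qed
qed

text \<open>A Vitali-type covering bound: the intervals contain their points strictly, so they form
  an open cover and compactness leaves finitely many for the greedy selection.\<close>

lemma cover_growth:
  fixes g :: "real \<Rightarrow> real"
  assumes g: "mono g" and w: "w \<ge> 0" and s: "s0 \<le> s1"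
    and cov: "\<And>s. \<lbrakk>s0 \<le> s; s \<le> s1\<rbrakk> \<Longrightarrow> \<exists>a b. a < s \<and> s < b \<and> \<alpha> \<le> a \<and> b \<le> \<beta> \<and> w * (b - a) \<le> g b - g a"
  shows "w * (s1 - s0) \<le> 2 * (g \<beta> - g \<alpha>)"
proof -
  define \<K> where "\<K> = {(a, b). \<alpha> \<le> a \<and> b \<le> \<beta> \<and> w * (b - a) \<le> g b - g a}"
  have "{s0..s1} \<subseteq> (\<Union>p\<in>\<K>. {fst p<..<snd p})"
    using cov by (fastforce simp: \<K>_def)
  then obtain K where K: "K \<subseteq> \<K>" "finite K" "{s0..s1} \<subseteq> (\<Union>p\<in>K. {fst p<..<snd p})"
    by (rule compactE_image[OF compact_Icc, rotated]) auto
  obtain a b where "\<alpha> \<le> a" "a < s0" "s0 < b" using cov[of s0] s by auto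
  hence \<alpha>: "\<alpha> \<le> s0" by simp
  obtain a b where "s1 < b" "b \<le> \<beta>" using cov[of s1] s by auto
  hence \<beta>: "s1 \<le> \<beta>" by simp
  have "w * (s1 - s0) \<le> (g \<beta> - g \<alpha>) + (g \<beta> - g s0)"
  proof (rule cover_growth_aux[OF g w K(2)])
    show "\<And>a b. (a, b) \<in> K \<Longrightarrow> w * (b - a) \<le> g b - g a \<and> b \<le> \<beta>"
      "\<And>a b. \<lbrakk>(a, b) \<in> K; s0 < b\<rbrakk> \<Longrightarrow> \<alpha> \<le> a"
      using K(1) by (auto simp: \<K>_def)
    show "\<exists>(a, b)\<in>K. a < t \<and> t < b" if "s0 \<le> t" "t \<le> s1" for t
      using K(3) that by (fastforce simp: subset_iff)
  qed (use \<alpha> \<beta> s in auto)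
  moreover have "g \<alpha> \<le> g s0" using g \<alpha> by (auto intro: monoD)
  ultimately show ?thesis by simp
qed

context finite_comm_group
begin

section \<open>Elementary properties of Bohr sets and their sizes\<close>

lemma bohr_subset: "bohr_set G B \<subseteq> carrier G"
  by (auto simp: bohr_set_def)

lemma finite_bohr [simp]: "finite (bohr_set G B)"
  using bohr_subset finite_carrier by (rule finite_subset)

lemma mem_bohr: "x \<in> bohr_set G (Bohr \<Gamma> r) \<longleftrightarrow> x \<in> carrier G \<and> (\<forall>\<gamma>\<in>\<Gamma>. cmod (\<gamma> x - 1) \<le> r)"
  by (simp add: bohr_set_def)

lemma bohr_mono: "r \<le> s \<Longrightarrow> bohr_set G (Bohr \<Gamma> r) \<subseteq> bohr_set G (Bohr \<Gamma> s)"
  by (force simp: bohr_set_def)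

lemma one_in_bohr: "\<lbrakk>\<Gamma> \<subseteq> characters G; 0 \<le> r\<rbrakk> \<Longrightarrow> \<one> \<in> bohr_set G (Bohr \<Gamma> r)"
  by (auto simp: bohr_set_def subset_iff)

lemma card_bohr_pos: "\<lbrakk>\<Gamma> \<subseteq> characters G; 0 \<le> r\<rbrakk> \<Longrightarrow> 0 < card (bohr_set G (Bohr \<Gamma> r))"
  using one_in_bohr card_gt_0_iff finite_bohr by blast

lemma card_bohr_mono: "r \<le> s \<Longrightarrow> card (bohr_set G (Bohr \<Gamma> r)) \<le> card (bohr_set G (Bohr \<Gamma> s))"
  by (intro card_mono bohr_mono) auto

lemma char_mult_minus_one:
  assumes "\<gamma> \<in> characters G" "x \<in> carrier G" "y \<in> carrier G"
  shows "cmod (\<gamma> (x \<otimes> y) - 1) \<le> cmod (\<gamma> x - 1) + cmod (\<gamma> y - 1)"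
proof -
  have "\<gamma> (x \<otimes> y) - 1 = \<gamma> x * (\<gamma> y - 1) + (\<gamma> x - 1)" using assms by (simp add: char_mult algebra_simps)
  also have "cmod \<dots> \<le> cmod (\<gamma> x * (\<gamma> y - 1)) + cmod (\<gamma> x - 1)" by (rule norm_triangle_ineq)
  finally show ?thesis using assms by (simp add: norm_mult)
qed

lemma char_inv_minus_one:
  assumes "\<gamma> \<in> characters G" "x \<in> carrier G"
  shows "cmod (\<gamma> (inv x) - 1) = cmod (\<gamma> x - 1)"
proof -
  have "\<gamma> (inv x) - 1 = cnj (\<gamma> x - 1)" using assms by (simp add: char_inv)
  thus ?thesis by (simp only: complex_mod_cnj)
qed

lemma bohr_mult:
  assumes "\<Gamma> \<subseteq> characters G" "x \<in> bohr_set G (Bohr \<Gamma> r)" "y \<in> bohr_set G (Bohr \<Gamma> s)"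
  shows "x \<otimes> y \<in> bohr_set G (Bohr \<Gamma> (r + s))"
proof -
  have xy: "x \<in> carrier G" "y \<in> carrier G" using assms by (auto simp: mem_bohr)
  have "cmod (\<gamma> (x \<otimes> y) - 1) \<le> r + s" if "\<gamma> \<in> \<Gamma>" for \<gamma>
  proof -
    have "\<gamma> \<in> characters G" "cmod (\<gamma> x - 1) \<le> r" "cmod (\<gamma> y - 1) \<le> s"
      using assms that by (auto simp: mem_bohr)
    thus ?thesis using char_mult_minus_one[OF _ xy, of \<gamma>] by simp
  qed
  thus ?thesis using xy by (simp add: mem_bohr)
qed

lemma bohr_inv:
  assumes "\<Gamma> \<subseteq> characters G" "x \<in> bohr_set G (Bohr \<Gamma> r)"
  shows "inv x \<in> bohr_set G (Bohr \<Gamma> r)"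
  using assms char_inv_minus_one by (auto simp: mem_bohr subset_iff)

text \<open>Pigeonhole: on the larger Bohr set the arguments of each character lie in an interval of
  length \<open>4 * R\<close>, which meets at most \<open>M\<close> cells of length
  \<open>D\<close>. Dividing the elements of one cell by a fixed one maps it injectively into the
  Bohr set of radius \<open>D\<close>.\<close>

lemma bohr_doubling:
  assumes \<Gamma>: "\<Gamma> \<subseteq> characters G" and D: "0 < D" and M: "4 * R / D + 2 \<le> real M"
  shows "card (bohr_set G (Bohr \<Gamma> R)) \<le> M ^ card \<Gamma> * card (bohr_set G (Bohr \<Gamma> D))"
proof (cases "bohr_set G (Bohr \<Gamma> R) = {}")
  case False
  let ?B = "bohr_set G (Bohr \<Gamma> R)"
  have fin: "finite \<Gamma>" using finite_subset[OF \<Gamma> finite_characters] .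
  define cell where "cell = (\<lambda>x. \<lambda>\<gamma>\<in>\<Gamma>. \<lfloor>Arg (\<gamma> x) / D\<rfloor>)"
  define P where "P = \<Gamma> \<rightarrow>\<^sub>E {\<lfloor>- 2 * R / D\<rfloor>..\<lfloor>2 * R / D\<rfloor>}"
  have unit: "cmod (\<gamma> x) = 1" if "\<gamma> \<in> \<Gamma>" "x \<in> ?B" for \<gamma> x
    using that \<Gamma> by (auto simp: mem_bohr)
  have cell: "cell x \<in> P" if x: "x \<in> ?B" for x
  proof -
    have "\<lfloor>Arg (\<gamma> x) / D\<rfloor> \<in> {\<lfloor>- 2 * R / D\<rfloor>..\<lfloor>2 * R / D\<rfloor>}" if "\<gamma> \<in> \<Gamma>" for \<gamma>
    proof -
      have "\<bar>Arg (\<gamma> x)\<bar> \<le> 2 * R" using abs_Arg_le[OF unit[OF that x]] x that by (fastforce simp: mem_bohr)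
      hence "- 2 * R / D \<le> Arg (\<gamma> x) / D" "Arg (\<gamma> x) / D \<le> 2 * R / D"
        using D by (intro divide_right_mono; simp)+
      thus ?thesis by (auto intro: floor_mono)
    qed
    thus ?thesis by (auto simp: P_def cell_def)
  qed
  have finP: "finite P" using fin by (simp add: P_def finite_PiE)
  have Pne: "P \<noteq> {}" using cell False by auto
  have fibre: "card (cell -` {c} \<inter> ?B) \<le> card (bohr_set G (Bohr \<Gamma> D))" for c
  proof (cases "cell -` {c} \<inter> ?B = {}")
    case False
    then obtain y where y: "cell y = c" "y \<in> ?B" by auto
    have "x \<otimes> inv y \<in> bohr_set G (Bohr \<Gamma> D)" if x: "cell x = c" "x \<in> ?B" for x
    proof -
      have xy: "x \<in> carrier G" "y \<in> carrier G" using x y by (auto simp: mem_bohr)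
      have "cmod (\<gamma> (x \<otimes> inv y) - 1) \<le> D" if g: "\<gamma> \<in> \<Gamma>" for \<gamma>
      proof -
        have gc: "\<gamma> \<in> characters G" using g \<Gamma> by auto
        have "\<lfloor>Arg (\<gamma> x) / D\<rfloor> = \<lfloor>Arg (\<gamma> y) / D\<rfloor>"
          using x y g by (auto simp: cell_def dest: fun_cong[of _ _ \<gamma>])
        hence "\<bar>Arg (\<gamma> x) / D - Arg (\<gamma> y) / D\<bar> \<le> 1" by linarith
        hence "\<bar>Arg (\<gamma> x) - Arg (\<gamma> y)\<bar> \<le> D" using D by (simp add: diff_divide_distrib[symmetric])
        hence "cmod (\<gamma> x - \<gamma> y) \<le> D"
          using cmod_diff_le_Arg[OF unit[OF g x(2)] unit[OF g y(2)]] by simp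
        moreover have "\<gamma> (x \<otimes> inv y) - 1 = cnj (\<gamma> y) * (\<gamma> x - \<gamma> y)"
          using char_mult_cnj[OF gc xy(2)] xy gc by (simp add: char_mult char_inv algebra_simps)
        ultimately show ?thesis using unit[OF g y(2)] by (simp add: norm_mult)
      qed
      thus ?thesis using xy by (simp add: mem_bohr)
    qed
    hence "(\<lambda>x. x \<otimes> inv y) ` (cell -` {c} \<inter> ?B) \<subseteq> bohr_set G (Bohr \<Gamma> D)" by auto
    moreover have "inj_on (\<lambda>x. x \<otimes> inv y) (cell -` {c} \<inter> ?B)"
      using y bohr_subset by (intro inj_onI) (auto simp: mem_bohr)
    ultimately show ?thesis by (intro card_inj_on_le) auto
  qed simp
  have "card ?B = (\<Sum>c\<in>P. card (cell -` {c} \<inter> ?B))"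
  proof -
    have "?B = (\<Union>c\<in>P. cell -` {c} \<inter> ?B)" using cell by auto
    hence "card ?B = card (\<Union>c\<in>P. cell -` {c} \<inter> ?B)" by (rule arg_cong)
    also have "\<dots> = (\<Sum>c\<in>P. card (cell -` {c} \<inter> ?B))"
      using finP by (intro card_UN_disjoint) auto
    finally show ?thesis .
  qed
  also have "\<dots> \<le> (\<Sum>c\<in>P. card (bohr_set G (Bohr \<Gamma> D)))" by (intro sum_mono fibre)
  also have "\<dots> = card P * card (bohr_set G (Bohr \<Gamma> D))" by simp
  also have "card P \<le> M ^ card \<Gamma>"
  proof -
    have "card {\<lfloor>- 2 * R / D\<rfloor>..\<lfloor>2 * R / D\<rfloor>} \<le> M"
    proof -
      have "real_of_int (\<lfloor>2 * R / D\<rfloor> - \<lfloor>- 2 * R / D\<rfloor> + 1) \<le> real M"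
        using M by simp linarith
      thus ?thesis by simp
    qed
    thus ?thesis using fin by (simp add: P_def card_PiE power_mono)
  qed
  finally show ?thesis by simp
qed simp

text \<open>A radius at which regularity fails lies in an interval, in logarithmic scale, on which \<open>ln |B|\<close>
  grows at rate more than \<open>6 d\<close>. If all radii in \<open>[r/8, r]\<close> were bad, the covering lemma would give
  growth \<open>9 d ln 2\<close>, while doubling allows at most \<open>8 d ln 2\<close>.\<close>

lemma regular_bohr_exists:
  assumes \<Gamma>: "\<Gamma> \<subseteq> characters G" and d: "1 \<le> card \<Gamma>" and r: "0 \<le> r"
  shows "\<exists>r'. r / 8 \<le> r' \<and> r' \<le> r \<and> regular_bohr G (Bohr \<Gamma> r')"
proof (cases "r = 0")
  case True
  have "regular_bohr G (Bohr \<Gamma> 0)"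
    using card_bohr_pos[OF \<Gamma>, of 0] \<Gamma>
    by (auto simp: regular_bohr_def is_bohr_def dilate_def bohr_rank_def)
  thus ?thesis using True by auto
next
  case False
  hence r: "0 < r" using r by simp
  show ?thesis
  proof (rule ccontr)
    assume "\<not> ?thesis"
    hence bad: "\<not> regular_bohr G (Bohr \<Gamma> \<kappa>)" if "r / 8 \<le> \<kappa>" "\<kappa> \<le> r" for \<kappa> using that by blast
    define d where "d = real (card \<Gamma>)"
    have d1: "1 \<le> d" using d by (simp add: d_def)
    define N where "N = (\<lambda>t. real (card (bohr_set G (Bohr \<Gamma> t))))"
    have Npos: "0 < N t" if "0 \<le> t" for t using card_bohr_pos[OF \<Gamma> that] by (simp add: N_def)
    have Nmono: "N t \<le> N u" if "t \<le> u" for t u using card_bohr_mono[OF that] by (simp add: N_def)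
    define g where "g = (\<lambda>t. ln (N (exp t)))"
    have g: "mono g" unfolding g_def by (intro monoI ln_mono Npos Nmono) auto
    \<comment> \<open>A factor 2 is added on both sides of the range from \<open>r / 8\<close> to
      \<open>r\<close>, to leave room for the intervals around its end points.\<close>
    define \<alpha> \<beta> where "\<alpha> = ln (r / 16)" and "\<beta> = ln (2 * r)"
    have cov: "\<exists>a b. a < s \<and> s < b \<and> \<alpha> \<le> a \<and> b \<le> \<beta> \<and> (6 * d) * (b - a) \<le> g b - g a"
      if s: "ln (r / 8) \<le> s" "s \<le> ln r" for s
    proof -
      define \<kappa> where "\<kappa> = exp s"
      have \<kappa>: "0 < \<kappa>" "s = ln \<kappa>" by (auto simp: \<kappa>_def)
      have "r / 8 \<le> \<kappa>" "\<kappa> \<le> r" 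
        using s r exp_le_cancel_iff[of "ln (r / 8)" s] exp_le_cancel_iff[of s "ln r"] by (auto simp: \<kappa>_def)
      hence "\<not> regular_bohr G (Bohr \<Gamma> \<kappa>)" by (rule bad)
      then obtain \<delta> where \<delta>: "\<bar>\<delta>\<bar> \<le> 1 / (12 * d)"
        "N ((1 + \<delta>) * \<kappa>) / N \<kappa> < 1 - 12 * d * \<bar>\<delta>\<bar> \<or> 1 + 12 * d * \<bar>\<delta>\<bar> < N ((1 + \<delta>) * \<kappa>) / N \<kappa>"
        using \<Gamma> \<kappa> by (auto simp: regular_bohr_def is_bohr_def dilate_def bohr_rank_def d_def N_def not_le)
      define u where "u = 12 * d * \<bar>\<delta>\<bar>"
      have u: "0 \<le> u" "u \<le> 1" using \<delta>(1) d1 by (auto simp: u_def field_simps)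
      have \<delta>12: "\<bar>\<delta>\<bar> \<le> 1 / 12"
      proof -
        have "1 / (12 * d) \<le> 1 / 12" using d1 by simp
        thus ?thesis using \<delta>(1) by linarith
      qed
      define v where "v = ln (1 + \<delta>)"
      have v: "ln (11 / 12) \<le> v" "v \<le> ln (13 / 12)" unfolding v_def using \<delta>12 by (intro ln_mono; simp)+
      have gs: "g s = ln (N \<kappa>)" by (simp add: g_def \<kappa>_def)
      have gv: "g (s + v) = ln (N ((1 + \<delta>) * \<kappa>))"
        using \<delta>12 by (simp add: g_def \<kappa>_def v_def exp_add mult.commute)
      have Np: "0 < N \<kappa>" "0 < N ((1 + \<delta>) * \<kappa>)" using \<kappa> \<delta>12 by (auto intro!: Npos)
      define \<rho> where "\<rho> = N ((1 + \<delta>) * \<kappa>) / N \<kappa>"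
      have \<rho>: "0 < \<rho>" "g (s + v) - g s = ln \<rho>" using Np by (simp_all add: \<rho>_def gv gs ln_div)
      \<comment> \<open>For positive \<open>\<delta>\<close> the growth exceeds
        \<open>ln (1 + u) \<ge> u / 2 = 6 * d * \<delta>\<close> over a length at most
        \<open>\<delta>\<close>. Otherwise it exceeds
        \<open>u = 12 * d * \<bar>\<delta>\<bar>\<close> over a length at most
        \<open>2 * \<bar>\<delta>\<bar>\<close>. Either way the rate is above
        \<open>6 * d\<close>.\<close>
      have "\<exists>p q. p \<le> s \<and> s \<le> q \<and> s + ln (11 / 12) \<le> p \<and> q \<le> s + ln (13 / 12) \<and> (6 * d) * (q - p) < g q - g p"
      proof (cases "\<delta> > 0")
        case True
        have "1 \<le> \<rho>" using Nmono[of \<kappa> "(1 + \<delta>) * \<kappa>"] True \<kappa> Np by (simp add: \<rho>_def)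
        hence "1 + u < \<rho>" using \<delta>(2) u by (auto simp: \<rho>_def u_def)
        hence "ln (1 + u) < ln \<rho>" using u by (intro ln_less_cancel_iff[THEN iffD2]) auto
        moreover have "u / 2 \<le> ln (1 + u)"
        proof -
          have "u / 2 \<le> 1 - 1 / (1 + u)" using u mult_left_mono[OF u(2) u(1)] by (simp add: field_simps)
          thus ?thesis using ln_ge_one_minus_inverse[of "1 + u"] u by simp
        qed
        moreover have "6 * d * v \<le> 6 * d * \<delta>" using True d1 by (simp add: v_def ln_add_one_self_le_self)
        moreover have "0 \<le> v" using True by (simp add: v_def)
        moreover have "u / 2 = 6 * d * \<delta>" using True by (simp add: u_def)
        ultimately have "6 * d * (s + v - s) < g (s + v) - g s" "0 \<le> v" using \<rho> by simp_all
        thus ?thesis using v ln_le_minus_one[of "11/12"]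
          by (intro exI[of _ s] exI[of _ "s + v"]) auto
      next
        case False
        have "\<rho> \<le> 1" using Nmono[of "(1 + \<delta>) * \<kappa>" \<kappa>] False \<kappa> Np by (simp add: \<rho>_def)
        hence r1: "\<rho> < 1 - u" using \<delta>(2) u by (auto simp: \<rho>_def u_def)
        hence u1: "0 < 1 - u" using \<rho> by simp
        hence "ln \<rho> < ln (1 - u)" using r1 \<rho> by simp
        moreover have "ln (1 - u) \<le> - u" using ln_le_minus_one[of "1 - u"] u1 by simp
        moreover have "6 * d * (- v) \<le> 6 * d * (2 * \<bar>\<delta>\<bar>)"
        proof (intro mult_left_mono)
          have "1 - 1 / (1 + \<delta>) \<ge> 2 * \<delta>"
            using False \<delta>12 mult_nonneg_nonneg[of "- \<delta>" "1 + 2 * \<delta>"] by (simp add: field_simps)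
          thus "- v \<le> 2 * \<bar>\<delta>\<bar>" using ln_ge_one_minus_inverse[of "1 + \<delta>"] \<delta>12 False by (simp add: v_def)
        qed (use d1 in auto)
        moreover have "v \<le> 0" using False \<delta>12 by (simp add: v_def)
        moreover have "u = 6 * d * (2 * \<bar>\<delta>\<bar>)" by (simp add: u_def)
        ultimately have "6 * d * (s - (s + v)) < g s - g (s + v)" "v \<le> 0" using \<rho> by simp_all
        thus ?thesis using v ln_ge_one_minus_inverse[of "13/12"]
          by (intro exI[of _ "s + v"] exI[of _ s]) auto
      qed
      then obtain p q where pq: "p \<le> s" "s \<le> q" "s + ln (11 / 12) \<le> p" "q \<le> s + ln (13 / 12)"
        "(6 * d) * (q - p) < g q - g p" by blast
      \<comment> \<open>So far \<open>s\<close> is an end point of the interval. The strictness of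
        the growth inequality pays for widening it by \<open>h\<close> on both sides, which makes
        \<open>s\<close> an interior point; the cap \<open>1 / 10\<close> keeps it between
        \<open>\<alpha>\<close> and \<open>\<beta>\<close>.\<close>
      define h where "h = min (1 / 10) ((g q - g p - (6 * d) * (q - p)) / (12 * d))"
      have h: "0 < h" "h \<le> 1 / 10" using pq d1 by (auto simp: h_def)
      have "12 * d * h \<le> 12 * d * ((g q - g p - (6 * d) * (q - p)) / (12 * d))"
        using d1 by (intro mult_left_mono) (auto simp: h_def)
      hence "12 * d * h \<le> g q - g p - (6 * d) * (q - p)" using d1 by simp
      hence "(6 * d) * ((q + h) - (p - h)) \<le> g q - g p" by (simp add: algebra_simps)
      also have "\<dots> \<le> g (q + h) - g (p - h)"
        using h by (intro diff_mono monoD[OF g]) auto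
      finally have "(6 * d) * ((q + h) - (p - h)) \<le> g (q + h) - g (p - h)" .
      moreover have "\<alpha> \<le> p - h"
      proof -
        have "\<alpha> + ln (11 / 6) = ln (r / 8) + ln (11 / 12)"
          using r by (simp add: \<alpha>_def ln_mult_pos[symmetric])
        moreover have "1 / 10 \<le> ln (11 / 6 :: real)" using ln_ge_one_minus_inverse[of "11/6"] by simp
        ultimately show ?thesis using pq s h by linarith
      qed
      moreover have "q + h \<le> \<beta>"
      proof -
        have "\<beta> = (ln r + ln (13 / 12)) + ln (24 / 13)"
          using r by (simp add: \<beta>_def ln_mult_pos[symmetric])
        moreover have "1 / 10 \<le> ln (24 / 13 :: real)" using ln_ge_one_minus_inverse[of "24/13"] by simp
        ultimately show ?thesis using pq s h by linarith
      qed
      ultimately show ?thesis using pq h by (intro exI[of _ "p - h"] exI[of _ "q + h"]) auto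
    qed
    have "(6 * d) * (ln r - ln (r / 8)) \<le> 2 * (g \<beta> - g \<alpha>)"
      using r d1 by (intro cover_growth g cov) auto
    moreover have "ln r - ln (r / 8) = 3 * ln 2"
    proof -
      have "ln (8::real) = ln (2 ^ 3)" by simp
      also have "\<dots> = 3 * ln 2" by (subst ln_realpow) auto
      finally show ?thesis using r by (simp add: ln_div)
    qed
    moreover have "g \<beta> - g \<alpha> \<le> 8 * d * ln 2"
    proof -
      \<comment> \<open>The radii have ratio 32, so \<open>4 * 32 + 2 = 130\<close> cells would do;
        256 is the next power of 2.\<close>
      have "card (bohr_set G (Bohr \<Gamma> (2 * r))) \<le> 256 ^ card \<Gamma> * card (bohr_set G (Bohr \<Gamma> (r / 16)))"
        using r by (intro bohr_doubling \<Gamma>) auto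
      hence "real (card (bohr_set G (Bohr \<Gamma> (2 * r)))) \<le> real (256 ^ card \<Gamma> * card (bohr_set G (Bohr \<Gamma> (r / 16))))"
        by (simp only: of_nat_le_iff)
      hence "N (2 * r) \<le> (2 ^ 8) ^ card \<Gamma> * N (r / 16)" by (simp add: N_def)
      hence "ln (N (2 * r)) \<le> ln ((2 ^ 8) ^ card \<Gamma> * N (r / 16))"
        using r by (intro ln_mono Npos) auto
      also have "\<dots> = 8 * d * ln 2 + ln (N (r / 16))"
        using ln_realpow[of 2 8] Npos[of "r / 16"] r by (subst ln_mult_pos) (auto simp: ln_realpow power_mult[symmetric] d_def)
      finally show ?thesis using r by (simp add: g_def \<alpha>_def \<beta>_def)
    qed
    ultimately have "18 * (d * ln 2) \<le> 16 * (d * ln 2)" by (simp add: algebra_simps)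
    moreover have "0 < d * ln 2" using d1 by simp
    ultimately show False by linarith
  qed
qed

end

subsection \<open>Almost periods by random sampling\<close>

lemma exp_le_quadratic:
  fixes y :: real
  assumes "\<bar>y\<bar> \<le> 1"
  shows "exp y \<le> 1 + y + y\<^sup>2"
proof (cases "0 \<le> y")
  case True
  then show ?thesis using exp_bound[of y] assms by simp
next
  case False
  define x where "x = - y"
  have x: "0 < x" "x \<le> 1" using False assms by (auto simp: x_def)
  have "1 \<le> (1 - x + x\<^sup>2) * (1 + x)" using x by (simp add: power2_eq_square algebra_simps)
  also have "\<dots> \<le> (1 - x + x\<^sup>2) * exp x" using x by (intro mult_left_mono) auto
  finally have "exp (- x) \<le> 1 - x + x\<^sup>2" by (simp add: exp_minus field_simps)
  thus ?thesis by (simp add: x_def)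
qed

text \<open>All terms of the power series are nonnegative, so two of them may be kept. The constant
  term is retained because it cancels against the 1 in \<open>exp_mult_le_chord\<close>.\<close>

lemma power_div_fact_le_cosh:
  fixes x :: real
  assumes "0 < q"
  shows "1 + x ^ (2 * q) / fact (2 * q) \<le> cosh x"
proof -
  let ?f = "\<lambda>n. if even n then x ^ n /\<^sub>R fact n else 0"
  have f: "?f sums cosh x" using cosh_converges[of x] by simp
  have "sum ?f {0, 2 * q} \<le> suminf ?f"
    using f by (intro sum_le_suminf) (auto simp: sums_iff zero_le_even_power)
  thus ?thesis using f assms by (simp add: sums_iff divide_inverse mult.commute)
qed

text \<open>Convexity of \<open>exp\<close> between 0 and \<open>c\<close>. It bounds
  \<open>exp (c * p) - 1\<close> linearly in \<open>p\<close>, which is how \<open>p\<close> gets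
  out of the exponent.\<close>

lemma exp_mult_le_chord:
  fixes p c :: real
  assumes "0 \<le> p" "p \<le> 1"
  shows "exp (c * p) \<le> 1 + p * (exp c - 1)"
  using convex_onD[OF exp_convex, where t=p and x=0 and y=c] assms by (simp add: algebra_simps)

text \<open>The linear term averages out and the quadratic one is the variance
  \<open>p - p\<^sup>2 \<le> p\<close> of a 0/1 variable. This is the contribution of one coordinate
  of a sample.\<close>

lemma centred_exp_moment:
  fixes h :: "'b \<Rightarrow> real"
  assumes A: "finite A" "A \<noteq> {}" and h: "\<And>a. a \<in> A \<Longrightarrow> h a \<in> {0, 1}"
    and p: "p = (\<Sum>a\<in>A. h a) / real (card A)" and l: "\<bar>l\<bar> \<le> 1"
  shows "(\<Sum>a\<in>A. exp (l * (h a - p))) \<le> real (card A) * exp (l\<^sup>2 * p)"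
proof -
  have cA: "0 < real (card A)" using A by (simp add: card_gt_0_iff)
  have sh: "(\<Sum>a\<in>A. h a) = real (card A) * p" using cA p by simp
  have sh2: "(\<Sum>a\<in>A. (h a)\<^sup>2) = real (card A) * p"
    unfolding sh[symmetric] using h by (intro sum.cong) force+
  have "0 \<le> (\<Sum>a\<in>A. h a)" using h by (intro sum_nonneg) force
  moreover have "(\<Sum>a\<in>A. h a) \<le> (\<Sum>a\<in>A. 1)" using h by (intro sum_mono) force
  ultimately have p01: "0 \<le> p" "p \<le> 1" using cA by (auto simp: p field_simps)
  have "(\<Sum>a\<in>A. exp (l * (h a - p))) \<le> (\<Sum>a\<in>A. 1 + l * (h a - p) + (l * (h a - p))\<^sup>2)"
  proof (intro sum_mono exp_le_quadratic)
    fix a assume "a \<in> A"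
    hence "\<bar>h a - p\<bar> \<le> 1" using h[of a] p01 by auto
    thus "\<bar>l * (h a - p)\<bar> \<le> 1" using l mult_mono[of "\<bar>l\<bar>" 1 "\<bar>h a - p\<bar>" 1] by (simp add: abs_mult)
  qed
  also have "\<dots> = (\<Sum>a\<in>A. (1 - l * p + l\<^sup>2 * p\<^sup>2) + (l - 2 * l\<^sup>2 * p) * h a + l\<^sup>2 * (h a)\<^sup>2)"
    by (intro sum.cong) (simp_all add: power2_eq_square algebra_simps)
  also have "\<dots> = real (card A) * (1 - l * p + l\<^sup>2 * p\<^sup>2) + (l - 2 * l\<^sup>2 * p) * (real (card A) * p)
      + l\<^sup>2 * (real (card A) * p)"
    unfolding sum.distrib sum_distrib_left[symmetric] sum_constant sh sh2 by (simp add: algebra_simps)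
  also have "\<dots> = real (card A) * (1 + l\<^sup>2 * (p - p\<^sup>2))"
    by (simp add: power2_eq_square algebra_simps)
  also have "\<dots> \<le> real (card A) * (1 + l\<^sup>2 * p)"
    using cA by (intro mult_left_mono add_mono) auto
  also have "\<dots> \<le> real (card A) * exp (l\<^sup>2 * p)" using cA by (intro mult_left_mono) auto
  finally show ?thesis .
qed

text \<open>Bounding \<open>cosh - 1\<close> rather than the exponential keeps the factor \<open>p\<close>, without which the
  bound could not be summed over the group.\<close>

lemma centred_moment:
  fixes h :: "'b \<Rightarrow> real"
  assumes A: "finite A" "A \<noteq> {}" and h: "\<And>a. a \<in> A \<Longrightarrow> h a \<in> {0, 1}"
    and p: "p = (\<Sum>a\<in>A. h a) / real (card A)" and q: "0 < q" "q \<le> m"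
  shows "(\<Sum>a\<in>{..<m} \<rightarrow>\<^sub>E A. (\<Sum>i<m. h (a i) - p) ^ (2 * q))
           \<le> real (card A) ^ m * (12 * real q * real m) ^ q * p"
proof -
  have cA: "0 < real (card A)" using A by (simp add: card_gt_0_iff)
  have "0 \<le> (\<Sum>a\<in>A. h a)" using h by (intro sum_nonneg) force
  moreover have "(\<Sum>a\<in>A. h a) \<le> (\<Sum>a\<in>A. 1)" using h by (intro sum_mono) force
  ultimately have p01: "0 \<le> p" "p \<le> 1" using cA by (auto simp: p field_simps)
  \<comment> \<open>With this \<open>l\<close> the \<open>m\<close> coordinates together contribute
    the exponent \<open>m * l\<^sup>2 * p = q * p\<close>; the condition \<open>q \<le> m\<close>
    gives \<open>l \<le> 1\<close>.\<close>
  define l where "l = sqrt (real q / real m)"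
  have l: "0 < l" "l \<le> 1" and l2: "l\<^sup>2 = real q / real m" using q by (auto simp: l_def)
  define X where "X = (\<lambda>a. \<Sum>i<m. h (a i) - p)"
  let ?T = "{..<m} \<rightarrow>\<^sub>E A"
  have finT: "finite ?T" using A by (intro finite_PiE) auto
  have cT: "real (card ?T) = real (card A) ^ m" by (simp add: card_PiE)
  have mgf: "(\<Sum>a\<in>?T. exp (s * X a)) \<le> real (card A) ^ m * exp (q * p)" if s: "s\<^sup>2 = l\<^sup>2" for s
  proof -
    have "(\<Sum>a\<in>?T. exp (s * X a)) = (\<Sum>a\<in>?T. \<Prod>i<m. exp (s * (h (a i) - p)))"
      by (simp add: X_def sum_distrib_left exp_sum)
    also have "\<dots> = (\<Prod>i<m. \<Sum>a\<in>A. exp (s * (h a - p)))"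
      using A by (subst prod_sum_PiE) auto
    also have "\<dots> = (\<Sum>a\<in>A. exp (s * (h a - p))) ^ m" by simp
    also have "\<dots> \<le> (real (card A) * exp (s\<^sup>2 * p)) ^ m"
    proof (intro power_mono centred_exp_moment A h p sum_nonneg)
      have "\<bar>s\<bar> = \<bar>l\<bar>" using s by (simp add: power2_eq_iff abs_eq_iff)
      thus "\<bar>s\<bar> \<le> 1" using l by simp
    qed auto
    also have "\<dots> = real (card A) ^ m * exp (q * p)"
      using q by (simp add: s l2 power_mult_distrib exp_of_nat_mult[symmetric])
    finally show ?thesis .
  qed
  have "(\<Sum>a\<in>?T. 1 + (l * X a) ^ (2 * q) / fact (2 * q)) \<le> (\<Sum>a\<in>?T. cosh (l * X a))"
    by (intro sum_mono power_div_fact_le_cosh q)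
  also have "\<dots> = ((\<Sum>a\<in>?T. exp (l * X a)) + (\<Sum>a\<in>?T. exp ((- l) * X a))) / 2"
    by (simp add: cosh_field_def sum_divide_distrib[symmetric] sum.distrib)
  also have "\<dots> \<le> real (card A) ^ m * exp (q * p)" using mgf[of l] mgf[of "- l"] by simp
  also have "\<dots> \<le> real (card A) ^ m * (1 + p * exp q)"
    using exp_mult_le_chord[OF p01, of q] p01 cA by (intro mult_left_mono) (auto simp: algebra_simps)
  finally have "(\<Sum>a\<in>?T. (l * X a) ^ (2 * q)) / fact (2 * q) \<le> real (card A) ^ m * (p * exp q)"
    by (simp add: sum.distrib cT sum_divide_distrib[symmetric] algebra_simps)
  hence "(\<Sum>a\<in>?T. (l * X a) ^ (2 * q)) \<le> real (card A) ^ m * (p * exp q) * fact (2 * q)"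
    by (simp add: divide_le_eq)
  moreover have "(\<Sum>a\<in>?T. (l * X a) ^ (2 * q)) = (real q / real m) ^ q * (\<Sum>a\<in>?T. X a ^ (2 * q))"
    by (simp only: power_mult_distrib power_mult l2 sum_distrib_left)
  ultimately have "(real q / real m) ^ q * (\<Sum>a\<in>?T. X a ^ (2 * q)) 
      \<le> real (card A) ^ m * (p * exp q) * fact (2 * q)" by simp
  \<comment> \<open>The constant 12 of the statement is \<open>3 * 4\<close>, from
    \<open>exp 1 \<le> 3\<close> and from bounding the factorial of \<open>2 * q\<close> by
    \<open>(2 * q) ^ (2 * q)\<close>.\<close>
  also have "\<dots> \<le> real (card A) ^ m * (p * 3 ^ q) * (4 * real q * real q) ^ q"
  proof (intro mult_mono mult_left_mono)
    have "exp (real q) = exp 1 ^ q" by (simp add: exp_of_nat_mult[symmetric])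
    also have "\<dots> \<le> 3 ^ q" using exp_le by (intro power_mono) auto
    finally show "exp (real q) \<le> 3 ^ q" .
    have "fact (2 * q) \<le> real ((2 * q) ^ (2 * q))" using fact_le_power[of "2 * q", where ?'a = real] by simp
    also have "\<dots> = ((2 * real q)\<^sup>2) ^ q" by (simp only: of_nat_power of_nat_mult of_nat_numeral power_mult)
    also have "(2 * real q)\<^sup>2 = 4 * real q * real q" by (simp add: power2_eq_square)
    finally show "fact (2 * q) \<le> (4 * real q * real q) ^ q" .
  qed (use p01 in auto)
  also have "\<dots> = (real q / real m) ^ q * (real (card A) ^ m * (12 * real q * real m) ^ q * p)"
    using q by (simp add: power_mult_distrib[symmetric] power_divide[symmetric] mult_ac)
  finally show ?thesis using q by (simp add: X_def)
qed

lemma power_mean_even: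
  fixes u :: "'b \<Rightarrow> real"
  assumes "finite M" "M \<noteq> {}" "even n"
  shows "(\<Sum>y\<in>M. u y) ^ n \<le> real (card M) ^ n * ((\<Sum>y\<in>M. u y ^ n) / real (card M))"
proof -
  have c: "0 < real (card M)" using assms by (simp add: card_gt_0_iff)
  have "(\<Sum>y\<in>M. (1 / real (card M)) *\<^sub>R u y) ^ n \<le> (\<Sum>y\<in>M. (1 / real (card M)) * u y ^ n)"
    using c assms by (intro convex_on_sum[OF _ _ convex_power_even]) auto
  hence "((\<Sum>y\<in>M. u y) / real (card M)) ^ n \<le> (\<Sum>y\<in>M. u y ^ n) / real (card M)"
    by (simp add: sum_divide_distrib)
  thus ?thesis using c by (simp add: power_divide field_simps)
qed

context finite_comm_group
begin

text \<open>Convolution of \<open>f\<close> with the uniform probability measure on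
  \<open>D\<close>; see \<open>convol_unif\<close>.\<close>

definition smear :: "'a set \<Rightarrow> ('a \<Rightarrow> real) \<Rightarrow> 'a \<Rightarrow> real" where
  "smear D f x = (\<Sum>z\<in>D. f (x \<otimes> inv z)) / real (card D)"

lemma sum_smear:
  assumes "D \<subseteq> carrier G" "D \<noteq> {}"
  shows "(\<Sum>x\<in>carrier G. smear D f x) = (\<Sum>x\<in>carrier G. f x)"
proof -
  have "0 < card D" using assms finite_subset[OF assms(1)] by (simp add: card_gt_0_iff)
  moreover have "(\<Sum>x\<in>carrier G. smear D f x) = (\<Sum>z\<in>D. \<Sum>x\<in>carrier G. f (x \<otimes> inv z)) / real (card D)"
    unfolding smear_def sum_divide_distrib[symmetric] by (subst sum.swap) simp
  moreover have "(\<Sum>z\<in>D. \<Sum>x\<in>carrier G. f (x \<otimes> inv z)) = (\<Sum>z\<in>D. \<Sum>x\<in>carrier G. f x)"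
    using assms by (intro sum.cong refl sum_translate) auto
  ultimately show ?thesis by simp
qed

text \<open>The translates by \<open>s \<in> S\<close> of good \<open>m\<close>-tuples from \<open>A\<close> are \<open>m\<close>-tuples from \<open>A <#> S\<close>, so some
  tuple is a translate of a good one by many \<open>s\<close>.\<close>

lemma croot_sisask:
  assumes A: "A \<subseteq> carrier G" "A \<noteq> {}" and L: "L \<subseteq> carrier G" "L \<noteq> {}"
    and S: "S \<subseteq> carrier G" and K: "real (card (A <#> S)) \<le> K * real (card A)"
    and q: "0 < q" "q \<le> m"
  shows "\<exists>T g. T \<subseteq> S \<and> real (card S) \<le> 2 * K ^ m * real (card T) \<and>
           (\<forall>s\<in>T. (\<Sum>x\<in>carrier G. (g (x \<otimes> s) - smear A (indicat_real L) x) ^ (2 * q))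
                    \<le> 2 * (12 * real q / real m) ^ q * real (card L))"
proof -
  define sample where "sample = (\<lambda>a x. (\<Sum>i<m. indicat_real L (x \<otimes> inv (a i))) / real m)"
  define dev where "dev = (\<lambda>a. \<Sum>x\<in>carrier G. (sample a x - smear A (indicat_real L) x) ^ (2 * q))"
  define c where "c = (12 * real q / real m) ^ q * real (card L)"
  let ?T = "{..<m} \<rightarrow>\<^sub>E A"
  let ?U = "{..<m} \<rightarrow>\<^sub>E (A <#> S)"
  have finA: "finite A" and finL: "finite L" and finS: "finite S"
    using A L S finite_carrier by (auto intro: finite_subset)
  have AS: "A <#> S \<subseteq> carrier G" using A S by (auto simp: set_mult_def)
  have finAS: "finite (A <#> S)" using finite_subset[OF AS finite_carrier] .
  have cA: "0 < real (card A)" using A finA by (simp add: card_gt_0_iff)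
  have finT: "finite ?T" using finA by (intro finite_PiE) auto
  have finU: "finite ?U" using finAS by (intro finite_PiE) auto
  have cT: "real (card ?T) = real (card A) ^ m" by (simp add: card_PiE)
  have m: "0 < real m" using q by simp
  have c: "0 < c" using q L finL m by (simp add: c_def card_gt_0_iff)
  have dev_nonneg: "0 \<le> dev a" for a
    unfolding dev_def by (intro sum_nonneg zero_le_even_power) simp
  have mean: "(\<Sum>a\<in>?T. dev a) \<le> real (card ?T) * c"
  proof -
    have "(\<Sum>a\<in>?T. dev a) = (\<Sum>x\<in>carrier G. \<Sum>a\<in>?T. (sample a x - smear A (indicat_real L) x) ^ (2 * q))"
      unfolding dev_def by (rule sum.swap)
    also have "\<dots> \<le> (\<Sum>x\<in>carrier G. real (card A) ^ m * (12 * real q / real m) ^ q * smear A (indicat_real L) x)"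
    proof (rule sum_mono)
      fix x assume x: "x \<in> carrier G"
      let ?h = "\<lambda>a. indicat_real L (x \<otimes> inv a)"
      let ?p = "smear A (indicat_real L) x"
      have sample: "sample a x - ?p = (\<Sum>i<m. ?h (a i) - ?p) / real m" for a
        using m by (simp add: sample_def sum_subtractf diff_divide_distrib)
      have "(\<Sum>a\<in>?T. (sample a x - ?p) ^ (2 * q)) = (\<Sum>a\<in>?T. (\<Sum>i<m. ?h (a i) - ?p) ^ (2 * q)) / real m ^ (2 * q)"
        unfolding sample power_divide by (rule sum_divide_distrib[symmetric])
      also have "\<dots> \<le> (real (card A) ^ m * (12 * real q * real m) ^ q * ?p) / real m ^ (2 * q)"
        using finA A q by (intro divide_right_mono centred_moment) (auto simp: smear_def indicator_def)
      also have "\<dots> = real (card A) ^ m * (12 * real q / real m) ^ q * ?p"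
        using m by (simp add: power_mult power_mult_distrib power_divide power2_eq_square field_simps)
      finally show "(\<Sum>a\<in>?T. (sample a x - ?p) ^ (2 * q)) \<le> \<dots>" .
    qed
    also have "\<dots> = real (card A) ^ m * (12 * real q / real m) ^ q * (\<Sum>x\<in>carrier G. smear A (indicat_real L) x)"
      by (simp add: sum_distrib_left)
    also have "(\<Sum>x\<in>carrier G. smear A (indicat_real L) x) = real (card L)"
      using L finL by (simp add: sum_smear[OF A] indicator_def sum.If_cases Int_absorb1)
    finally show ?thesis by (simp add: c_def cT mult_ac)
  qed
  \<comment> \<open>Markov's inequality at twice the mean: at least half of all tuples are
    good.\<close>
  define good where "good = {a\<in>?T. dev a \<le> 2 * c}"
  have finG: "finite good" using finT by (simp add: good_def)
  have good: "real (card ?T) \<le> 2 * real (card good)"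
  proof -
    have "real (card (?T - good)) * (2 * c) = (\<Sum>a\<in>?T - good. 2 * c)" by (simp only: sum_constant)
    also have "\<dots> \<le> (\<Sum>a\<in>?T - good. dev a)"
    proof (rule sum_mono)
      fix a assume a: "a \<in> ?T - good"
      have "\<not> dev a \<le> 2 * c" using a unfolding good_def by blast
      thus "2 * c \<le> dev a" by linarith
    qed
    also have "\<dots> \<le> (\<Sum>a\<in>?T. dev a)"
      using finT dev_nonneg by (intro sum_mono2) blast+
    also have "\<dots> \<le> real (card ?T) * c" by (rule mean)
    finally have "(2 * real (card (?T - good))) * c \<le> real (card ?T) * c" by (simp only: mult_ac)
    hence "2 * real (card (?T - good)) \<le> real (card ?T)" using c by (rule mult_right_le_imp_le)
    moreover have "card (?T - good) = card ?T - card good"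
      by (rule card_Diff_subset[OF finG]) (auto simp: good_def)
    moreover have "card good \<le> card ?T" using finT by (intro card_mono) (auto simp: good_def)
    ultimately show ?thesis by (simp add: of_nat_diff)
  qed
  define shift where "shift = (\<lambda>s a. \<lambda>i\<in>{..<m}. a i \<otimes> s)"
  define Tb where "Tb = (\<lambda>b. {s\<in>S. shift (inv s) b \<in> good})"
  \<comment> \<open>Double counting of the pairs of \<open>s\<close> and \<open>b\<close> for which
    \<open>b\<close>, shifted back by \<open>s\<close>, is good: each \<open>s\<close> has at least
    \<open>card good\<close> partners.\<close>
  have "real (card S) * real (card good) = (\<Sum>s\<in>S. real (card good))" by simp
  also have "\<dots> \<le> (\<Sum>s\<in>S. real (card {b\<in>?U. shift (inv s) b \<in> good}))"
  proof (rule sum_mono)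
    fix s assume s: "s \<in> S"
    hence sc: "s \<in> carrier G" using S by auto
    have inv: "shift (inv s) (shift s a) = a" if "a \<in> good" for a
      using that A sc by (auto simp: shift_def good_def PiE_def Pi_def extensional_def fun_eq_iff m_assoc subset_iff)
    have "shift s ` good \<subseteq> {b\<in>?U. shift (inv s) b \<in> good}"
    proof
      fix b assume "b \<in> shift s ` good"
      then obtain a where a: "a \<in> good" "b = shift s a" by auto
      have "b \<in> ?U" using a s by (auto simp: shift_def good_def set_mult_def PiE_def Pi_def)
      thus "b \<in> {b\<in>?U. shift (inv s) b \<in> good}" using a inv by simp
    qed
    hence "card good \<le> card {b\<in>?U. shift (inv s) b \<in> good}"
      using inv finU by (intro card_inj_on_le[of "shift s"] inj_on_inverseI[of _ "shift (inv s)"]) auto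
    thus "real (card good) \<le> real (card {b\<in>?U. shift (inv s) b \<in> good})" by simp
  qed
  also have "\<dots> = real (\<Sum>s\<in>S. card {b\<in>?U. shift (inv s) b \<in> good})" by simp
  also have "(\<Sum>s\<in>S. card {b\<in>?U. shift (inv s) b \<in> good}) = (\<Sum>b\<in>?U. card (Tb b))"
    unfolding Tb_def by (rule sum_multicount_gen[OF finS finU]) simp
  finally have count: "real (card S) * real (card good) \<le> (\<Sum>b\<in>?U. real (card (Tb b)))" by simp
  \<comment> \<open>Averaging over at most \<open>(K * card A) ^ m\<close> tuples \<open>b\<close>,
    against at least \<open>card S * card A ^ m / 2\<close> pairs.\<close>
  have "\<exists>b\<in>?U. real (card S) \<le> 2 * K ^ m * real (card (Tb b))" if "S \<noteq> {}"
  proof (rule ccontr)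
    assume "\<not> ?thesis"
    hence lt: "2 * K ^ m * real (card (Tb b)) < real (card S)" if "b \<in> ?U" for b using that by force
    have ASne: "A <#> S \<noteq> {}" using A that by (auto simp: set_mult_def)
    hence Une: "?U \<noteq> {}" by (auto simp: PiE_eq_empty_iff)
    have "0 < real (card (A <#> S))" using ASne finAS by (simp add: card_gt_0_iff)
    hence K0: "0 < K" using K cA by (metis order_less_le_trans zero_less_mult_pos2)
    have cU: "real (card ?U) \<le> (K * real (card A)) ^ m"
      using K by (simp add: card_PiE power_mono)
    have "2 * K ^ m * (\<Sum>b\<in>?U. real (card (Tb b))) < (\<Sum>b\<in>?U. real (card S))"
      unfolding sum_distrib_left using finU Une lt by (intro sum_strict_mono) auto
    also have "\<dots> = real (card ?U) * real (card S)" by simp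
    also have "\<dots> \<le> (K * real (card A)) ^ m * real (card S)" using cU by (intro mult_right_mono) auto
    also have "\<dots> = K ^ m * real (card S) * real (card ?T)" by (simp add: cT power_mult_distrib)
    also have "\<dots> \<le> K ^ m * real (card S) * (2 * real (card good))"
      using good K0 by (intro mult_left_mono) auto
    also have "\<dots> = 2 * K ^ m * (real (card S) * real (card good))" by simp
    also have "\<dots> \<le> 2 * K ^ m * (\<Sum>b\<in>?U. real (card (Tb b)))"
      using count K0 by (intro mult_left_mono) auto
    finally show False by simp
  qed
  then obtain b where b: "S \<noteq> {} \<longrightarrow> b \<in> ?U \<and> real (card S) \<le> 2 * K ^ m * real (card (Tb b))" by blast
  show ?thesis
  proof (cases "S = {}")
    case False
    have bU: "b \<in> ?U" using b False by simp
    have "(\<Sum>x\<in>carrier G. (sample b (x \<otimes> s) - smear A (indicat_real L) x) ^ (2 * q)) \<le> 2 * c" if s: "s \<in> Tb b" for s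
    proof -
      have sc: "s \<in> carrier G" using s S by (auto simp: Tb_def)
      \<comment> \<open>Shifting the tuple amounts to translating its sample, so the single function
        \<open>sample b\<close> serves all \<open>s\<close> in \<open>Tb b\<close>.\<close>
      have "sample (shift (inv s) b) x = sample b (x \<otimes> s)" if x: "x \<in> carrier G" for x
      proof -
        have "x \<otimes> inv (b i \<otimes> inv s) = x \<otimes> s \<otimes> inv (b i)" if "i < m" for i
        proof -
          have "b i \<in> carrier G" using bU that AS by (auto simp: PiE_def Pi_def)
          thus ?thesis using x sc by (simp add: inv_mult m_assoc m_comm[of "inv (b i)"])
        qed
        thus ?thesis by (simp add: sample_def shift_def)
      qed
      hence "dev (shift (inv s) b) = (\<Sum>x\<in>carrier G. (sample b (x \<otimes> s) - smear A (indicat_real L) x) ^ (2 * q))"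
        by (simp add: dev_def)
      thus ?thesis using s by (simp add: Tb_def good_def)
    qed
    moreover have "Tb b \<subseteq> S" by (auto simp: Tb_def)
    ultimately show ?thesis using b False by (intro exI[of _ "Tb b"] exI[of _ "sample b"]) (auto simp: c_def mult.assoc)
  qed auto
qed

text \<open>The triple convolution of the three indicators divided by \<open>card A\<close>; see
  \<open>convol_indicators\<close>.\<close>

definition tri_conv :: "'a set \<Rightarrow> 'a set \<Rightarrow> 'a set \<Rightarrow> 'a \<Rightarrow> real" where
  "tri_conv A M L x = (\<Sum>y\<in>M. smear A (indicat_real L) (x \<otimes> inv y))"

text \<open>Averaging the unknown \<open>g\<close> over \<open>M\<close> gives \<open>\<Phi>\<close>
  with \<open>\<Phi> (x \<otimes> s)\<close> close to \<open>tri_conv A M L x\<close> for all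
  \<open>s\<close> in \<open>T\<close>. Comparing the values at \<open>x\<close> and at
  \<open>x \<otimes> (s \<otimes> inv t)\<close> with the same value of \<open>\<Phi>\<close>
  eliminates \<open>g\<close> at the price of a factor 2. The power mean inequality over
  \<open>M\<close> makes the estimate pointwise, and \<open>small\<close> absorbs the loss from
  \<open>card L\<close> against \<open>card M\<close>.\<close>

lemma almost_period:
  assumes A: "A \<subseteq> carrier G" "A \<noteq> {}" and L: "L \<subseteq> carrier G" "L \<noteq> {}"
    and M: "M \<subseteq> carrier G" "M \<noteq> {}"
    and S: "S \<subseteq> carrier G" and K: "real (card (A <#> S)) \<le> K * real (card A)"
    and q: "0 < q" "q \<le> m" and c: "0 \<le> c"
    and small: "2 * (12 * real q / real m) ^ q * real (card L) \<le> c ^ (2 * q) * real (card M)"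
  shows "\<exists>T \<subseteq> S. real (card S) \<le> 2 * K ^ m * real (card T) \<and>
           (\<forall>s\<in>T. \<forall>t\<in>T. \<forall>x\<in>carrier G. 
              \<bar>tri_conv A M L (x \<otimes> (s \<otimes> inv t)) - tri_conv A M L x\<bar> \<le> 2 * c * real (card M))"
proof -
  have finM: "finite M" using finite_subset[OF M(1) finite_carrier] .
  have cM: "0 < real (card M)" using M finM by (simp add: card_gt_0_iff)
  obtain T g where T: "T \<subseteq> S" "real (card S) \<le> 2 * K ^ m * real (card T)"
    and g: "\<And>s. s \<in> T \<Longrightarrow> (\<Sum>x\<in>carrier G. (g (x \<otimes> s) - smear A (indicat_real L) x) ^ (2 * q))
                    \<le> 2 * (12 * real q / real m) ^ q * real (card L)"
    using croot_sisask[OF A L S K q] by blast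
  define \<Phi> where "\<Phi> = (\<lambda>x. \<Sum>y\<in>M. g (x \<otimes> inv y))"
  have close: "\<bar>\<Phi> (x \<otimes> s) - tri_conv A M L x\<bar> \<le> c * real (card M)" if s: "s \<in> T" and x: "x \<in> carrier G" for s x
  proof -
    have sc: "s \<in> carrier G" using s T S by auto
    define u where "u = (\<lambda>y. g (x \<otimes> inv y \<otimes> s) - smear A (indicat_real L) (x \<otimes> inv y))"
    have "\<Phi> (x \<otimes> s) - tri_conv A M L x = (\<Sum>y\<in>M. u y)"
    proof -
      have "x \<otimes> s \<otimes> inv y = x \<otimes> inv y \<otimes> s" if "y \<in> M" for y
        using x sc that M by (simp add: m_assoc m_comm[of s] subset_iff)
      thus ?thesis by (simp add: \<Phi>_def tri_conv_def u_def sum_subtractf)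
    qed
    moreover have "\<bar>\<Sum>y\<in>M. u y\<bar> ^ (2 * q) \<le> (c * real (card M)) ^ (2 * q)"
    proof -
      have "(\<Sum>y\<in>M. u y ^ (2 * q)) \<le> c ^ (2 * q) * real (card M)"
      proof -
        define f where "f = (\<lambda>z. (g (z \<otimes> s) - smear A (indicat_real L) z) ^ (2 * q))"
        have "(\<Sum>y\<in>M. u y ^ (2 * q)) = (\<Sum>z\<in>(\<lambda>y. x \<otimes> inv y) ` M. f z)"
        proof -
          have "inj_on (\<lambda>y. x \<otimes> inv y) M"
            using x M by (intro inj_on_inverseI[of _ "\<lambda>z. inv z \<otimes> x"])
              (auto simp: inv_mult_group m_assoc subset_iff)
          thus ?thesis by (subst sum.reindex) (auto simp: u_def f_def)
        qed
        also have "\<dots> \<le> (\<Sum>z\<in>carrier G. f z)"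
          using x M by (intro sum_mono2) (auto simp: f_def zero_le_even_power)
        also have "\<dots> \<le> c ^ (2 * q) * real (card M)" using order_trans[OF g[OF s] small] by (simp only: f_def)
        finally show ?thesis .
      qed
      hence "(\<Sum>y\<in>M. u y ^ (2 * q)) / real (card M) \<le> c ^ (2 * q)" using cM by (simp add: divide_le_eq)
      hence "real (card M) ^ (2 * q) * ((\<Sum>y\<in>M. u y ^ (2 * q)) / real (card M)) \<le> real (card M) ^ (2 * q) * c ^ (2 * q)"
        by (rule mult_left_mono) simp
      moreover have "(\<Sum>y\<in>M. u y) ^ (2 * q) \<le> real (card M) ^ (2 * q) * ((\<Sum>y\<in>M. u y ^ (2 * q)) / real (card M))"
        using finM M by (intro power_mean_even) auto
      ultimately show ?thesis by (simp add: power_even_abs power_mult_distrib mult.commute)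
    qed
    hence "\<bar>\<Sum>y\<in>M. u y\<bar> \<le> c * real (card M)"
      by (rule power_mono_iff[THEN iffD1, rotated 3]) (use q c in auto)
    ultimately show ?thesis by simp
  qed
  have "\<bar>tri_conv A M L (x \<otimes> (s \<otimes> inv t)) - tri_conv A M L x\<bar> \<le> 2 * c * real (card M)"
    if "s \<in> T" "t \<in> T" "x \<in> carrier G" for s t x
  proof -
    have st: "s \<in> carrier G" "t \<in> carrier G" using that T S by auto
    have "x \<otimes> (s \<otimes> inv t) \<otimes> t = x \<otimes> s" using st that by (simp add: m_assoc)
    thus ?thesis using close[of t "x \<otimes> (s \<otimes> inv t)"] close[of s x] st that by simp
  qed
  thus ?thesis using T by (intro exI[of _ T]) auto
qed


subsection \<open>The large spectrum relative to a Bohr set\<close>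

definition fhat :: "('a \<Rightarrow> real) \<Rightarrow> ('a \<Rightarrow> complex) \<Rightarrow> complex" where
  "fhat f \<gamma> = inner (\<lambda>x. complex_of_real (f x)) \<gamma>"

text \<open>The Fourier transform of the uniform probability measure on \<open>D\<close>; unlike
  \<open>fhat\<close> of an indicator it has modulus at most 1 at every character.\<close>

definition mhat :: "'a set \<Rightarrow> ('a \<Rightarrow> complex) \<Rightarrow> complex" where
  "mhat D \<gamma> = (\<Sum>z\<in>D. cnj (\<gamma> z)) / of_nat (card D)"

lemma fhat_smear:
  assumes "D \<subseteq> carrier G" "\<gamma> \<in> characters G"
  shows "fhat (smear D f) \<gamma> = mhat D \<gamma> * fhat f \<gamma>"
proof -
  have "fhat (smear D f) \<gamma> = (\<Sum>z\<in>D. \<Sum>x\<in>carrier G. f (x \<otimes> inv z) * cnj (\<gamma> x)) / of_nat (card D)"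
    unfolding fhat_def smear_def
    by (subst sum.swap) (simp add: sum_divide_distrib sum_distrib_right)
  also have "(\<Sum>z\<in>D. \<Sum>x\<in>carrier G. f (x \<otimes> inv z) * cnj (\<gamma> x)) = (\<Sum>z\<in>D. cnj (\<gamma> z) * fhat f \<gamma>)"
  proof (rule sum.cong[OF refl])
    fix z assume "z \<in> D"
    hence z: "z \<in> carrier G" using assms by auto
    have "(\<Sum>x\<in>carrier G. f (x \<otimes> inv z) * cnj (\<gamma> x))
        = (\<Sum>x\<in>carrier G. complex_of_real (f (x \<otimes> inv z)) * cnj (\<gamma> (x \<otimes> inv z)) * cnj (\<gamma> z))"
      using assms z char_mult_cnj[OF assms(2) z]
      by (intro sum.cong) (auto simp: char_mult char_inv mult.commute)
    also have "\<dots> = (\<Sum>x\<in>carrier G. complex_of_real (f x) * cnj (\<gamma> x) * cnj (\<gamma> z))"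
      using sum_translate[of "inv z" "\<lambda>x. complex_of_real (f x) * cnj (\<gamma> x) * cnj (\<gamma> z)"] z by simp
    finally show "(\<Sum>x\<in>carrier G. f (x \<otimes> inv z) * cnj (\<gamma> x)) = cnj (\<gamma> z) * fhat f \<gamma>"
      by (simp add: fhat_def sum_distrib_left mult_ac)
  qed
  finally show ?thesis by (simp add: mhat_def sum_distrib_right)
qed

lemma cmod_mhat: "cmod (mhat D \<gamma>) = cmod (\<Sum>z\<in>D. \<gamma> z) / real (card D)"
proof -
  have "(\<Sum>z\<in>D. cnj (\<gamma> z)) = cnj (\<Sum>z\<in>D. \<gamma> z)" by simp
  thus ?thesis unfolding mhat_def by (simp only: norm_divide complex_mod_cnj norm_of_nat)
qed

lemma cmod_mhat_le:
  assumes "D \<subseteq> carrier G" "\<gamma> \<in> characters G"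
  shows "cmod (mhat D \<gamma>) \<le> 1"
proof -
  have "cmod (\<Sum>z\<in>D. \<gamma> z) \<le> (\<Sum>z\<in>D. cmod (\<gamma> z))" by (rule norm_sum)
  also have "\<dots> = (\<Sum>z\<in>D. 1)" using assms by (intro sum.cong) auto
  finally show ?thesis by (simp add: cmod_mhat divide_le_eq)
qed

text \<open>Replacing \<open>Re (\<omega> \<theta>)\<close> by half the sum of \<open>\<omega> \<theta>\<close> and its conjugate expands a Riesz product
  into characters of total weight \<open>(9/8)^k\<close>.\<close>

definition riesz :: "(('a \<Rightarrow> complex) \<Rightarrow> complex) \<Rightarrow> ('a \<Rightarrow> complex) set \<Rightarrow> 'a \<Rightarrow> real" where
  "riesz \<omega> \<Lambda> x = (\<Prod>\<gamma>\<in>\<Lambda>. 1 + Re (\<omega> \<gamma> * \<gamma> x) / 8)"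

text \<open>Expanding one factor replaces \<open>\<gamma>\<close> by \<open>\<gamma>\<close>,
  \<open>\<gamma> * \<theta>\<close> and \<open>\<gamma> * cnj \<theta>\<close> with weights at most
  1, 1/16 and 1/16. So one of the three correlations shrinks by at most \<open>9/8\<close>, and the
  induction continues with that character. Each step changes the distance to 1 at \<open>u\<close>
  by at most \<open>cmod (\<theta> u - 1)\<close>.\<close>

lemma riesz_expand:
  assumes "finite \<Lambda>" "\<Lambda> \<subseteq> characters G" "\<gamma> \<in> characters G" "0 \<le> v"
    and \<omega>: "\<And>\<phi>. cmod (\<omega> \<phi>) \<le> 1"
    and "v * (9/8) ^ card \<Lambda> < cmod (\<Sum>x\<in>carrier G. \<beta> x * \<gamma> x * complex_of_real (riesz \<omega> \<Lambda> x))"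
  shows "\<exists>\<phi>\<in>characters G. v < cmod (\<Sum>x\<in>carrier G. \<beta> x * \<phi> x) \<and>
     (\<forall>u\<in>carrier G. cmod (\<gamma> u - 1) \<le> (\<Sum>\<theta>\<in>\<Lambda>. cmod (\<theta> u - 1)) + cmod (\<phi> u - 1))"
  using assms(1-4,6)
proof (induction \<Lambda> arbitrary: \<gamma> rule: finite_induct)
  case empty
  then show ?case by (intro bexI[of _ \<gamma>]) (auto simp: riesz_def)
next
  case (insert \<theta> \<Lambda>)
  have \<theta>: "\<theta> \<in> characters G" "\<Lambda> \<subseteq> characters G" using insert.prems by auto
  define I where "I = (\<lambda>\<psi>. \<Sum>x\<in>carrier G. \<beta> x * \<psi> x * complex_of_real (riesz \<omega> \<Lambda> x))"
  define \<gamma>1 \<gamma>2 where "\<gamma>1 = (\<lambda>x\<in>carrier G. \<gamma> x * \<theta> x)" 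
    and "\<gamma>2 = (\<lambda>x\<in>carrier G. \<gamma> x * (\<lambda>x\<in>carrier G. cnj (\<theta> x)) x)"
  have chars: "\<gamma>1 \<in> characters G" "\<gamma>2 \<in> characters G"
    unfolding \<gamma>1_def \<gamma>2_def by (intro char_prod char_cnj insert.prems \<theta>)+
  have "(\<Sum>x\<in>carrier G. \<beta> x * \<gamma> x * complex_of_real (riesz \<omega> (insert \<theta> \<Lambda>) x))
      = I \<gamma> + \<omega> \<theta> / 16 * I \<gamma>1 + cnj (\<omega> \<theta>) / 16 * I \<gamma>2"
    unfolding I_def sum_distrib_left sum.distrib[symmetric]
  proof (rule sum.cong[OF refl])
    fix x assume x: "x \<in> carrier G"
    have "complex_of_real (Re (\<omega> \<theta> * \<theta> x)) = (\<omega> \<theta> * \<theta> x + cnj (\<omega> \<theta> * \<theta> x)) / 2"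
      unfolding complex_add_cnj by simp
    note h = this
    have "complex_of_real (riesz \<omega> (insert \<theta> \<Lambda>) x) 
      = (1 + complex_of_real (Re (\<omega> \<theta> * \<theta> x)) / 8) * complex_of_real (riesz \<omega> \<Lambda> x)"
      using insert.hyps by (simp add: riesz_def del: times_complex.sel)
    also have "\<dots>
      = (1 + (\<omega> \<theta> * \<theta> x + cnj (\<omega> \<theta>) * cnj (\<theta> x)) / 16) * complex_of_real (riesz \<omega> \<Lambda> x)"
      unfolding h by simp
    finally show "\<beta> x * \<gamma> x * complex_of_real (riesz \<omega> (insert \<theta> \<Lambda>) x) =
       \<beta> x * \<gamma> x * complex_of_real (riesz \<omega> \<Lambda> x)
        + \<omega> \<theta> / 16 * (\<beta> x * \<gamma>1 x * complex_of_real (riesz \<omega> \<Lambda> x))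
        + cnj (\<omega> \<theta>) / 16 * (\<beta> x * \<gamma>2 x * complex_of_real (riesz \<omega> \<Lambda> x))"
      using x by (simp add: \<gamma>1_def \<gamma>2_def field_simps)
  qed
  hence "v * (9/8) ^ card (insert \<theta> \<Lambda>) < cmod (I \<gamma> + \<omega> \<theta> / 16 * I \<gamma>1 + cnj (\<omega> \<theta>) / 16 * I \<gamma>2)"
    using insert.prems by simp
  also have "\<dots> \<le> cmod (I \<gamma>) + cmod (\<omega> \<theta> / 16 * I \<gamma>1) + cmod (cnj (\<omega> \<theta>) / 16 * I \<gamma>2)"
    by (intro norm_triangle_mono norm_triangle_ineq order_refl)
  also have "\<dots> = cmod (I \<gamma>) + cmod (\<omega> \<theta>) * cmod (I \<gamma>1) / 16 + cmod (\<omega> \<theta>) * cmod (I \<gamma>2) / 16"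
    by (simp add: norm_mult norm_divide)
  also have "\<dots> \<le> cmod (I \<gamma>) + cmod (I \<gamma>1) / 16 + cmod (I \<gamma>2) / 16"
    using \<omega>[of \<theta>] by (intro add_mono divide_right_mono order_refl mult_left_le_one_le) auto
  finally have "(9/8) * (v * (9/8) ^ card \<Lambda>) < cmod (I \<gamma>) + cmod (I \<gamma>1) / 16 + cmod (I \<gamma>2) / 16"
    using insert.hyps by (simp add: mult_ac)
  hence "v * (9/8) ^ card \<Lambda> < cmod (I \<gamma>) \<or> v * (9/8) ^ card \<Lambda> < cmod (I \<gamma>1) \<or> v * (9/8) ^ card \<Lambda> < cmod (I \<gamma>2)"
    by linarith
  then obtain \<psi> where \<psi>: "\<psi> \<in> {\<gamma>, \<gamma>1, \<gamma>2}" "v * (9/8) ^ card \<Lambda> < cmod (I \<psi>)" by blast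
  have \<psi>c: "\<psi> \<in> characters G" using \<psi> chars insert.prems by auto
  obtain \<phi> where \<phi>: "\<phi> \<in> characters G" "v < cmod (\<Sum>x\<in>carrier G. \<beta> x * \<phi> x)"
    "\<And>u. u \<in> carrier G \<Longrightarrow> cmod (\<psi> u - 1) \<le> (\<Sum>\<theta>\<in>\<Lambda>. cmod (\<theta> u - 1)) + cmod (\<phi> u - 1)"
    using insert.IH[OF \<theta>(2) \<psi>c insert.prems(3)] \<psi>(2) unfolding I_def by blast
  have "cmod (\<gamma> u - 1) \<le> cmod (\<theta> u - 1) + cmod (\<psi> u - 1)" if u: "u \<in> carrier G" for u
  proof -
    have aux: "cmod (a - 1) \<le> cmod (b - 1) + cmod (a * b - 1)" if "cmod a = 1" for a b :: complex
    proof -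
      have "a - 1 = (a * b - 1) - a * (b - 1)" by (simp add: algebra_simps)
      also have "cmod \<dots> \<le> cmod (a * b - 1) + cmod (a * (b - 1))" by (rule norm_triangle_ineq4)
      finally show ?thesis using that by (simp add: norm_mult)
    qed
    have "cmod (\<gamma> u) = 1" using insert.prems u by simp
    moreover have "cmod (cnj (\<theta> u) - 1) = cmod (\<theta> u - 1)"
      by (metis complex_cnj_diff complex_cnj_one complex_mod_cnj)
    ultimately show ?thesis
      using \<psi>(1) u aux[of "\<gamma> u" "\<theta> u"] aux[of "\<gamma> u" "cnj (\<theta> u)"] by (auto simp: \<gamma>1_def \<gamma>2_def)
  qed
  hence "cmod (\<gamma> u - 1) \<le> (\<Sum>\<theta>\<in>insert \<theta> \<Lambda>. cmod (\<theta> u - 1)) + cmod (\<phi> u - 1)" if "u \<in> carrier G" for u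
    using \<phi>(3)[OF that] that insert.hyps by fastforce
  thus ?case using \<phi>(1,2) by blast
qed

text \<open>Translation by \<open>u\<close> multiplies the sum of \<open>\<phi>\<close> over the
  Bohr set by \<open>\<phi> u\<close>. On the other hand, the set and its translate both lie in the
  slightly larger Bohr set, and by regularity each misses at most a proportion
  \<open>12 * d * \<delta>\<close>, with \<open>d\<close> the rank.\<close>

lemma regular_bohr_char_bound:
  assumes reg: "regular_bohr G (Bohr \<Gamma> \<kappa>)" and d: "1 \<le> card \<Gamma>"
    and \<delta>: "0 \<le> \<delta>" "\<delta> \<le> 1 / (12 * real (card \<Gamma>))"
    and u: "u \<in> bohr_set G (Bohr \<Gamma> (\<delta> * \<kappa>))" and \<phi>: "\<phi> \<in> characters G"
  shows "cmod (\<phi> u - 1) * cmod (mhat (bohr_set G (Bohr \<Gamma> \<kappa>)) \<phi>) \<le> 24 * real (card \<Gamma>) * \<delta>"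
proof -
  let ?D = "bohr_set G (Bohr \<Gamma> \<kappa>)" and ?E = "bohr_set G (Bohr \<Gamma> ((1 + \<delta>) * \<kappa>))"
  have \<Gamma>: "\<Gamma> \<subseteq> characters G" "0 \<le> \<kappa>" using reg by (auto simp: regular_bohr_def is_bohr_def)
  have cD: "0 < real (card ?D)" using card_bohr_pos[OF \<Gamma>] by simp
  have uc: "u \<in> carrier G" using u by (simp add: mem_bohr)
  have "real (card ?E) / real (card ?D) \<le> 1 + 12 * real (card \<Gamma>) * \<delta>"
  proof -
    have "\<forall>\<delta>'. \<bar>\<delta>'\<bar> \<le> 1 / (12 * real (card \<Gamma>)) \<longrightarrow>
        real (card (bohr_set G (Bohr \<Gamma> ((1 + \<delta>') * \<kappa>)))) / real (card ?D) \<le> 1 + 12 * real (card \<Gamma>) * \<bar>\<delta>'\<bar>"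
      using reg by (simp add: regular_bohr_def bohr_rank_def dilate_def)
    from this[rule_format, of \<delta>] show ?thesis using \<delta> by simp
  qed
  hence cE: "real (card ?E) - real (card ?D) \<le> 12 * real (card \<Gamma>) * \<delta> * real (card ?D)"
    using cD by (simp add: divide_le_eq algebra_simps)
  define uD where "uD = (\<lambda>z. z \<otimes> u) ` ?D"
  have inj: "inj_on (\<lambda>z. z \<otimes> u) ?D" using uc by (intro inj_onI) (auto simp: mem_bohr)
  have DE: "?D \<subseteq> ?E" using \<Gamma> \<delta> by (intro bohr_mono) (simp add: algebra_simps)
  have uDE: "uD \<subseteq> ?E"
    using bohr_mult[OF \<Gamma>(1) _ u] by (auto simp: uD_def algebra_simps)
  have tail: "cmod (\<Sum>z\<in>?E - X. \<phi> z) \<le> real (card ?E) - real (card ?D)" if X: "X \<subseteq> ?E" "card X = card ?D" for X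
  proof -
    have "cmod (\<Sum>z\<in>?E - X. \<phi> z) \<le> (\<Sum>z\<in>?E - X. cmod (\<phi> z))" by (rule norm_sum)
    also have "\<dots> = (\<Sum>z\<in>?E - X. 1)" using \<phi> by (intro sum.cong) (auto simp: mem_bohr)
    also have "\<dots> = real (card ?E) - real (card X)"
      using X(1) card_mono[OF finite_bohr X(1)] finite_subset[OF X(1)]
      by (simp add: card_Diff_subset of_nat_diff)
    finally show ?thesis using X by simp
  qed
  have "(\<phi> u - 1) * (\<Sum>z\<in>?D. \<phi> z) = (\<Sum>z\<in>uD. \<phi> z) - (\<Sum>z\<in>?D. \<phi> z)"
  proof -
    have "(\<Sum>z\<in>uD. \<phi> z) = (\<Sum>z\<in>?D. \<phi> u * \<phi> z)"
      unfolding uD_def sum.reindex[OF inj] using \<phi> uc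
      by (intro sum.cong) (auto simp: char_mult mem_bohr mult.commute)
    thus ?thesis by (simp only: left_diff_distrib sum_distrib_left mult_1_left sum_subtractf)
  qed
  also have "\<dots> = (\<Sum>z\<in>?E - ?D. \<phi> z) - (\<Sum>z\<in>?E - uD. \<phi> z)"
    using sum_diff[OF finite_bohr DE, of \<phi>] sum_diff[OF finite_bohr uDE, of \<phi>] by simp
  also have "cmod \<dots> \<le> cmod (\<Sum>z\<in>?E - ?D. \<phi> z) + cmod (\<Sum>z\<in>?E - uD. \<phi> z)" by (rule norm_triangle_ineq4)
  also have "\<dots> \<le> 2 * (real (card ?E) - real (card ?D))"
    using tail[OF DE] tail[OF uDE] card_image[OF inj] by (simp add: uD_def)
  also have "\<dots> \<le> 24 * real (card \<Gamma>) * \<delta> * real (card ?D)" using cE by simp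
  finally show ?thesis using cD by (simp add: cmod_mhat norm_mult divide_le_eq)
qed

lemma riesz_nonneg:
  assumes "\<Lambda> \<subseteq> characters G" "x \<in> carrier G" "\<And>\<phi>. cmod (\<omega> \<phi>) \<le> 1"
  shows "0 \<le> riesz \<omega> \<Lambda> x"
  unfolding riesz_def
proof (rule prod_nonneg)
  fix \<gamma> assume "\<gamma> \<in> \<Lambda>"
  hence "cmod (\<omega> \<gamma> * \<gamma> x) \<le> 1" using assms by (auto simp: norm_mult)
  hence "\<bar>Re (\<omega> \<gamma> * \<gamma> x)\<bar> \<le> 1" using abs_Re_le_cmod order_trans by blast
  thus "0 \<le> 1 + Re (\<omega> \<gamma> * \<gamma> x) / 8" by linarith
qed

text \<open>Factorwise \<open>ln (1 + y) \<ge> y - 2 * y\<^sup>2\<close> with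
  \<open>\<bar>y\<bar> \<le> 1 / 8\<close>, so each factor loses at most
  \<open>2 / 64 = 1 / 32\<close> in the exponent.\<close>

lemma riesz_lower:
  assumes "\<Lambda> \<subseteq> characters G" "x \<in> carrier G" "\<And>\<phi>. cmod (\<omega> \<phi>) \<le> 1"
  shows "exp ((\<Sum>\<gamma>\<in>\<Lambda>. Re (\<omega> \<gamma> * \<gamma> x)) / 8 - real (card \<Lambda>) / 32) \<le> riesz \<omega> \<Lambda> x"
proof -
  have fin: "finite \<Lambda>" using finite_subset[OF assms(1) finite_characters] .
  have "exp ((\<Sum>\<gamma>\<in>\<Lambda>. Re (\<omega> \<gamma> * \<gamma> x)) / 8 - real (card \<Lambda>) / 32) = exp (\<Sum>\<gamma>\<in>\<Lambda>. Re (\<omega> \<gamma> * \<gamma> x) / 8 - 1 / 32)"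
    unfolding sum_subtractf sum_divide_distrib[symmetric] by simp
  also have "\<dots> = (\<Prod>\<gamma>\<in>\<Lambda>. exp (Re (\<omega> \<gamma> * \<gamma> x) / 8 - 1 / 32))" by (rule exp_sum[OF fin])
  also have "\<dots> \<le> riesz \<omega> \<Lambda> x" unfolding riesz_def
  proof (rule prod_mono, rule conjI)
    fix \<gamma> assume "\<gamma> \<in> \<Lambda>"
    hence "cmod (\<omega> \<gamma> * \<gamma> x) \<le> 1" using assms by (auto simp: norm_mult)
    hence "\<bar>Re (\<omega> \<gamma> * \<gamma> x)\<bar> \<le> 1" using abs_Re_le_cmod order_trans by blast
    moreover define y where "y = Re (\<omega> \<gamma> * \<gamma> x) / 8"
    ultimately have y: "\<bar>y\<bar> \<le> 1 / 8" by simp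
    hence "\<bar>y\<bar>\<^sup>2 \<le> (1 / 8)\<^sup>2" by (intro power_mono) auto
    hence "y - 1 / 32 \<le> ln (1 + y)"
      using abs_ln_one_plus_x_minus_x_bound[of y] y by (simp add: power2_eq_square)
    hence "exp (y - 1 / 32) \<le> exp (ln (1 + y))" by simp
    hence "exp (y - 1 / 32) \<le> 1 + y" using y by simp
    thus "exp (Re (\<omega> \<gamma> * \<gamma> x) / 8 - 1 / 32) \<le> 1 + Re (\<omega> \<gamma> * \<gamma> x) / 8"
      by (simp only: y_def)
  qed auto
  finally show ?thesis .
qed

definition large_spectrum :: "'a set \<Rightarrow> ('a \<Rightarrow> complex) set" where
  "large_spectrum T = {\<gamma>\<in>characters G. 1 / 2 \<le> cmod (mhat T \<gamma>)}"

text \<open>Choosing the phases \<open>\<omega>\<close> to align with \<open>T\<close> makes the Riesz product exponentially large on average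
  over \<open>T\<close>.\<close>

lemma riesz_card_bound:
  assumes \<Lambda>: "\<Lambda> \<subseteq> large_spectrum T" and T: "T \<subseteq> carrier G" "T \<noteq> {}"
    and \<beta>: "\<And>x. x \<in> carrier G \<Longrightarrow> 0 \<le> \<beta> x" "\<And>x. x \<in> T \<Longrightarrow> b \<le> \<beta> x"
    and b: "0 < b"
    and valid: "\<And>\<omega>. (\<And>\<phi>. cmod (\<omega> \<phi>) \<le> 1) \<Longrightarrow> 
       (\<Sum>x\<in>carrier G. \<beta> x * riesz \<omega> \<Lambda> x) \<le> exp (real (card \<Lambda>) / 64)"
  shows "b * real (card T) * exp (real (card \<Lambda>) / 64) \<le> 1"
proof -
  let ?k = "real (card \<Lambda>)"
  \<comment> \<open>The phases make the sum over \<open>T\<close> of each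
    \<open>\<omega> \<gamma> * \<gamma> t\<close> equal to its modulus, hence at least
    \<open>card T / 2\<close>. So \<open>Y\<close> below has mean at least
    \<open>?k / 16 - ?k / 32 = ?k / 32\<close> over \<open>T\<close>.\<close>
  define \<omega> where "\<omega> = (\<lambda>\<gamma>. cnj (sgn (\<Sum>t\<in>T. \<gamma> t)))"
  have \<omega>: "cmod (\<omega> \<phi>) \<le> 1" for \<phi> by (simp add: \<omega>_def norm_sgn)
  have \<Lambda>c: "\<Lambda> \<subseteq> characters G" using \<Lambda> by (auto simp: large_spectrum_def)
  have finT: "finite T" using finite_subset[OF T(1) finite_carrier] .
  have cT: "0 < real (card T)" using T finT by (simp add: card_gt_0_iff)
  define Y where "Y = (\<lambda>t. (\<Sum>\<gamma>\<in>\<Lambda>. Re (\<omega> \<gamma> * \<gamma> t)) / 8 - ?k / 32)"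
  have corr: "real (card T) / 2 \<le> (\<Sum>t\<in>T. Re (\<omega> \<gamma> * \<gamma> t))" if "\<gamma> \<in> \<Lambda>" for \<gamma>
  proof -
    have "(\<Sum>t\<in>T. \<omega> \<gamma> * \<gamma> t) = cnj (sgn (\<Sum>t\<in>T. \<gamma> t)) * (\<Sum>t\<in>T. \<gamma> t)"
      by (simp add: \<omega>_def sum_distrib_left)
    also have "\<dots> = complex_of_real (cmod (\<Sum>t\<in>T. \<gamma> t))"
    proof -
      have "cnj (sgn z) * z = complex_of_real (cmod z)" for z :: complex
        using complex_norm_square[of z] by (cases "z = 0") (auto simp: sgn_eq power2_eq_square field_simps)
      thus ?thesis .
    qed
    finally have "(\<Sum>t\<in>T. Re (\<omega> \<gamma> * \<gamma> t)) = cmod (\<Sum>t\<in>T. \<gamma> t)"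
      by (metis Re_complex_of_real Re_sum)
    moreover have "1 / 2 \<le> cmod (mhat T \<gamma>)" using that \<Lambda> by (auto simp: large_spectrum_def)
    ultimately show ?thesis using cT by (simp add: cmod_mhat le_divide_eq)
  qed
  have "?k * (real (card T) / 2) = (\<Sum>\<gamma>\<in>\<Lambda>. real (card T) / 2)" by (simp only: sum_constant)
  also have "\<dots> \<le> (\<Sum>\<gamma>\<in>\<Lambda>. \<Sum>t\<in>T. Re (\<omega> \<gamma> * \<gamma> t))" by (intro sum_mono corr)
  also have "\<dots> = (\<Sum>t\<in>T. \<Sum>\<gamma>\<in>\<Lambda>. Re (\<omega> \<gamma> * \<gamma> t))" by (rule sum.swap)
  finally have *: "?k * (real (card T) / 2) \<le> (\<Sum>t\<in>T. \<Sum>\<gamma>\<in>\<Lambda>. Re (\<omega> \<gamma> * \<gamma> t))" .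
  have "(\<Sum>t\<in>T. Y t) = (\<Sum>t\<in>T. \<Sum>\<gamma>\<in>\<Lambda>. Re (\<omega> \<gamma> * \<gamma> t)) / 8 - real (card T) * (?k / 32)"
    by (simp only: Y_def sum_subtractf sum_divide_distrib[symmetric] sum_constant)
  hence Y: "real (card T) * (?k / 32) \<le> (\<Sum>t\<in>T. Y t)" using * by (simp add: field_simps)
  \<comment> \<open>Jensen's inequality for \<open>exp\<close>, carried out with the tangent at
    \<open>?k / 32\<close>.\<close>
  have "b * real (card T) * exp (?k / 32) \<le> b * (\<Sum>t\<in>T. exp (?k / 32) * (1 + (Y t - ?k / 32)))"
  proof -
    have "(\<Sum>t\<in>T. exp (?k / 32) * (1 + (Y t - ?k / 32))) 
        = exp (?k / 32) * (real (card T) + ((\<Sum>t\<in>T. Y t) - real (card T) * (?k / 32)))"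
      unfolding sum_distrib_left[symmetric] sum.distrib sum_subtractf by simp
    also have "\<dots> \<ge> exp (?k / 32) * real (card T)" using Y by (intro mult_left_mono) auto
    finally show ?thesis using b by (simp add: mult_ac)
  qed
  also have "\<dots> \<le> b * (\<Sum>t\<in>T. riesz \<omega> \<Lambda> t)"
  proof (intro mult_left_mono sum_mono)
    fix t assume t: "t \<in> T"
    have "exp (?k / 32) * (1 + (Y t - ?k / 32)) \<le> exp (?k / 32) * exp (Y t - ?k / 32)"
      by (intro mult_left_mono exp_ge_add_one_self) auto
    also have "\<dots> = exp (Y t)" by (simp add: exp_diff)
    also have "\<dots> \<le> riesz \<omega> \<Lambda> t" unfolding Y_def using t T by (intro riesz_lower \<Lambda>c \<omega>) auto
    finally show "exp (?k / 32) * (1 + (Y t - ?k / 32)) \<le> riesz \<omega> \<Lambda> t" .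
  qed (use b in auto)
  also have "\<dots> \<le> (\<Sum>t\<in>T. \<beta> t * riesz \<omega> \<Lambda> t)"
    unfolding sum_distrib_left using \<beta>(2) T
    by (intro sum_mono mult_right_mono riesz_nonneg \<Lambda>c \<omega>) auto
  also have "\<dots> \<le> (\<Sum>x\<in>carrier G. \<beta> x * riesz \<omega> \<Lambda> x)"
    using T by (intro sum_mono2 mult_nonneg_nonneg \<beta> riesz_nonneg \<Lambda>c \<omega>) auto
  also have "\<dots> \<le> exp (?k / 64)" by (intro valid \<omega>)
  finally have "b * real (card T) * exp (?k / 32) \<le> exp (?k / 64)" .
  moreover have "exp (?k / 32) = exp (?k / 64) * exp (?k / 64)" by (simp add: exp_add[symmetric])
  ultimately have "(b * real (card T) * exp (?k / 64)) * exp (?k / 64) \<le> 1 * exp (?k / 64)" by (simp add: mult_ac)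
  thus ?thesis by (rule mult_right_le_imp_le) simp
qed

text \<open>\<open>\<Lambda>\<close> is maximal subject to the Riesz product bound \<open>exp (|\<Lambda>| / 64)\<close>; adding another character
  breaks the bound, which forces correlation with \<open>\<beta>\<close>.\<close>

lemma maximal_riesz:
  assumes T: "T \<subseteq> carrier G" "T \<noteq> {}"
    and \<beta>: "\<And>x. x \<in> carrier G \<Longrightarrow> 0 \<le> \<beta> x" "\<And>x. x \<in> T \<Longrightarrow> b \<le> \<beta> x" "(\<Sum>x\<in>carrier G. \<beta> x) = 1"
    and b: "0 < b"
    and n: "1 \<le> b * real (card T) * exp (real n / 64)"
  shows "\<exists>\<Lambda> \<subseteq> large_spectrum T. b * real (card T) * exp (real (card \<Lambda>) / 64) \<le> 1 \<and>
    (\<forall>\<gamma>\<in>large_spectrum T - \<Lambda>. \<exists>\<phi>\<in>characters G. exp (- real n / 8) / 8 < cmod (fhat \<beta> \<phi>) \<and>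
     (\<forall>u\<in>carrier G. cmod (\<gamma> u - 1) \<le> (\<Sum>\<theta>\<in>\<Lambda>. cmod (\<theta> u - 1)) + cmod (\<phi> u - 1)))"
proof -
  define valid where "valid = (\<lambda>\<Lambda>. \<forall>\<omega>. (\<forall>\<phi>. cmod (\<omega> \<phi>) \<le> 1) \<longrightarrow>
       (\<Sum>x\<in>carrier G. \<beta> x * riesz \<omega> \<Lambda> x) \<le> exp (real (card \<Lambda>) / 64))"
  define \<V> where "\<V> = {\<Lambda>. \<Lambda> \<subseteq> large_spectrum T \<and> valid \<Lambda>}"
  have finS: "finite (large_spectrum T)" by (rule finite_subset[OF _ finite_characters]) (auto simp: large_spectrum_def)
  have "finite \<V>" by (rule finite_subset[of _ "Pow (large_spectrum T)"]) (auto simp: \<V>_def finS)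
  moreover have "{} \<in> \<V>" using \<beta>(3) by (simp add: \<V>_def valid_def riesz_def)
  ultimately obtain \<Lambda> where \<Lambda>: "\<Lambda> \<in> \<V>" "\<And>\<Lambda>'. \<Lambda>' \<in> \<V> \<Longrightarrow> \<Lambda> \<subseteq> \<Lambda>' \<Longrightarrow> \<Lambda> = \<Lambda>'"
    using finite_has_maximal2[of \<V> "{}"] by auto
  have \<Lambda>S: "\<Lambda> \<subseteq> large_spectrum T" and v: "valid \<Lambda>" using \<Lambda>(1) by (auto simp: \<V>_def)
  have \<Lambda>c: "\<Lambda> \<subseteq> characters G" using \<Lambda>S by (auto simp: large_spectrum_def)
  have fin\<Lambda>: "finite \<Lambda>" using finite_subset[OF \<Lambda>S finS] .
  have bound: "b * real (card T) * exp (real (card \<Lambda>) / 64) \<le> 1"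
    using \<beta> v by (intro riesz_card_bound[of \<Lambda> T \<beta> b] \<Lambda>S T b) (auto simp: valid_def)
  \<comment> \<open>The size bound for \<open>\<Lambda>\<close> and the hypothesis on
    \<open>n\<close> compare the same expression with 1 from opposite sides.\<close>
  have kn: "card \<Lambda> \<le> n"
  proof -
    have "0 < b * real (card T)" using b T finite_subset[OF T(1) finite_carrier] by (simp add: card_gt_0_iff)
    moreover have "b * real (card T) * exp (real (card \<Lambda>) / 64) \<le> b * real (card T) * exp (real n / 64)"
      using bound n by linarith
    ultimately have "exp (real (card \<Lambda>) / 64) \<le> exp (real n / 64)" by (rule mult_left_le_imp_le[rotated])
    thus ?thesis by simp
  qed
  have "\<exists>\<phi>\<in>characters G. exp (- real n / 8) / 8 < cmod (fhat \<beta> \<phi>) \<and>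
     (\<forall>u\<in>carrier G. cmod (\<gamma> u - 1) \<le> (\<Sum>\<theta>\<in>\<Lambda>. cmod (\<theta> u - 1)) + cmod (\<phi> u - 1))"
    if \<gamma>: "\<gamma> \<in> large_spectrum T" "\<gamma> \<notin> \<Lambda>" for \<gamma>
  proof -
    let ?k = "real (card \<Lambda>)"
    have \<gamma>c: "\<gamma> \<in> characters G" using \<gamma> by (auto simp: large_spectrum_def)
    have "insert \<gamma> \<Lambda> \<notin> \<V>" using \<Lambda>(2)[of "insert \<gamma> \<Lambda>"] \<gamma> by blast
    hence "\<not> valid (insert \<gamma> \<Lambda>)" using \<gamma> \<Lambda>S by (auto simp: \<V>_def)
    then obtain \<omega> where \<omega>: "\<And>\<phi>. cmod (\<omega> \<phi>) \<le> 1"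
      and big: "exp (real (card (insert \<gamma> \<Lambda>)) / 64) < (\<Sum>x\<in>carrier G. \<beta> x * riesz \<omega> (insert \<gamma> \<Lambda>) x)"
      by (auto simp: valid_def not_le)
    define J where "J = (\<Sum>x\<in>carrier G. \<beta> x * \<gamma> x * complex_of_real (riesz \<omega> \<Lambda> x))"
    have "(\<Sum>x\<in>carrier G. \<beta> x * riesz \<omega> (insert \<gamma> \<Lambda>) x)
        = (\<Sum>x\<in>carrier G. \<beta> x * riesz \<omega> \<Lambda> x) + Re (\<omega> \<gamma> * J) / 8"
    proof -
      have "Re (\<omega> \<gamma> * J) / 8 = (\<Sum>x\<in>carrier G. \<beta> x * riesz \<omega> \<Lambda> x * (Re (\<omega> \<gamma> * \<gamma> x) / 8))"
        unfolding J_def sum_distrib_left Re_sum sum_divide_distrib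
        by (intro sum.cong) (simp_all add: algebra_simps)
      thus ?thesis using \<gamma>(2) fin\<Lambda> by (simp add: riesz_def algebra_simps sum.distrib)
    qed
    moreover have "(\<Sum>x\<in>carrier G. \<beta> x * riesz \<omega> \<Lambda> x) \<le> exp (?k / 64)" using v \<omega> by (auto simp: valid_def)
    \<comment> \<open>The allowed bound grows by at least
      \<open>exp (?k / 64) / 64 \<ge> 1 / 64\<close> when \<open>\<gamma>\<close> is added, yet it
      is exceeded. Hence the new term \<open>Re (\<omega> \<gamma> * J) / 8\<close> is above
      \<open>1 / 64\<close>.\<close>
    moreover have "exp (?k / 64) * (1 + 1 / 64) \<le> exp (real (card (insert \<gamma> \<Lambda>)) / 64)"
    proof -
      have "real (card (insert \<gamma> \<Lambda>)) / 64 = ?k / 64 + 1 / 64" using \<gamma>(2) fin\<Lambda> by (simp add: add_divide_distrib)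
      thus ?thesis by (simp only: exp_add) (intro mult_left_mono exp_ge_add_one_self; simp)
    qed
    moreover have "exp (?k / 64) * (1 + 1 / 64) = exp (?k / 64) + exp (?k / 64) / 64" "1 \<le> exp (?k / 64)"
      by (simp_all add: field_simps)
    ultimately have "1 / 8 < Re (\<omega> \<gamma> * J)" using big by linarith
    also have "\<dots> \<le> cmod (\<omega> \<gamma> * J)" by (rule complex_Re_le_cmod)
    also have "\<dots> \<le> cmod J" using \<omega>[of \<gamma>] by (simp add: norm_mult mult_left_le_one_le)
    finally have J: "1 / 8 < cmod J" .
    \<comment> \<open>The expansion may cost \<open>(9/8) ^ card \<Lambda>\<close>, which is at most
      \<open>exp (n / 8)\<close>; this is the origin of the exponentially small threshold.\<close>
    have "exp (- real n / 8) / 8 * (9 / 8) ^ card \<Lambda> \<le> 1 / 8"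
    proof -
      have "(9 / 8) ^ card \<Lambda> \<le> exp (1 / 8 :: real) ^ card \<Lambda>"
        using exp_ge_add_one_self[of "1/8"] by (intro power_mono) auto
      also have "\<dots> = exp (?k / 8)" by (simp add: exp_of_nat_mult[symmetric])
      also have "\<dots> \<le> exp (real n / 8)" using kn by simp
      finally have "exp (- real n / 8) * (9 / 8) ^ card \<Lambda> \<le> exp (- real n / 8) * exp (real n / 8)"
        by (intro mult_left_mono) auto
      also have "\<dots> = 1" by (simp add: exp_add[symmetric])
      finally show ?thesis by simp
    qed
    hence "exp (- real n / 8) / 8 * (9 / 8) ^ card \<Lambda> < cmod J" using J by linarith
    from riesz_expand[OF fin\<Lambda> \<Lambda>c \<gamma>c _ \<omega> this[unfolded J_def]]
    obtain \<phi> :: "'a \<Rightarrow> complex" where \<phi>: "\<phi> \<in> characters G" "exp (- real n / 8) / 8 < cmod (\<Sum>x\<in>carrier G. \<beta> x * \<phi> x)"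
      "\<forall>u\<in>carrier G. cmod (\<gamma> u - 1) \<le> (\<Sum>\<theta>\<in>\<Lambda>. cmod (\<theta> u - 1)) + cmod (\<phi> u - 1)" by auto
    have "fhat \<beta> \<phi> = cnj (\<Sum>x\<in>carrier G. \<beta> x * \<phi> x)" by (simp add: fhat_def)
    hence "cmod (fhat \<beta> \<phi>) = cmod (\<Sum>x\<in>carrier G. \<beta> x * \<phi> x)" by (simp only: complex_mod_cnj)
    thus ?thesis using \<phi> by (intro bexI[of _ \<phi>]) simp_all
  qed
  thus ?thesis using \<Lambda>S bound by blast
qed


section \<open>A smooth weight on a Bohr set and the covering of the large spectrum\<close>

lemma fhat_smear_funpow:
  assumes "D \<subseteq> carrier G" "\<gamma> \<in> characters G"
  shows "fhat ((smear D ^^ n) f) \<gamma> = mhat D \<gamma> ^ n * fhat f \<gamma>"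
  by (induction n) (auto simp: fhat_smear[OF assms])

lemma smear_nonneg:
  assumes "D \<subseteq> carrier G" "\<And>x. x \<in> carrier G \<Longrightarrow> 0 \<le> f x" "x \<in> carrier G"
  shows "0 \<le> smear D f x"
  using assms by (auto simp: smear_def subset_iff intro!: divide_nonneg_nonneg sum_nonneg)

text \<open>The weight is flat on the inner Bohr set, so it dominates densities there, while its Fourier
  transform is small unless that of the small Bohr set \<open>D\<close> is bounded below.\<close>

lemma smear_unif_bohr:
  fixes n :: nat
  assumes \<Gamma>: "\<Gamma> \<subseteq> characters G" and r: "0 \<le> r" and \<kappa>: "0 \<le> \<kappa>"
  defines "E \<equiv> bohr_set G (Bohr \<Gamma> (r + real n * \<kappa>))" and "D \<equiv> bohr_set G (Bohr \<Gamma> \<kappa>)"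
  shows "(\<forall>x\<in>carrier G. 0 \<le> (smear D ^^ n) (unif E) x)"
    and "(\<Sum>x\<in>carrier G. (smear D ^^ n) (unif E) x) = 1"
    and "\<forall>x\<in>bohr_set G (Bohr \<Gamma> r). (smear D ^^ n) (unif E) x = 1 / real (card E)"
    and "\<phi> \<in> characters G \<Longrightarrow> cmod (fhat ((smear D ^^ n) (unif E)) \<phi>) \<le> cmod (mhat D \<phi>) ^ n"
proof -
  have D: "D \<subseteq> carrier G" "D \<noteq> {}" using one_in_bohr[OF \<Gamma> \<kappa>] bohr_subset by (auto simp: D_def)
  have cD: "0 < real (card D)" using card_bohr_pos[OF \<Gamma> \<kappa>] by (simp add: D_def)
  have cE: "0 < real (card E)" using card_bohr_pos[OF \<Gamma>, of "r + real n * \<kappa>"] r \<kappa> by (simp add: E_def)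
  have E: "E \<subseteq> carrier G" using bohr_subset by (simp add: E_def)
  have nonneg: "\<forall>x\<in>carrier G. 0 \<le> (smear D ^^ j) (unif E) x" for j
  proof (induction j)
    case (Suc j)
    then show ?case using smear_nonneg[OF D(1)] by simp
  qed (simp add: unif_def)
  show "(\<forall>x\<in>carrier G. 0 \<le> (smear D ^^ n) (unif E) x)" by (rule nonneg)
  have tot0: "(\<Sum>x\<in>carrier G. unif E x) = 1"
    using cE E by (simp add: unif_def sum_divide_distrib[symmetric] indicator_def sum.If_cases Int_absorb1)
  have "(\<Sum>x\<in>carrier G. (smear D ^^ j) (unif E) x) = 1" for j
    by (induction j) (simp_all add: tot0 sum_smear[OF D])
  thus "(\<Sum>x\<in>carrier G. (smear D ^^ n) (unif E) x) = 1" .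
  \<comment> \<open>Each averaging over \<open>D\<close> uses up \<open>\<kappa>\<close> of the
    radius on which the function is constant; of \<open>r + n * \<kappa>\<close> the radius
    \<open>r\<close> remains after \<open>n\<close> rounds.\<close>
  have val: "j \<le> n \<Longrightarrow> \<forall>x\<in>bohr_set G (Bohr \<Gamma> (r + real (n - j) * \<kappa>)). (smear D ^^ j) (unif E) x = 1 / real (card E)" for j
  proof (induction j)
    case 0
    then show ?case by (simp add: unif_def E_def)
  next
    case (Suc j)
    have "(smear D ^^ j) (unif E) (x \<otimes> inv z) = 1 / real (card E)" 
      if "x \<in> bohr_set G (Bohr \<Gamma> (r + real (n - Suc j) * \<kappa>))" "z \<in> D" for x z
    proof -
      have "x \<otimes> inv z \<in> bohr_set G (Bohr \<Gamma> (r + real (n - Suc j) * \<kappa> + \<kappa>))"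
        using bohr_mult[OF \<Gamma> that(1) bohr_inv[OF \<Gamma> that(2)[unfolded D_def]]] .
      moreover have "r + real (n - Suc j) * \<kappa> + \<kappa> = r + real (n - j) * \<kappa>"
        using Suc.prems by (simp add: of_nat_diff algebra_simps)
      ultimately have "x \<otimes> inv z \<in> bohr_set G (Bohr \<Gamma> (r + real (n - j) * \<kappa>))" by (simp only:)
      thus ?thesis using Suc.IH Suc.prems by (meson Suc_leD)
    qed
    hence "smear D ((smear D ^^ j) (unif E)) x = 1 / real (card E)"
      if "x \<in> bohr_set G (Bohr \<Gamma> (r + real (n - Suc j) * \<kappa>))" for x
      using that cD by (simp add: smear_def)
    thus ?case by simp
  qed
  show "\<forall>x\<in>bohr_set G (Bohr \<Gamma> r). (smear D ^^ n) (unif E) x = 1 / real (card E)"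
    using val[of n] by simp
  show "cmod (fhat ((smear D ^^ n) (unif E)) \<phi>) \<le> cmod (mhat D \<phi>) ^ n" if \<phi>: "\<phi> \<in> characters G"
  proof -
    have "cmod (fhat (unif E) \<phi>) \<le> (\<Sum>x\<in>carrier G. cmod (complex_of_real (unif E x) * cnj (\<phi> x)))"
      unfolding fhat_def by (rule norm_sum)
    also have "\<dots> = (\<Sum>x\<in>carrier G. unif E x)"
      using \<phi> by (intro sum.cong) (auto simp: norm_mult norm_divide unif_def)
    finally have "cmod (fhat (unif E) \<phi>) \<le> 1" using tot0 by simp
    thus ?thesis by (simp add: fhat_smear_funpow[OF D(1) \<phi>] norm_mult norm_power mult_left_le)
  qed
qed

text \<open>\<open>maximal_riesz\<close> is applied to a weight equal to \<open>1 / card E\<close>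
  on \<open>T\<close>. As \<open>E\<close> is at most twice as large as the Bohr set of radius
  \<open>r\<close>, the density \<open>\<tau>\<close> is only halved, whence
  \<open>2 / \<tau>\<close>. A character of the large spectrum outside \<open>\<Lambda>\<close> is
  controlled by \<open>\<Lambda>\<close> and one \<open>\<phi>\<close> correlating with the weight,
  and \<open>\<phi>\<close> is controlled by the regularity of \<open>D\<close>.\<close>

lemma chang_sanders:
  assumes \<Gamma>: "\<Gamma> \<subseteq> characters G" and d: "1 \<le> card \<Gamma>" and r: "0 \<le> r" "r \<le> 2"
    and growth: "card (bohr_set G (Bohr \<Gamma> ((1 + 1 / (12 * real (card \<Gamma>))) * r))) \<le> 2 * card (bohr_set G (Bohr \<Gamma> r))"
    and T: "T \<subseteq> bohr_set G (Bohr \<Gamma> r)" "T \<noteq> {}"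
    and \<tau>: "0 < \<tau>" "\<tau> * real (card (bohr_set G (Bohr \<Gamma> r))) \<le> real (card T)"
    and \<nu>: "0 < \<nu>" "\<nu> \<le> 1" and n: "1 \<le> n" "64 * ln (2 / \<tau>) \<le> real n"
  shows "\<exists>\<Lambda> \<subseteq> characters G. real (card \<Lambda>) \<le> 64 * ln (2 / \<tau>) \<and>
    (\<forall>\<gamma>\<in>large_spectrum T. \<forall>u\<in>bohr_set G (Bohr (\<Gamma> \<union> \<Lambda>) (r * \<nu> / (100000 * (real (card \<Gamma>))\<^sup>2 * real n))).
        cmod (\<gamma> u - 1) \<le> \<nu>)"
proof -
  define d where "d = real (card \<Gamma>)"
  have d1: "1 \<le> d" using d by (simp add: d_def)
  have n1: "1 \<le> real n" using n by simp
  \<comment> \<open>The \<open>n\<close> averagings widen the radius by at most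
    \<open>n * \<kappa>0 = r / (12 * d)\<close>, the dilation covered by
    \<open>growth\<close>.\<close>
  define \<kappa>0 where "\<kappa>0 = r / (12 * d * real n)"
  have "0 \<le> \<kappa>0" using r d1 by (simp add: \<kappa>0_def)
  then obtain \<kappa> where \<kappa>: "\<kappa>0 / 8 \<le> \<kappa>" "\<kappa> \<le> \<kappa>0" and reg: "regular_bohr G (Bohr \<Gamma> \<kappa>)"
    using regular_bohr_exists[OF \<Gamma> d] by blast
  have \<kappa>pos: "0 \<le> \<kappa>" using \<kappa> \<open>0 \<le> \<kappa>0\<close> by simp
  define E where "E = bohr_set G (Bohr \<Gamma> (r + real n * \<kappa>))"
  define D where "D = bohr_set G (Bohr \<Gamma> \<kappa>)"
  define B where "B = bohr_set G (Bohr \<Gamma> r)"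
  define \<beta> where "\<beta> = (smear D ^^ n) (unif E)"
  note \<beta> = smear_unif_bohr[OF \<Gamma> r(1) \<kappa>pos, where n = n, folded D_def E_def B_def, folded \<beta>_def]
  have cB: "0 < real (card B)" using card_bohr_pos[OF \<Gamma> r(1)] by (simp add: B_def)
  have cE: "0 < real (card E)" using card_bohr_pos[OF \<Gamma>, of "r + real n * \<kappa>"] r \<kappa>pos by (simp add: E_def)
  have "real n * \<kappa> \<le> real n * \<kappa>0" using \<kappa> by (intro mult_left_mono) auto
  also have "\<dots> = 1 / (12 * d) * r" using n1 by (simp add: \<kappa>0_def)
  finally have "card E \<le> card (bohr_set G (Bohr \<Gamma> ((1 + 1 / (12 * real (card \<Gamma>))) * r)))"
    unfolding E_def by (intro card_bohr_mono) (simp add: algebra_simps d_def)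
  hence "card E \<le> 2 * card B" using growth by (simp add: B_def)
  hence EB: "real (card E) \<le> 2 * real (card B)" by linarith
  have Tc: "T \<subseteq> carrier G" using T(1) bohr_subset by blast
  have bT: "\<tau> / 2 \<le> 1 / real (card E) * real (card T)"
  proof -
    have "\<tau> * real (card E) \<le> \<tau> * (2 * real (card B))" using EB \<tau>(1) by (intro mult_left_mono) auto
    also have "\<dots> \<le> 2 * real (card T)" using \<tau>(2) by (simp add: B_def)
    finally show ?thesis using cE by (simp add: field_simps)
  qed
  have expn: "2 / \<tau> \<le> exp (real n / 64)"
  proof -
    have "ln (2 / \<tau>) \<le> real n / 64" using n by simp
    hence "exp (ln (2 / \<tau>)) \<le> exp (real n / 64)" by simp
    thus ?thesis using \<tau>(1) by simp
  qed
  have "1 = \<tau> / 2 * (2 / \<tau>)" using \<tau>(1) by simp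
  also have "\<dots> \<le> 1 / real (card E) * real (card T) * exp (real n / 64)"
    using bT expn \<tau>(1) by (intro mult_mono) auto
  finally have nn: "1 \<le> 1 / real (card E) * real (card T) * exp (real n / 64)" .
  obtain \<Lambda> where \<Lambda>: "\<Lambda> \<subseteq> large_spectrum T" "1 / real (card E) * real (card T) * exp (real (card \<Lambda>) / 64) \<le> 1"
    and near: "\<And>\<gamma>. \<gamma> \<in> large_spectrum T - \<Lambda> \<Longrightarrow> \<exists>\<phi>\<in>characters G. exp (- real n / 8) / 8 < cmod (fhat \<beta> \<phi>) \<and>
     (\<forall>u\<in>carrier G. cmod (\<gamma> u - 1) \<le> (\<Sum>\<theta>\<in>\<Lambda>. cmod (\<theta> u - 1)) + cmod (\<phi> u - 1))"
    using maximal_riesz[OF Tc T(2) _ _ \<beta>(2) _ nn] \<beta>(1,3) cE T(1)[folded B_def] by fastforce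
  have \<Lambda>c: "\<Lambda> \<subseteq> characters G" using \<Lambda>(1) by (auto simp: large_spectrum_def)
  have fin\<Lambda>: "finite \<Lambda>" using finite_subset[OF \<Lambda>c finite_characters] .
  have card\<Lambda>: "real (card \<Lambda>) \<le> 64 * ln (2 / \<tau>)"
  proof -
    have "\<tau> / 2 * exp (real (card \<Lambda>) / 64) \<le> 1"
      by (rule order_trans[OF mult_right_mono[OF bT] \<Lambda>(2)]) simp
    hence "exp (real (card \<Lambda>) / 64) \<le> 2 / \<tau>" using \<tau>(1) by (simp add: field_simps)
    hence "real (card \<Lambda>) / 64 \<le> ln (2 / \<tau>)" using \<tau>(1) by (subst ln_ge_iff) auto
    thus ?thesis by simp
  qed
  \<comment> \<open>The allowance \<open>\<nu>\<close> is split in halves: one for the at most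
    \<open>n\<close> characters of \<open>\<Lambda>\<close>, each contributing at most
    \<open>r1\<close>, and one for \<open>\<phi>\<close>.\<close>
  define r1 where "r1 = r * \<nu> / (100000 * d\<^sup>2 * real n)"
  have r1: "0 \<le> r1" using r \<nu> by (simp add: r1_def)
  have nr1: "real n * r1 \<le> \<nu> / 2"
  proof -
    have "r * \<nu> \<le> 2 * \<nu>" using r \<nu> by (intro mult_right_mono) auto
    moreover have "\<nu> * 1 \<le> \<nu> * d\<^sup>2" using \<nu> d1 by (intro mult_left_mono) (auto simp: one_le_power)
    ultimately have "2 * (r * \<nu>) \<le> \<nu> * (100000 * d\<^sup>2)" using \<nu> by linarith
    hence "r * \<nu> / (100000 * d\<^sup>2) \<le> \<nu> / 2" using d1 by (simp add: field_simps)
    thus ?thesis using n1 by (simp add: r1_def)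
  qed
  \<comment> \<open>Then \<open>24 * d * \<delta> = \<nu> / 32\<close>, and dividing by the lower
    bound \<open>1 / 16\<close> for the transform of \<open>D\<close> leaves
    \<open>\<nu> / 2\<close>.\<close>
  define \<delta> where "\<delta> = \<nu> / (768 * d)"
  have \<delta>: "0 \<le> \<delta>" "\<delta> \<le> 1 / (12 * real (card \<Gamma>))"
    using \<nu> d1 by (auto simp: \<delta>_def d_def[symmetric] frac_le)
  \<comment> \<open>\<open>73728 = 8 * 12 * 768\<close>, where 8 is the loss in finding a regular
    radius; it is rounded up to 100000 in \<open>r1\<close>.\<close>
  have r1\<delta>: "r1 \<le> \<delta> * \<kappa>"
  proof -
    have "\<delta> * (\<kappa>0 / 8) \<le> \<delta> * \<kappa>" using \<kappa> \<delta> by (intro mult_left_mono) auto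
    moreover have "\<delta> * (\<kappa>0 / 8) = r * \<nu> / (73728 * d\<^sup>2 * real n)"
      by (simp add: \<delta>_def \<kappa>0_def power2_eq_square mult_ac)
    moreover have "r1 \<le> r * \<nu> / (73728 * d\<^sup>2 * real n)"
      unfolding r1_def using r \<nu> d1 n1 by (intro divide_left_mono mult_right_mono) auto
    ultimately show ?thesis by linarith
  qed
  have "cmod (\<gamma> u - 1) \<le> \<nu>" if \<gamma>: "\<gamma> \<in> large_spectrum T" and u: "u \<in> bohr_set G (Bohr (\<Gamma> \<union> \<Lambda>) r1)" for \<gamma> u
  proof (cases "\<gamma> \<in> \<Lambda>")
    case True
    have "1 * r1 \<le> real n * r1" using n1 r1 by (rule mult_right_mono)
    moreover have "cmod (\<gamma> u - 1) \<le> r1" using u True by (auto simp: mem_bohr)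
    ultimately show ?thesis using nr1 \<nu> by linarith
  next
    case False
    then obtain \<phi> where \<phi>: "\<phi> \<in> characters G" "exp (- real n / 8) / 8 < cmod (fhat \<beta> \<phi>)"
     "\<forall>u\<in>carrier G. cmod (\<gamma> u - 1) \<le> (\<Sum>\<theta>\<in>\<Lambda>. cmod (\<theta> u - 1)) + cmod (\<phi> u - 1)"
      using near[of \<gamma>] \<gamma> by blast
    have uc: "u \<in> carrier G" using u by (simp add: mem_bohr)
    \<comment> \<open>Here the \<open>n\<close>-fold average pays off: a transform of
      \<open>D\<close> below \<open>1 / 16\<close> would give at most
      \<open>(1/8) ^ n * (1/2) ^ n \<le> exp (- n / 8) / 8\<close>, using
      \<open>n \<ge> 1\<close>.\<close>
    have mD: "1 / 16 \<le> cmod (mhat D \<phi>)"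
    proof (rule ccontr)
      assume "\<not> ?thesis"
      hence "cmod (mhat D \<phi>) ^ n \<le> (1 / 16) ^ n" by (intro power_mono) auto
      also have "\<dots> = (1 / 8) ^ n * (1 / 2) ^ n" by (simp add: power_mult_distrib[symmetric])
      also have "\<dots> \<le> (1 / 8) ^ 1 * exp (- 1 / 8) ^ n"
      proof (intro mult_mono power_decreasing power_mono)
        show "1 / 2 \<le> exp (- 1 / 8 :: real)" using exp_ge_add_one_self[of "- 1 / 8"] by simp
      qed (use n in auto)
      also have "\<dots> = exp (- real n / 8) / 8" by (simp add: exp_of_nat_mult[symmetric])
      finally show False using \<phi>(2) \<beta>(4)[OF \<phi>(1)] by linarith
    qed
    have "u \<in> bohr_set G (Bohr \<Gamma> r1)" using u by (auto simp: mem_bohr)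
    hence "u \<in> bohr_set G (Bohr \<Gamma> (\<delta> * \<kappa>))" using bohr_mono[OF r1\<delta>] by blast
    hence "cmod (\<phi> u - 1) * cmod (mhat D \<phi>) \<le> 24 * d * \<delta>"
      unfolding D_def d_def by (rule regular_bohr_char_bound[OF reg d \<delta> _ \<phi>(1)])
    moreover have "24 * d * \<delta> = \<nu> / 32" using d1 by (simp add: \<delta>_def)
    moreover have "cmod (\<phi> u - 1) * (1 / 16) \<le> cmod (\<phi> u - 1) * cmod (mhat D \<phi>)"
      using mD by (intro mult_left_mono) auto
    ultimately have \<phi>u: "cmod (\<phi> u - 1) \<le> \<nu> / 2" by linarith
    have "(\<Sum>\<theta>\<in>\<Lambda>. cmod (\<theta> u - 1)) \<le> (\<Sum>\<theta>\<in>\<Lambda>. r1)" using u by (intro sum_mono) (auto simp: mem_bohr)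
    also have "\<dots> = real (card \<Lambda>) * r1" by simp
    also have "\<dots> \<le> real n * r1" using r1 card\<Lambda> n(2) by (intro mult_right_mono) auto
    finally show ?thesis using nr1 \<phi>u \<phi>(3) uc by force
  qed
  thus ?thesis using card\<Lambda> \<Lambda>c by (intro exI[of _ \<Lambda>]) (auto simp: r1_def d_def)
qed

subsection \<open>Smoothing\<close>

lemma smear_close:
  assumes "D \<subseteq> carrier G" "D \<noteq> {}" "\<And>z. z \<in> D \<Longrightarrow> \<bar>f (x \<otimes> inv z) - c\<bar> \<le> e"
  shows "\<bar>smear D f x - c\<bar> \<le> e"
proof -
  have cD: "0 < real (card D)" using assms(2) finite_subset[OF assms(1)] by (simp add: card_gt_0_iff)
  have "smear D f x - c = (\<Sum>z\<in>D. f (x \<otimes> inv z) - c) / real (card D)"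
    using cD by (simp add: smear_def sum_subtractf diff_divide_distrib)
  moreover have "\<bar>\<Sum>z\<in>D. f (x \<otimes> inv z) - c\<bar> \<le> (\<Sum>z\<in>D. e)"
    by (intro order_trans[OF sum_abs] sum_mono assms)
  ultimately show ?thesis using cD by (simp add: divide_le_eq mult.commute)
qed

lemma smear_translate:
  assumes "D \<subseteq> carrier G" "D \<noteq> {}" "x \<in> carrier G" "g \<in> carrier G"
    and "\<And>y. y \<in> carrier G \<Longrightarrow> \<bar>f (y \<otimes> g) - f y\<bar> \<le> e"
  shows "\<bar>smear D f (x \<otimes> g) - smear D f x\<bar> \<le> e"
proof -
  have "smear D f (x \<otimes> g) - smear D f x = smear D (\<lambda>y. f (y \<otimes> g) - f y) x - 0"
  proof -
    have "f (x \<otimes> g \<otimes> inv z) = f (x \<otimes> inv z \<otimes> g)" if "z \<in> D" for z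
      using assms that by (simp add: m_assoc m_comm[of g] subset_iff)
    thus ?thesis by (simp add: smear_def sum_subtractf diff_divide_distrib)
  qed
  also have "\<bar>\<dots>\<bar> \<le> e" by (rule smear_close[OF assms(1,2)]) (use assms in auto)
  finally show ?thesis .
qed

text \<open>Convolution with the uniform measures on \<open>T\<close> and on its inverse. The shifts
  are then quotients of elements of \<open>T\<close>, which are the almost periods, and the Fourier
  multiplier has modulus \<open>(cmod (mhat T \<gamma>))\<^sup>2\<close>.\<close>

definition symm_smear :: "'a set \<Rightarrow> ('a \<Rightarrow> real) \<Rightarrow> 'a \<Rightarrow> real" where
  "symm_smear T f = smear T (smear ((\<lambda>x. inv x) ` T) f)"

text \<open>Averages of a function inherit its almost periods with the same error, so every one of
  the \<open>k\<close> rounds moves the function by at most \<open>\<delta>\<close>.\<close>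

lemma symm_smear_funpow_close:
  assumes T: "T \<subseteq> carrier G" "T \<noteq> {}"
    and f: "\<And>s t x. \<lbrakk>s \<in> T; t \<in> T; x \<in> carrier G\<rbrakk> \<Longrightarrow> \<bar>f (x \<otimes> (s \<otimes> inv t)) - f x\<bar> \<le> \<delta>"
    and x: "x \<in> carrier G"
  shows "\<bar>(symm_smear T ^^ k) f x - f x\<bar> \<le> real k * \<delta>"
proof -
  let ?T' = "(\<lambda>x. inv x) ` T"
  have T': "?T' \<subseteq> carrier G" "?T' \<noteq> {}" using T by auto
  have inv: "\<bar>(symm_smear T ^^ k) f (x \<otimes> (s \<otimes> inv t)) - (symm_smear T ^^ k) f x\<bar> \<le> \<delta>"
    if "s \<in> T" "t \<in> T" "x \<in> carrier G" for s t x k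
    using that(3)
  proof (induction k arbitrary: x)
    case 0
    then show ?case using f that by simp
  next
    case (Suc k)
    have g: "s \<otimes> inv t \<in> carrier G" using that T by auto
    show ?case using Suc.IH
      by (simp add: symm_smear_def) (intro smear_translate T T' g Suc.prems; simp)
  qed
  have step: "\<bar>symm_smear T g x - g x\<bar> \<le> \<delta>" if x: "x \<in> carrier G"
    and g: "\<And>s t x. \<lbrakk>s \<in> T; t \<in> T; x \<in> carrier G\<rbrakk> \<Longrightarrow> \<bar>g (x \<otimes> (s \<otimes> inv t)) - g x\<bar> \<le> \<delta>" for g x
    unfolding symm_smear_def
  proof (rule smear_close[OF T])
    fix z assume z: "z \<in> T"
    show "\<bar>smear ?T' g (x \<otimes> inv z) - g x\<bar> \<le> \<delta>"
    proof (rule smear_close[OF T'])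
      fix w assume "w \<in> ?T'"
      then obtain t where t: "t \<in> T" "w = inv t" by auto
      have "x \<otimes> inv z \<otimes> inv w = x \<otimes> (t \<otimes> inv z)"
        using x z t T by (simp add: m_assoc m_comm[of t] subset_iff)
      thus "\<bar>g (x \<otimes> inv z \<otimes> inv w) - g x\<bar> \<le> \<delta>" using g[OF t(1) z x] by simp
    qed
  qed
  show ?thesis
  proof (induction k)
    case (Suc k)
    have "\<bar>symm_smear T ((symm_smear T ^^ k) f) x - (symm_smear T ^^ k) f x\<bar> \<le> \<delta>"
      by (intro step x inv)
    thus ?case using Suc by (simp add: algebra_simps)
  qed simp
qed

lemma cmod_fhat_symm_smear_funpow:
  assumes T: "T \<subseteq> carrier G" and \<gamma>: "\<gamma> \<in> characters G"
  shows "cmod (fhat ((symm_smear T ^^ k) f) \<gamma>) = cmod (mhat T \<gamma>) ^ (2 * k) * cmod (fhat f \<gamma>)"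
proof (induction k)
  case (Suc k)
  let ?T' = "(\<lambda>x. inv x) ` T"
  have T': "?T' \<subseteq> carrier G" using T by auto
  have inj: "inj_on (\<lambda>x. inv x) T" using T by (intro inj_on_inverseI[of _ "\<lambda>x. inv x"]) auto
  have "(\<Sum>z\<in>?T'. \<gamma> z) = cnj (\<Sum>z\<in>T. \<gamma> z)"
    unfolding sum.reindex[OF inj] using \<gamma> T by (auto simp: char_inv intro!: sum.cong)
  hence "cmod (mhat ?T' \<gamma>) = cmod (mhat T \<gamma>)"
    unfolding cmod_mhat card_image[OF inj] by (simp only: complex_mod_cnj)
  thus ?case using Suc
    by (simp add: symm_smear_def fhat_smear[OF T \<gamma>] fhat_smear[OF T' \<gamma>] norm_mult power2_eq_square)
qed simp

section \<open>Fourier estimates for translates of the triple convolution\<close>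

lemma fourier_translate_bound:
  assumes x: "x \<in> carrier G" and u: "u \<in> carrier G"
  shows "real cardG * \<bar>f (x \<otimes> u) - f x\<bar> \<le> (\<Sum>\<gamma>\<in>characters G. cmod (fhat f \<gamma>) * cmod (\<gamma> u - 1))"
proof -
  let ?f = "\<lambda>x. complex_of_real (f x)"
  have "of_nat cardG * (?f (x \<otimes> u) - ?f x) = of_nat cardG * ?f (x \<otimes> u) - of_nat cardG * ?f x"
    by (rule right_diff_distrib)
  also have "\<dots> = (\<Sum>\<gamma>\<in>characters G. fhat f \<gamma> * \<gamma> (x \<otimes> u)) - (\<Sum>\<gamma>\<in>characters G. fhat f \<gamma> * \<gamma> x)"
    using x u by (simp only: fourier_inversion[of _ ?f] fhat_def m_closed)
  also have "\<dots> = (\<Sum>\<gamma>\<in>characters G. fhat f \<gamma> * \<gamma> x * (\<gamma> u - 1))"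
    unfolding sum_subtractf[symmetric] using x u by (intro sum.cong) (auto simp: char_mult algebra_simps)
  finally have "cmod (of_nat cardG * (?f (x \<otimes> u) - ?f x)) \<le> (\<Sum>\<gamma>\<in>characters G. cmod (fhat f \<gamma> * \<gamma> x * (\<gamma> u - 1)))"
    by (simp only: norm_sum)
  also have "\<dots> = (\<Sum>\<gamma>\<in>characters G. cmod (fhat f \<gamma>) * cmod (\<gamma> u - 1))"
    using x by (intro sum.cong) (auto simp: norm_mult)
  also have "cmod (of_nat cardG * (?f (x \<otimes> u) - ?f x)) = real cardG * \<bar>f (x \<otimes> u) - f x\<bar>"
    unfolding norm_mult of_real_diff[symmetric] norm_of_real norm_of_nat by simp
  finally show ?thesis .
qed

lemma fhat_indicator: 
  assumes "M \<subseteq> carrier G"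
  shows "fhat (indicat_real M) \<gamma> = of_nat (card M) * mhat M \<gamma>"
proof -
  have fin: "finite M" using finite_subset[OF assms finite_carrier] .
  have "fhat (indicat_real M) \<gamma> = (\<Sum>x\<in>carrier G. if x \<in> M then cnj (\<gamma> x) else 0)"
    unfolding fhat_def by (intro sum.cong) (auto simp: indicator_def)
  also have "\<dots> = (\<Sum>x\<in>M. cnj (\<gamma> x))"
    using assms by (simp add: sum.If_cases Int_absorb1)
  finally show ?thesis using fin by (cases "M = {}") (auto simp: mhat_def)
qed

lemma parseval_indicator:
  assumes "M \<subseteq> carrier G"
  shows "(\<Sum>\<gamma>\<in>characters G. (cmod (fhat (indicat_real M) \<gamma>))\<^sup>2) = real cardG * real (card M)"
proof -
  have "(\<Sum>x\<in>carrier G. (cmod (complex_of_real (indicat_real M x)))\<^sup>2) = (\<Sum>x\<in>carrier G. if x \<in> M then 1 else 0)"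
    by (intro sum.cong) (auto simp: indicator_def)
  also have "\<dots> = real (card M)" using assms by (simp add: sum.If_cases Int_absorb1)
  finally show ?thesis unfolding fhat_def parseval by simp
qed

text \<open>The transform is a product in which the factor of \<open>A\<close> has modulus at most
  1. Cauchy-Schwarz and Parseval treat the other two, so the bound does not involve
  \<open>A\<close>.\<close>

lemma sum_fhat_tri_conv:
  assumes A: "A \<subseteq> carrier G" and M: "M \<subseteq> carrier G" "M \<noteq> {}" and L: "L \<subseteq> carrier G"
  shows "(\<Sum>\<gamma>\<in>characters G. cmod (fhat (tri_conv A M L) \<gamma>)) \<le> real cardG * sqrt (real (card M) * real (card L))"
proof -
  let ?m = "\<lambda>\<gamma>. cmod (fhat (indicat_real M) \<gamma>)" and ?l = "\<lambda>\<gamma>. cmod (fhat (indicat_real L) \<gamma>)"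
  have cM: "0 < real (card M)" using M(2) finite_subset[OF M(1)] by (simp add: card_gt_0_iff)
  have tri: "tri_conv A M L = (\<lambda>x. real (card M) * smear M (smear A (indicat_real L)) x)"
    using cM by (intro ext) (simp add: tri_conv_def smear_def[of M])
  have "cmod (fhat (tri_conv A M L) \<gamma>) \<le> \<bar>?m \<gamma>\<bar> * \<bar>?l \<gamma>\<bar>" if \<gamma>: "\<gamma> \<in> characters G" for \<gamma>
  proof -
    have "fhat (tri_conv A M L) \<gamma> = of_nat (card M) * fhat (smear M (smear A (indicat_real L))) \<gamma>"
      by (simp add: tri fhat_def sum_distrib_left mult_ac)
    also have "\<dots> = fhat (indicat_real M) \<gamma> * (mhat A \<gamma> * fhat (indicat_real L) \<gamma>)"
      by (simp add: fhat_smear[OF M(1) \<gamma>] fhat_smear[OF A \<gamma>] fhat_indicator[OF M(1)])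
    finally have "cmod (fhat (tri_conv A M L) \<gamma>) = ?m \<gamma> * (cmod (mhat A \<gamma>) * ?l \<gamma>)" by (simp add: norm_mult)
    also have "\<dots> \<le> ?m \<gamma> * ?l \<gamma>"
      using cmod_mhat_le[OF A \<gamma>] by (intro mult_left_mono mult_left_le_one_le) auto
    finally show ?thesis by simp
  qed
  hence "(\<Sum>\<gamma>\<in>characters G. cmod (fhat (tri_conv A M L) \<gamma>)) \<le> (\<Sum>\<gamma>\<in>characters G. \<bar>?m \<gamma>\<bar> * \<bar>?l \<gamma>\<bar>)"
    by (rule sum_mono)
  also have "\<dots> \<le> L2_set ?m (characters G) * L2_set ?l (characters G)" by (rule L2_set_mult_ineq)
  also have "\<dots> = sqrt ((real cardG)\<^sup>2 * (real (card M) * real (card L)))"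
    unfolding L2_set_def parseval_indicator[OF M(1)] parseval_indicator[OF L] real_sqrt_mult[symmetric]
    by (simp add: power2_eq_square mult_ac)
  also have "\<dots> = real cardG * sqrt (real (card M) * real (card L))"
    by (subst real_sqrt_mult) simp
  finally show ?thesis .
qed

text \<open>Replacing the function by its average \<open>H\<close> costs \<open>k * \<delta>\<close>
  at each of the two points. For \<open>H\<close>, characters of the large spectrum are within
  \<open>\<nu>\<close> of 1 at \<open>u\<close>; all others carry the multiplier
  \<open>(1 / 4) ^ k\<close> and change by at most 2.\<close>

lemma tri_conv_translate_bound:
  assumes A: "A \<subseteq> carrier G" and M: "M \<subseteq> carrier G" "M \<noteq> {}" and L: "L \<subseteq> carrier G"
    and T: "T \<subseteq> carrier G" "T \<noteq> {}"
    and period: "\<And>s t x. \<lbrakk>s \<in> T; t \<in> T; x \<in> carrier G\<rbrakk> \<Longrightarrow> 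
        \<bar>tri_conv A M L (x \<otimes> (s \<otimes> inv t)) - tri_conv A M L x\<bar> \<le> \<delta>"
    and \<nu>: "0 \<le> \<nu>" and spec: "\<And>\<gamma>. \<gamma> \<in> large_spectrum T \<Longrightarrow> cmod (\<gamma> u - 1) \<le> \<nu>"
    and x: "x \<in> carrier G" and u: "u \<in> carrier G"
  shows "\<bar>tri_conv A M L (x \<otimes> u) - tri_conv A M L x\<bar> 
    \<le> 2 * real k * \<delta> + (2 * (1 / 4) ^ k + \<nu>) * sqrt (real (card M) * real (card L))"
proof -
  let ?F = "tri_conv A M L"
  let ?c = "2 * (1 / 4) ^ k + \<nu>"
  define H where "H = (symm_smear T ^^ k) ?F"
  have close: "\<bar>H y - ?F y\<bar> \<le> real k * \<delta>" if "y \<in> carrier G" for y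
    unfolding H_def by (intro symm_smear_funpow_close T period that)
  have "real cardG * \<bar>H (x \<otimes> u) - H x\<bar> \<le> (\<Sum>\<gamma>\<in>characters G. cmod (fhat H \<gamma>) * cmod (\<gamma> u - 1))"
    by (rule fourier_translate_bound[OF x u])
  also have "\<dots> \<le> (\<Sum>\<gamma>\<in>characters G. ?c * cmod (fhat ?F \<gamma>))"
  proof (rule sum_mono)
    fix \<gamma> assume \<gamma>: "\<gamma> \<in> characters G"
    have "cmod (mhat T \<gamma>) ^ (2 * k) * cmod (\<gamma> u - 1) \<le> ?c"
    proof (cases "\<gamma> \<in> large_spectrum T")
      case True
      have "cmod (mhat T \<gamma>) ^ (2 * k) \<le> 1" using cmod_mhat_le[OF T(1) \<gamma>] by (intro power_le_one) auto
      hence "cmod (mhat T \<gamma>) ^ (2 * k) * cmod (\<gamma> u - 1) \<le> 1 * \<nu>"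
        using spec[OF True] by (intro mult_mono) auto
      thus ?thesis by (simp add: add_increasing)
    next
      case False
      hence "cmod (mhat T \<gamma>) ^ (2 * k) \<le> (1 / 2) ^ (2 * k)"
        using \<gamma> by (intro power_mono) (auto simp: large_spectrum_def)
      also have "\<dots> = (1 / 4) ^ k" by (simp add: power_mult power_divide)
      finally have "cmod (mhat T \<gamma>) ^ (2 * k) * cmod (\<gamma> u - 1) \<le> (1 / 4) ^ k * 2"
        using norm_triangle_ineq4[of "\<gamma> u" 1] \<gamma> u by (intro mult_mono) auto
      thus ?thesis using \<nu> by simp
    qed
    hence "cmod (fhat ?F \<gamma>) * (cmod (mhat T \<gamma>) ^ (2 * k) * cmod (\<gamma> u - 1)) \<le> cmod (fhat ?F \<gamma>) * ?c"
      by (intro mult_left_mono) auto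
    thus "cmod (fhat H \<gamma>) * cmod (\<gamma> u - 1) \<le> ?c * cmod (fhat ?F \<gamma>)"
      unfolding H_def cmod_fhat_symm_smear_funpow[OF T(1) \<gamma>] by (simp only: mult_ac)
  qed
  also have "\<dots> = ?c * (\<Sum>\<gamma>\<in>characters G. cmod (fhat ?F \<gamma>))" by (rule sum_distrib_left[symmetric])
  also have "\<dots> \<le> ?c * (real cardG * sqrt (real (card M) * real (card L)))"
    using \<nu> by (intro mult_left_mono sum_fhat_tri_conv A M L) auto
  finally have "real cardG * \<bar>H (x \<otimes> u) - H x\<bar> \<le> real cardG * (?c * sqrt (real (card M) * real (card L)))"
    by (simp only: mult_ac)
  hence "\<bar>H (x \<otimes> u) - H x\<bar> \<le> ?c * sqrt (real (card M) * real (card L))"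
    by (rule mult_left_le_imp_le) simp
  thus ?thesis using close[of x] close[of "x \<otimes> u"] x u by simp
qed

section \<open>The convolutions of the theorem in terms of averages\<close>

lemma convol_indicators:
  assumes A: "A \<subseteq> carrier G" "A \<noteq> {}" and M: "M \<subseteq> carrier G" and x: "x \<in> carrier G"
  shows "(indicat_real A \<star> indicat_real M \<star> indicat_real L) x = real (card A) * tri_conv A M L x"
proof -
  have cA: "0 < real (card A)" using A(2) finite_subset[OF A(1)] by (simp add: card_gt_0_iff)
  have ind: "(\<Sum>y\<in>carrier G. indicat_real X y * h y) = (\<Sum>y\<in>X. h y)" if "X \<subseteq> carrier G" for X and h :: "'a \<Rightarrow> real"
  proof -
    have "(\<Sum>y\<in>carrier G. indicat_real X y * h y) = (\<Sum>y\<in>carrier G. if y \<in> X then h y else 0)"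
      by (intro sum.cong) auto
    thus ?thesis using that by (simp add: sum.If_cases Int_absorb1)
  qed
  have "(indicat_real A \<star> indicat_real M \<star> indicat_real L) x
      = (\<Sum>y\<in>carrier G. \<Sum>w\<in>A. indicat_real M (y \<otimes> inv w) * indicat_real L (x \<otimes> inv y))"
    unfolding convol_def ind[OF A(1)] sum_distrib_right ..
  also have "\<dots> = (\<Sum>w\<in>A. \<Sum>y\<in>carrier G. indicat_real M (y \<otimes> inv w) * indicat_real L (x \<otimes> inv y))"
    by (rule sum.swap)
  also have "\<dots> = (\<Sum>w\<in>A. \<Sum>y\<in>M. indicat_real L (x \<otimes> inv y \<otimes> inv w))"
  proof (rule sum.cong[OF refl])
    fix w assume "w \<in> A"
    hence w: "w \<in> carrier G" using A by auto
    have "(\<Sum>y\<in>carrier G. indicat_real M (y \<otimes> inv w) * indicat_real L (x \<otimes> inv y))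
       = (\<Sum>y\<in>carrier G. indicat_real M (y \<otimes> w \<otimes> inv w) * indicat_real L (x \<otimes> inv (y \<otimes> w)))"
      using sum_translate[OF w, of "\<lambda>y. indicat_real M (y \<otimes> inv w) * indicat_real L (x \<otimes> inv y)"] by simp
    also have "\<dots> = (\<Sum>y\<in>carrier G. indicat_real M y * indicat_real L (x \<otimes> inv y \<otimes> inv w))"
      using w x by (intro sum.cong) (auto simp: m_assoc inv_mult)
    also have "\<dots> = (\<Sum>y\<in>M. indicat_real L (x \<otimes> inv y \<otimes> inv w))" by (rule ind[OF M])
    finally show "(\<Sum>y\<in>carrier G. indicat_real M (y \<otimes> inv w) * indicat_real L (x \<otimes> inv y)) = \<dots>" .
  qed
  also have "\<dots> = (\<Sum>y\<in>M. \<Sum>w\<in>A. indicat_real L (x \<otimes> inv y \<otimes> inv w))" by (rule sum.swap)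
  also have "\<dots> = real (card A) * tri_conv A M L x"
    unfolding tri_conv_def smear_def sum_divide_distrib[symmetric] using cA by simp
  finally show ?thesis .
qed

lemma convol_unif:
  assumes X: "X \<subseteq> carrier G" and x: "x \<in> carrier G"
  shows "(f \<star> unif X) x = smear X f x"
proof -
  have xx: "x \<otimes> inv (x \<otimes> inv y) = y" if "y \<in> carrier G" for y
    using x that by (simp add: inv_mult m_assoc[symmetric])
  have "(f \<star> unif X) x = (\<Sum>z\<in>carrier G. f (x \<otimes> inv z) * unif X z)"
    unfolding convol_def using x
    by (intro sum.reindex_bij_witness[of _ "\<lambda>z. x \<otimes> inv z" "\<lambda>y. x \<otimes> inv y"])
       (auto simp: xx)
  also have "\<dots> = (\<Sum>z\<in>carrier G. if z \<in> X then f (x \<otimes> inv z) / real (card X) else 0)"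
    by (intro sum.cong) (auto simp: unif_def)
  also have "\<dots> = smear X f x"
    using X by (simp add: sum.If_cases Int_absorb1 smear_def sum_divide_distrib)
  finally show ?thesis .
qed

lemma sup_norm_le:
  assumes "\<And>x. x \<in> carrier G \<Longrightarrow> \<bar>f x\<bar> \<le> c"
  shows "sup_norm G f \<le> c"
  unfolding sup_norm_def using assms by (subst Max_le_iff) auto

end

section \<open>Choice of the parameters\<close>

lemma ln2_ge_half: "1 / 2 \<le> ln (2::real)"
  using ln_ge_one_minus_inverse[of 2] by simp

lemma parameters_exist:
  fixes \<epsilon> \<eta> K \<sigma> :: real
  assumes \<epsilon>: "0 < \<epsilon>" "\<epsilon> < 1" and \<eta>: "0 < \<eta>" "\<eta> \<le> 1" and K: "1 \<le> K" and \<sigma>: "0 < \<sigma>" "\<sigma> \<le> 1"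
  shows "\<exists>k q m :: nat. 1 \<le> k \<and> 0 < q \<and> q \<le> m \<and>
     2 * (12 * real q / real m) ^ q \<le> (\<epsilon> / (8 * real k)) ^ (2 * q) * \<eta> \<and>
     2 * (1 / 4) ^ k \<le> \<epsilon> * sqrt \<eta> / 4 \<and>
     ln (2 / (\<sigma> / (2 * K ^ m)))
       \<le> 2160000 * (1 / \<epsilon>\<^sup>2 * (ln (2 / (\<epsilon> * \<eta>)))\<^sup>2 * ln (2 / \<eta>) * ln (2 * K) + ln (1 / \<sigma>))"
proof -
  define l where "l = ln (2 / (\<epsilon> * \<eta>))"
  define h where "h = ln (2 / \<eta>)"
  have "\<epsilon> * \<eta> \<le> 1 * 1" using \<epsilon> \<eta> by (intro mult_mono) auto
  hence "2 \<le> 2 / (\<epsilon> * \<eta>)" "2 \<le> 2 / \<eta>" using \<epsilon> \<eta> by (auto simp: le_divide_eq)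
  hence "ln 2 \<le> l" "ln 2 \<le> h" unfolding l_def h_def by (auto intro!: ln_mono)
  hence l: "1 / 2 \<le> l" and h: "1 / 2 \<le> h" using ln2_ge_half by linarith+
  define k where "k = nat \<lceil>l\<rceil> + 1"
  define q where "q = nat \<lceil>h\<rceil>"
  have k: "l + 1 \<le> real k" "real k \<le> l + 2" using l by (auto simp: k_def) linarith+
  have q: "h \<le> real q" "real q \<le> h + 1" using h by (auto simp: q_def)
  have q0: "0 < q" using q h by (cases q) auto
  have k1: "1 \<le> k" by (simp add: k_def)
  \<comment> \<open>A third of the accuracy \<open>\<epsilon> / (8 * k)\<close> that is required:
    the resulting \<open>9 ^ q\<close> compensates the factor \<open>\<eta>\<close>, since
    \<open>exp q \<ge> 2 / \<eta>\<close>.\<close>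
  define e where "e = \<epsilon> / (24 * real k)"
  have e: "0 < e" "e < 1" using \<epsilon> k1 by (auto simp: e_def divide_less_eq)
  \<comment> \<open>This makes \<open>12 * q / m \<le> e\<^sup>2 / 2\<close>; in the
    \<open>q\<close>-th power the denominator 2 absorbs the leading factor 2 of the claim.\<close>
  define m where "m = nat \<lceil>24 * real q / e\<^sup>2\<rceil>"
  have qe: "0 < 24 * real q / e\<^sup>2" using q0 e by simp
  have m: "24 * real q / e\<^sup>2 \<le> real m" "real m \<le> 24 * real q / e\<^sup>2 + 1"
    using qe by (auto simp: m_def)
  have e2: "e\<^sup>2 \<le> 1" using e by (simp add: power_le_one)
  have qm: "real q / e\<^sup>2 \<le> real m" using m q0 e by (simp add: field_simps)
  have "real q * 1 \<le> real q / e\<^sup>2" using e2 e q0 by (simp add: field_simps)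
  hence qlem: "q \<le> m" using qm by simp
  have m0: "0 < real m" using qlem q0 by simp
  have expq: "2 / \<eta> \<le> exp (real q)"
  proof -
    have "exp h \<le> exp (real q)" using q by simp
    thus ?thesis using \<eta> by (simp add: h_def)
  qed
  have small: "2 * (12 * real q / real m) ^ q \<le> (\<epsilon> / (8 * real k)) ^ (2 * q) * \<eta>"
  proof -
    have "12 * real q / real m \<le> e\<^sup>2 / 2" using m(1) m0 e by (simp add: field_simps)
    hence "(12 * real q / real m) ^ q \<le> (e\<^sup>2 / 2) ^ q" by (intro power_mono) auto
    also have "\<dots> = (e\<^sup>2) ^ q / 2 ^ q" by (simp add: power_divide)
    also have "\<dots> \<le> (e\<^sup>2) ^ q / 2"
      using q0 e power_increasing[of 1 q "2::real"] by (intro divide_left_mono) auto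
    finally have 1: "2 * (12 * real q / real m) ^ q \<le> (e\<^sup>2) ^ q" by simp
    have "1 \<le> 2 / \<eta> * \<eta>" using \<eta> by simp
    also have "\<dots> \<le> exp (real q) * \<eta>" using expq \<eta> by (intro mult_right_mono) auto
    also have "exp (real q) = exp 1 ^ q" by (simp add: exp_of_nat_mult[symmetric])
    also have "exp 1 ^ q * \<eta> \<le> 9 ^ q * \<eta>"
      using exp_le \<eta> by (intro mult_right_mono power_mono) auto
    finally have "(e\<^sup>2) ^ q * 1 \<le> (e\<^sup>2) ^ q * (9 ^ q * \<eta>)" using e by (intro mult_left_mono) auto
    also have "\<dots> = (\<epsilon> / (8 * real k)) ^ (2 * q) * \<eta>"
    proof -
      have "\<epsilon> / (8 * real k) = 3 * e" by (simp add: e_def)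
      hence "(\<epsilon> / (8 * real k)) ^ (2 * q) = (9 * e\<^sup>2) ^ q" by (simp add: power_mult power_mult_distrib)
      thus ?thesis by (simp add: power_mult_distrib)
    qed
    finally show ?thesis using 1 by simp
  qed
  have quarter: "2 * (1 / 4) ^ k \<le> \<epsilon> * sqrt \<eta> / 4"
  proof -
    have "2 / (\<epsilon> * \<eta>) = exp l" using \<epsilon> \<eta> by (simp add: l_def)
    also have "\<dots> \<le> exp (real (k - 1))" using k by (simp add: of_nat_diff k1)
    also have "\<dots> = exp 1 ^ (k - 1)" by (simp add: exp_of_nat_mult[symmetric])
    also have "\<dots> \<le> 4 ^ (k - 1)" using exp_le by (intro power_mono) auto
    finally have "4 * (2 / (\<epsilon> * \<eta>)) \<le> 4 * 4 ^ (k - 1)" by simp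
    also have "\<dots> = 4 ^ k" using k1 by (simp add: power_Suc[symmetric] del: power_Suc)
    finally have "8 / (\<epsilon> * \<eta>) \<le> 4 ^ k" by simp
    hence "8 \<le> 4 ^ k * (\<epsilon> * \<eta>)" using \<epsilon> \<eta> by (simp add: divide_le_eq)
    also have "\<dots> \<le> 4 ^ k * (\<epsilon> * sqrt \<eta>)"
    proof -
      have "\<eta> = sqrt \<eta> * sqrt \<eta>" using \<eta> by simp
      also have "\<dots> \<le> sqrt \<eta> * 1" using \<eta> by (intro mult_left_mono) auto
      finally show ?thesis using \<epsilon> by (intro mult_left_mono) auto
    qed
    finally show ?thesis by (simp add: power_divide field_simps)
  qed
  define X where "X = 1 / \<epsilon>\<^sup>2 * l\<^sup>2 * h"
  have mX: "real m \<le> 1080000 * X"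
  proof -
    have "real m \<le> 25 * real q / e\<^sup>2"
    proof -
      have "1 \<le> real q / e\<^sup>2" using q0 e2 e by (simp add: le_divide_eq)
      moreover have "24 * real q / e\<^sup>2 = 24 * (real q / e\<^sup>2)" "25 * real q / e\<^sup>2 = 25 * (real q / e\<^sup>2)"
        by simp_all
      ultimately show ?thesis using m(2) by linarith
    qed
    \<comment> \<open>\<open>14400 = 25 * 24\<^sup>2\<close>. As \<open>h\<close> and
      \<open>l\<close> are at least \<open>1 / 2\<close>, rounding gives
      \<open>q \<le> 3 * h\<close> and \<open>k \<le> 5 * l\<close>, whence
      \<open>1080000 = 14400 * 3 * 25\<close>.\<close>
    also have "\<dots> = 14400 * real q * (real k)\<^sup>2 / \<epsilon>\<^sup>2" by (simp add: e_def power_divide power_mult_distrib)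
    also have "\<dots> \<le> 14400 * (3 * h) * (5 * l)\<^sup>2 / \<epsilon>\<^sup>2"
      using q k h l by (intro divide_right_mono mult_mono power_mono) auto
    also have "\<dots> = 1080000 * X" by (simp add: X_def power2_eq_square)
    finally show ?thesis .
  qed
  define W where "W = ln (2 / (\<sigma> / (2 * K ^ m)))"
  have "W = ln (2 * 2 * K ^ m * (1 / \<sigma>))" by (simp add: W_def)
  also have "\<dots> = ln 2 + ln 2 + real m * ln K + ln (1 / \<sigma>)"
    using K \<sigma> ln_mult_pos[of 2 2] by (simp add: ln_mult_pos ln_realpow ln_div)
  also have "\<dots> \<le> 2 * real m * ln (2 * K) + ln (1 / \<sigma>)"
  proof -
    have "1 * ln 2 \<le> real m * ln (2::real)" using qlem q0 by (intro mult_right_mono) auto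
    moreover have "0 \<le> real m * ln K" using K by simp
    moreover have "2 * real m * ln (2 * K) = 2 * (real m * ln 2) + 2 * (real m * ln K)"
      using K by (simp add: ln_mult_pos algebra_simps)
    ultimately show ?thesis by linarith
  qed
  also have "\<dots> \<le> 2 * (1080000 * X) * ln (2 * K) + 2160000 * ln (1 / \<sigma>)"
    using mX K \<sigma> by (intro add_mono mult_right_mono mult_left_mono) auto
  finally have "W \<le> 2160000 * (X * ln (2 * K) + ln (1 / \<sigma>))" by simp
  thus ?thesis using k1 q0 qlem small quarter unfolding W_def X_def l_def h_def by blast
qed

context finite_comm_group
begin

section \<open>Assembly of the almost periods and the spectral bound\<close>

lemma bohr_min_radius:
  assumes "\<Gamma> \<subseteq> characters G"
  shows "bohr_set G (Bohr \<Gamma> (min \<rho> 2)) = bohr_set G (Bohr \<Gamma> \<rho>)"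
proof -
  have "cmod (\<gamma> x - 1) \<le> 2" if "\<gamma> \<in> \<Gamma>" "x \<in> carrier G" for \<gamma> x
    using norm_triangle_ineq4[of "\<gamma> x" 1] that assms by (auto simp: subset_iff)
  thus ?thesis by (auto simp: mem_bohr)
qed

text \<open>The regularity condition at its extreme dilation, in the form needed by
  \<open>chang_sanders\<close>. Truncating the radius at 2 leaves the set unchanged and can only
  shrink its dilate.\<close>

lemma regular_bohr_growth:
  assumes reg: "regular_bohr G (Bohr \<Gamma> \<rho>)" and d: "1 \<le> card \<Gamma>"
  shows "card (bohr_set G (Bohr \<Gamma> ((1 + 1 / (12 * real (card \<Gamma>))) * min \<rho> 2)))
    \<le> 2 * card (bohr_set G (Bohr \<Gamma> (min \<rho> 2)))"
proof -
  have \<Gamma>: "\<Gamma> \<subseteq> characters G" "0 \<le> \<rho>" using reg by (auto simp: regular_bohr_def is_bohr_def)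
  let ?\<delta> = "1 / (12 * real (card \<Gamma>))"
  let ?B = "bohr_set G (Bohr \<Gamma> \<rho>)" and ?E = "bohr_set G (Bohr \<Gamma> ((1 + ?\<delta>) * \<rho>))"
  have cB: "0 < real (card ?B)" using card_bohr_pos[OF \<Gamma>] by simp
  have "real (card ?E) / real (card ?B) \<le> 1 + 12 * real (card \<Gamma>) * \<bar>?\<delta>\<bar>"
    using reg[unfolded regular_bohr_def, THEN conjunct2, rule_format, of ?\<delta>]
    by (simp add: bohr_rank_def dilate_def)
  also have "\<dots> = 2" using d by simp
  finally have "real (card ?E) \<le> real (2 * card ?B)" using cB by (simp add: divide_le_eq)
  hence "card ?E \<le> 2 * card ?B" by linarith
  moreover have "card (bohr_set G (Bohr \<Gamma> ((1 + ?\<delta>) * min \<rho> 2))) \<le> card ?E"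
    by (intro card_bohr_mono mult_left_mono) auto
  ultimately show ?thesis unfolding bohr_min_radius[OF \<Gamma>(1)] by linarith
qed

text \<open>The error is split in two: \<open>2 * k\<close> periods of accuracy
  \<open>2 * c * card M\<close> with \<open>c = \<epsilon> / (8 * k)\<close> use up one half of
  \<open>\<epsilon> * card M\<close>. The spectral term is the other half, because
  \<open>sqrt \<eta> * sqrt (card M * card L) = card M\<close>.\<close>

lemma almost_period_bohr:
  assumes \<epsilon>: "0 < \<epsilon>" "\<epsilon> < 1"
    and A: "A \<subseteq> carrier G" "A \<noteq> {}" and M: "M \<subseteq> carrier G" "M \<noteq> {}" and L: "L \<subseteq> carrier G" "L \<noteq> {}"
    and reg: "regular_bohr G (Bohr \<Gamma> \<rho>)" and d: "1 \<le> card \<Gamma>"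
    and S: "S \<subseteq> bohr_set G (Bohr \<Gamma> \<rho>)" and K: "real (card (A <#> S)) \<le> K * real (card A)"
    and \<sigma>: "\<sigma> \<le> real (card S) / real (card (bohr_set G (Bohr \<Gamma> \<rho>)))" "0 < \<sigma>"
    and \<eta>: "\<eta> = real (card M) / real (card L)" "\<eta> \<le> 1"
    and d': "d' = 10 ^ 16 * (1 / \<epsilon>\<^sup>2 * (ln (2 / (\<epsilon> * \<eta>)))\<^sup>2 * ln (2 / \<eta>) * ln (2 * K) + ln (1 / \<sigma>))"
  shows "\<exists>\<Gamma>' \<rho>'. regular_bohr G (Bohr \<Gamma>' \<rho>') \<and> \<Gamma> \<subseteq> \<Gamma>' \<and> \<rho>' \<le> \<rho> \<and>
    real (card \<Gamma>') \<le> real (card \<Gamma>) + d' \<and>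
    min \<rho> 2 * \<epsilon> * sqrt \<eta> / ((real (card \<Gamma>))\<^sup>2 * d') \<le> \<rho>' \<and>
    (\<forall>u\<in>bohr_set G (Bohr \<Gamma>' \<rho>'). \<forall>x\<in>carrier G.
       \<bar>tri_conv A M L (x \<otimes> u) - tri_conv A M L x\<bar> \<le> \<epsilon> * real (card M))"
proof -
  have \<Gamma>: "\<Gamma> \<subseteq> characters G" "0 \<le> \<rho>" using reg by (auto simp: regular_bohr_def is_bohr_def)
  have fin\<Gamma>: "finite \<Gamma>" using finite_subset[OF \<Gamma>(1) finite_characters] .
  define r where "r = min \<rho> 2"
  have r: "0 \<le> r" "r \<le> 2" "r \<le> \<rho>" using \<Gamma> by (auto simp: r_def)
  define B where "B = bohr_set G (Bohr \<Gamma> \<rho>)"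
  have Br: "bohr_set G (Bohr \<Gamma> r) = B" by (simp add: B_def r_def bohr_min_radius[OF \<Gamma>(1)])
  have cB: "0 < real (card B)" using card_bohr_pos[OF \<Gamma>] by (simp add: B_def)
  have cM: "0 < real (card M)" using M(2) finite_subset[OF M(1)] by (simp add: card_gt_0_iff)
  have cL: "0 < real (card L)" using L(2) finite_subset[OF L(1)] by (simp add: card_gt_0_iff)
  have finA: "finite A" using finite_subset[OF A(1)] by simp
  have cA: "0 < real (card A)" using A(2) finA by (simp add: card_gt_0_iff)
  have \<eta>0: "0 < \<eta>" using cM cL by (simp add: \<eta>)
  have Sc: "S \<subseteq> carrier G" using S bohr_subset by blast
  have \<sigma>S: "\<sigma> * real (card B) \<le> real (card S)" using \<sigma>(1) cB by (simp add: B_def le_divide_eq)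
  have "0 < \<sigma> * real (card B)" using \<sigma>(2) cB by simp
  hence cS: "0 < real (card S)" using \<sigma>S by linarith
  hence Sne: "S \<noteq> {}" by auto
  have "card S \<le> card B" using S by (intro card_mono) (auto simp: B_def)
  hence \<sigma>1: "\<sigma> \<le> 1" using \<sigma>(1) cB by (simp add: B_def) (metis divide_le_eq_1_pos of_nat_le_iff order_trans of_nat_0_less_iff)
  \<comment> \<open>\<open>S\<close> is nonempty because \<open>\<sigma>\<close> is positive, so the
    product set contains a translate of \<open>A\<close>.\<close>
  have K1: "1 \<le> K"
  proof -
    obtain s where s: "s \<in> S" using Sne by auto
    have sc: "s \<in> carrier G" using s Sc by auto
    have "(\<lambda>a. a \<otimes> s) ` A \<subseteq> A <#> S" using s by (auto simp: set_mult_def)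
    moreover have "inj_on (\<lambda>a. a \<otimes> s) A" using A sc by (intro inj_onI) (auto simp: subset_iff)
    moreover have "finite (A <#> S)"
      using A Sc by (intro finite_subset[OF _ finite_carrier]) (auto simp: set_mult_def)
    ultimately have "card A \<le> card (A <#> S)" by (intro card_inj_on_le)
    hence "1 * real (card A) \<le> K * real (card A)" using K by simp
    thus ?thesis using cA by (rule mult_right_le_imp_le)
  qed
  obtain k q m :: nat where k: "1 \<le> k" and q: "0 < q" "q \<le> m"
    and small: "2 * (12 * real q / real m) ^ q \<le> (\<epsilon> / (8 * real k)) ^ (2 * q) * \<eta>"
    and quarter: "2 * (1 / 4) ^ k \<le> \<epsilon> * sqrt \<eta> / 4"
    and W: "ln (2 / (\<sigma> / (2 * K ^ m)))
       \<le> 2160000 * (1 / \<epsilon>\<^sup>2 * (ln (2 / (\<epsilon> * \<eta>)))\<^sup>2 * ln (2 / \<eta>) * ln (2 * K) + ln (1 / \<sigma>))"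
    using parameters_exist[OF \<epsilon> \<eta>0 \<eta>(2) K1 \<sigma>(2) \<sigma>1] by blast
  define c where "c = \<epsilon> / (8 * real k)"
  have c: "0 < c" using \<epsilon> k by (simp add: c_def)
  have "2 * (12 * real q / real m) ^ q * real (card L) \<le> c ^ (2 * q) * \<eta> * real (card L)"
    using small by (intro mult_right_mono) (auto simp: c_def)
  also have "\<dots> = c ^ (2 * q) * real (card M)" using cL by (simp add: \<eta>)
  finally obtain T where T: "T \<subseteq> S" "real (card S) \<le> 2 * K ^ m * real (card T)"
    and period: "\<And>s t x. \<lbrakk>s \<in> T; t \<in> T; x \<in> carrier G\<rbrakk> \<Longrightarrow>
        \<bar>tri_conv A M L (x \<otimes> (s \<otimes> inv t)) - tri_conv A M L x\<bar> \<le> 2 * c * real (card M)"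
    using almost_period[OF A L M Sc K q, of c] c by fastforce
  have Tc: "T \<subseteq> carrier G" using T Sc by blast
  have Tne: "T \<noteq> {}" using T(2) cS by auto
  define \<tau> where "\<tau> = \<sigma> / (2 * K ^ m)"
  have Km: "1 \<le> K ^ m" using K1 by (rule one_le_power)
  have \<tau>: "0 < \<tau>" using \<sigma> Km by (simp add: \<tau>_def)
  have \<tau>T: "\<tau> * real (card B) \<le> real (card T)"
  proof -
    have "\<tau> * real (card B) = \<sigma> * real (card B) / (2 * K ^ m)" by (simp add: \<tau>_def)
    also have "\<dots> \<le> (2 * K ^ m * real (card T)) / (2 * K ^ m)"
      using \<sigma>S T(2) Km by (intro divide_right_mono) auto
    also have "\<dots> = real (card T)" using K1 by simp
    finally show ?thesis .
  qed
  define W where "W = ln (2 / \<tau>)"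
  have W2: "1 / 2 \<le> W"
  proof -
    have "\<tau> \<le> 1" using \<sigma> \<sigma>1 Km by (simp add: \<tau>_def divide_le_eq)
    hence "2 \<le> 2 / \<tau>" using \<tau> by (simp add: le_divide_eq)
    hence "ln 2 \<le> W" unfolding W_def by (intro ln_mono) auto
    thus ?thesis using ln2_ge_half by linarith
  qed
  \<comment> \<open>\<open>10 ^ 16\<close> exceeds \<open>2160000 * 10 ^ 9\<close>. The spare factor
    \<open>10 ^ 9\<close> covers the \<open>64 * W\<close> new characters and the numerical loss in
    the radius.\<close>
  have Wd': "1000000000 * W \<le> d'"
  proof -
    define Y where "Y = 1 / \<epsilon>\<^sup>2 * (ln (2 / (\<epsilon> * \<eta>)))\<^sup>2 * ln (2 / \<eta>) * ln (2 * K) + ln (1 / \<sigma>)"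
    have "W \<le> 2160000 * Y" using W by (simp only: W_def \<tau>_def Y_def)
    moreover have "d' = 10 ^ 16 * Y" by (simp only: d' Y_def)
    ultimately show ?thesis using W2 by simp
  qed
  define n where "n = nat \<lceil>64 * W\<rceil>"
  have n: "64 * W \<le> real n" "real n \<le> 64 * W + 1" using W2 by (auto simp: n_def)
  have n1: "1 \<le> n" using n W2 by linarith
  \<comment> \<open>Equal to the bound for \<open>2 * (1 / 4) ^ k\<close>, so that both spectral
    contributions have the same size.\<close>
  define \<nu> where "\<nu> = \<epsilon> * sqrt \<eta> / 4"
  have sq: "0 < sqrt \<eta>" "sqrt \<eta> \<le> 1" using \<eta>0 \<eta>(2) by auto
  have \<nu>0: "0 < \<nu>" using \<epsilon> sq by (simp add: \<nu>_def)
  have "\<epsilon> * sqrt \<eta> \<le> 1 * 1" using \<epsilon> sq by (intro mult_mono) auto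
  hence \<nu>1: "\<nu> \<le> 1" by (simp add: \<nu>_def)
  define D where "D = real (card \<Gamma>)"
  have D: "1 \<le> D" using d by (simp add: D_def)
  define r1 where "r1 = r * \<nu> / (100000 * D\<^sup>2 * real n)"
  have "\<exists>\<Lambda> \<subseteq> characters G. real (card \<Lambda>) \<le> 64 * ln (2 / \<tau>) \<and>
    (\<forall>\<gamma>\<in>large_spectrum T. \<forall>u\<in>bohr_set G (Bohr (\<Gamma> \<union> \<Lambda>) r1). cmod (\<gamma> u - 1) \<le> \<nu>)"
    unfolding r1_def D_def
  proof (rule chang_sanders[OF \<Gamma>(1) d r(1,2)])
    show "card (bohr_set G (Bohr \<Gamma> ((1 + 1 / (12 * real (card \<Gamma>))) * r))) \<le> 2 * card (bohr_set G (Bohr \<Gamma> r))"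
      unfolding r_def by (rule regular_bohr_growth[OF reg d])
    show "T \<subseteq> bohr_set G (Bohr \<Gamma> r)" using T(1) S by (simp add: Br B_def)
    show "\<tau> * real (card (bohr_set G (Bohr \<Gamma> r))) \<le> real (card T)" using \<tau>T by (simp add: Br)
    show "64 * ln (2 / \<tau>) \<le> real n" using n by (simp add: W_def)
  qed (fact Tne \<tau> \<nu>0 \<nu>1 n1)+
  then obtain \<Lambda> where \<Lambda>: "\<Lambda> \<subseteq> characters G" "real (card \<Lambda>) \<le> 64 * W"
    and spec: "\<And>\<gamma> u. \<lbrakk>\<gamma> \<in> large_spectrum T; u \<in> bohr_set G (Bohr (\<Gamma> \<union> \<Lambda>) r1)\<rbrakk> \<Longrightarrow> cmod (\<gamma> u - 1) \<le> \<nu>"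
    unfolding W_def by blast
  let ?\<Gamma> = "\<Gamma> \<union> \<Lambda>"
  have \<Gamma>': "?\<Gamma> \<subseteq> characters G" using \<Gamma> \<Lambda> by simp
  have fin: "finite ?\<Gamma>" using finite_subset[OF \<Gamma>' finite_characters] .
  have "card \<Gamma> \<le> card ?\<Gamma>" using fin by (intro card_mono) auto
  hence d'1: "1 \<le> card ?\<Gamma>" using d by simp
  have r10: "0 \<le> r1" using r \<nu>0 by (simp add: r1_def)
  obtain \<rho>' where \<rho>': "r1 / 8 \<le> \<rho>'" "\<rho>' \<le> r1" and reg': "regular_bohr G (Bohr ?\<Gamma> \<rho>')"
    using regular_bohr_exists[OF \<Gamma>' d'1 r10] by blast
  have "\<bar>tri_conv A M L (x \<otimes> u) - tri_conv A M L x\<bar> \<le> \<epsilon> * real (card M)"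
    if u: "u \<in> bohr_set G (Bohr ?\<Gamma> \<rho>')" and x: "x \<in> carrier G" for u x
  proof -
    have u1: "u \<in> bohr_set G (Bohr ?\<Gamma> r1)" using u bohr_mono[OF \<rho>'(2)] by blast
    have uc: "u \<in> carrier G" using u by (simp add: mem_bohr)
    have "\<bar>tri_conv A M L (x \<otimes> u) - tri_conv A M L x\<bar>
      \<le> 2 * real k * (2 * c * real (card M)) + (2 * (1 / 4) ^ k + \<nu>) * sqrt (real (card M) * real (card L))"
      using \<nu>0 spec[OF _ u1]
      by (intro tri_conv_translate_bound[OF A(1) M L(1) Tc Tne period _ _ x uc]) auto
    also have "2 * real k * (2 * c * real (card M)) = \<epsilon> / 2 * real (card M)" using k by (simp add: c_def)
    also have "(2 * (1 / 4) ^ k + \<nu>) * sqrt (real (card M) * real (card L)) \<le> (\<epsilon> * sqrt \<eta> / 2) * sqrt (real (card M) * real (card L))"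
      using quarter by (intro mult_right_mono) (auto simp: \<nu>_def)
    also have "(\<epsilon> * sqrt \<eta> / 2) * sqrt (real (card M) * real (card L)) = \<epsilon> / 2 * real (card M)"
    proof -
      have "sqrt \<eta> * sqrt (real (card M) * real (card L)) = sqrt (real (card M) * real (card M))"
        unfolding real_sqrt_mult[symmetric] using cL by (simp add: \<eta>)
      thus ?thesis by simp
    qed
    finally show ?thesis by simp
  qed
  moreover have "\<rho>' \<le> \<rho>"
  proof -
    have "1 * 1 \<le> D\<^sup>2 * real n" using D n1 by (intro mult_mono) (auto simp: one_le_power)
    hence "1 \<le> 100000 * D\<^sup>2 * real n" by simp
    hence "r1 \<le> r * \<nu> / 1" unfolding r1_def using r \<nu>0 D n1 by (intro divide_left_mono) auto
    also have "\<dots> \<le> r" using r \<nu>1 \<nu>0 by (simp add: mult_left_le)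
    finally show ?thesis using \<rho>' r by linarith
  qed
  moreover have "real (card ?\<Gamma>) \<le> real (card \<Gamma>) + d'"
  proof -
    have "real (card ?\<Gamma>) \<le> real (card \<Gamma>) + real (card \<Lambda>)" using card_Un_le[of \<Gamma> \<Lambda>] by linarith
    thus ?thesis using \<Lambda>(2) Wd' W2 by linarith
  qed
  moreover have "r * \<epsilon> * sqrt \<eta> / (D\<^sup>2 * d') \<le> \<rho>'"
  proof -
    \<comment> \<open>\<open>3200000 = 8 * 100000 * 4\<close> collects the losses from the regular
      radius, from \<open>r1\<close> and from \<open>\<nu>\<close>.\<close>
    have "3200000 * real n \<le> d'" "0 < d'" using n Wd' W2 by linarith+
    hence "D\<^sup>2 * (3200000 * real n) \<le> D\<^sup>2 * d'" by (intro mult_left_mono) auto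
    moreover have "0 < D\<^sup>2 * (3200000 * real n)" using D n1 by simp
    ultimately have "r * \<epsilon> * sqrt \<eta> / (D\<^sup>2 * d') \<le> r * \<epsilon> * sqrt \<eta> / (D\<^sup>2 * (3200000 * real n))"
      using r \<epsilon> sq D n1 \<open>0 < d'\<close> by (intro divide_left_mono mult_pos_pos) auto
    also have "\<dots> = r1 / 8" by (simp add: r1_def \<nu>_def mult_ac)
    finally show ?thesis using \<rho>'(1) by linarith
  qed
  ultimately show ?thesis using reg'
    by (intro exI[of _ ?\<Gamma>] exI[of _ \<rho>']) (auto simp: r_def D_def)
qed

end

theorem theorem5p4:
  "\<exists>C::real. C > 0 \<and>
    (\<forall>(\<epsilon>::real) (G :: 'a monoid) A M L S (B :: 'a bohr) (K::real) (\<sigma>::real) (d::nat) (\<rho>::real) (\<eta>::real) (d'::real).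
      0 < \<epsilon> \<and> \<epsilon> < 1 \<and>
      comm_group G \<and> finite (carrier G) \<and>
      A \<subseteq> carrier G \<and> M \<subseteq> carrier G \<and> L \<subseteq> carrier G \<and>
      A \<noteq> {} \<and> M \<noteq> {} \<and> L \<noteq> {} \<and>
      regular_bohr G B \<and> d = bohr_rank B \<and> d \<ge> 1 \<and> \<rho> = radius B \<and>
      S \<subseteq> bohr_set G B \<and>
      real (card (A <#>\<^bsub>G\<^esub> S)) \<le> K * real (card A) \<and>
      real (card S) / real (card (bohr_set G B)) \<ge> \<sigma> \<and> \<sigma> > 0 \<and>
      \<eta> = real (card M) / real (card L) \<and> \<eta> \<le> 1 \<and>
      d' = C * ((1 / \<epsilon>\<^sup>2) * (ln (2 / (\<epsilon> * \<eta>)))\<^sup>2 * ln (2 / \<eta>) * ln (2 * K) + ln (1 / \<sigma>))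
      \<longrightarrow>
      (\<exists>B' :: 'a bohr.
        regular_bohr G B' \<and> sub_bohr B' B \<and>
        real (bohr_rank B') \<le> real d + d' \<and>
        radius B' \<ge> min \<rho> 2 * \<epsilon> * sqrt \<eta> / ((real d)\<^sup>2 * d') \<and>
        (\<forall>t\<in>bohr_set G B'.
          sup_norm G (\<lambda>x. (indicat_real A \<star>\<^bsub>G\<^esub> indicat_real M \<star>\<^bsub>G\<^esub> indicat_real L) (x \<otimes>\<^bsub>G\<^esub> t)
                        - (indicat_real A \<star>\<^bsub>G\<^esub> indicat_real M \<star>\<^bsub>G\<^esub> indicat_real L) x)
            \<le> \<epsilon> * real (card A) * real (card M)) \<and>
        sup_norm G (\<lambda>x. (indicat_real A \<star>\<^bsub>G\<^esub> indicat_real M \<star>\<^bsub>G\<^esub> indicat_real L \<star>\<^bsub>G\<^esub> unif (bohr_set G B')) x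
                      - (indicat_real A \<star>\<^bsub>G\<^esub> indicat_real M \<star>\<^bsub>G\<^esub> indicat_real L) x)
          \<le> \<epsilon> * real (card A) * real (card M)))"
proof (intro exI[of _ "10 ^ 16"] conjI allI impI, goal_cases)
  case 1
  show ?case by simp
next
  case (2 \<epsilon> G A M L S B K \<sigma> d \<rho> \<eta> d')
  then have asm: "0 < \<epsilon>" "\<epsilon> < 1" "A \<subseteq> carrier G" "M \<subseteq> carrier G" "L \<subseteq> carrier G"
      "A \<noteq> {}" "M \<noteq> {}" "L \<noteq> {}" "regular_bohr G B" "d = bohr_rank B" "d \<ge> 1" "\<rho> = radius B"
      "S \<subseteq> bohr_set G B" "real (card (A <#>\<^bsub>G\<^esub> S)) \<le> K * real (card A)"
      "real (card S) / real (card (bohr_set G B)) \<ge> \<sigma>" "\<sigma> > 0"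
      "\<eta> = real (card M) / real (card L)" "\<eta> \<le> 1"
      "d' = 10 ^ 16 * ((1 / \<epsilon>\<^sup>2) * (ln (2 / (\<epsilon> * \<eta>)))\<^sup>2 * ln (2 / \<eta>) * ln (2 * K) + ln (1 / \<sigma>))"
    and G: "comm_group G" "finite (carrier G)" by blast+
  interpret finite_comm_group G
    using G by (simp add: finite_comm_group_def finite_comm_group_axioms_def)
  define \<Gamma> where "\<Gamma> = freqs B"
  have B: "B = Bohr \<Gamma> \<rho>" by (simp add: \<Gamma>_def asm)
  have d: "d = card \<Gamma>" by (simp add: asm(10) bohr_rank_def \<Gamma>_def)
  obtain \<Gamma>' \<rho>' where reg: "regular_bohr G (Bohr \<Gamma>' \<rho>')" and sub: "\<Gamma> \<subseteq> \<Gamma>'" "\<rho>' \<le> \<rho>"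
    and rank: "real (card \<Gamma>') \<le> real (card \<Gamma>) + d'"
    and radius: "min \<rho> 2 * \<epsilon> * sqrt \<eta> / ((real (card \<Gamma>))\<^sup>2 * d') \<le> \<rho>'"
    and period: "\<And>u x. \<lbrakk>u \<in> bohr_set G (Bohr \<Gamma>' \<rho>'); x \<in> carrier G\<rbrakk> \<Longrightarrow>
       \<bar>tri_conv A M L (x \<otimes>\<^bsub>G\<^esub> u) - tri_conv A M L x\<bar> \<le> \<epsilon> * real (card M)"
    using almost_period_bohr[OF asm(1,2) asm(3,6) asm(4,7) asm(5,8) asm(9)[unfolded B]
        asm(11)[unfolded d] asm(13)[unfolded B] asm(14) asm(15)[unfolded B] asm(16,17,18,19)] by blast
  let ?X = "bohr_set G (Bohr \<Gamma>' \<rho>')"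
  let ?f = "indicat_real A \<star>\<^bsub>G\<^esub> indicat_real M \<star>\<^bsub>G\<^esub> indicat_real L"
  have \<Gamma>': "\<Gamma>' \<subseteq> characters G" "0 \<le> \<rho>'" using reg by (auto simp: regular_bohr_def is_bohr_def)
  have f: "\<bar>?f (x \<otimes>\<^bsub>G\<^esub> u) - ?f x\<bar> \<le> \<epsilon> * real (card A) * real (card M)" if u: "u \<in> ?X" and x: "x \<in> carrier G" for u x
  proof -
    have "x \<otimes>\<^bsub>G\<^esub> u \<in> carrier G" using u x by (simp add: mem_bohr)
    hence "?f (x \<otimes>\<^bsub>G\<^esub> u) - ?f x = real (card A) * (tri_conv A M L (x \<otimes>\<^bsub>G\<^esub> u) - tri_conv A M L x)"
      using x by (simp add: convol_indicators[OF asm(3,6,4)] right_diff_distrib)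
    hence "\<bar>?f (x \<otimes>\<^bsub>G\<^esub> u) - ?f x\<bar> = real (card A) * \<bar>tri_conv A M L (x \<otimes>\<^bsub>G\<^esub> u) - tri_conv A M L x\<bar>"
      by (simp add: abs_mult)
    also have "\<dots> \<le> real (card A) * (\<epsilon> * real (card M))" using period[OF u x] by (intro mult_left_mono) auto
    finally show ?thesis by (simp add: mult_ac)
  qed
  \<comment> \<open>Convolution with the uniform measure averages translates by inverses of elements
    of the Bohr set, which lie in it as well; so the pointwise bound carries over.\<close>
  have "\<bar>(?f \<star>\<^bsub>G\<^esub> unif ?X) x - ?f x\<bar> \<le> \<epsilon> * real (card A) * real (card M)" if x: "x \<in> carrier G" for x
    unfolding convol_unif[OF bohr_subset x]
  proof (rule smear_close[OF bohr_subset])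
    show "?X \<noteq> {}" using one_in_bohr[OF \<Gamma>'] by blast
    show "\<bar>?f (x \<otimes>\<^bsub>G\<^esub> inv\<^bsub>G\<^esub> z) - ?f x\<bar> \<le> \<epsilon> * real (card A) * real (card M)" if "z \<in> ?X" for z
      by (rule f[OF bohr_inv[OF \<Gamma>'(1) that] x])
  qed
  thus ?case
    using reg sub rank radius f unfolding d B
    by (intro exI[of _ "Bohr \<Gamma>' \<rho>'"] conjI ballI sup_norm_le) (simp_all add: sub_bohr_def bohr_rank_def)
qed

end
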